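(* Let $\mathbf K$ be a rigidly-compactly-generated monoidal triangulated category such that $\mathbf K^c$ is $\mathrm{Spc}$-Noetherian. Suppose that $\widehat\sigma$ is a faithful and tensorial extension of the Balmer support $\mathrm{supp}^{\rm B}$ from $\mathbf K^c$ to $\mathbf K$. Then $\widehat\sigma=\mathrm{Supp}^{\rm B}$.
   Context: Setting. A rigidly-compactly-generated ("big") monoidal triangulated category $\mathbf K$ satisfies: it is triangulated with shift $\Sigma$ and has all set-indexed coproducts; it is the smallest localizing subcategory of itself containing the full subcategory $\mathbf K^c$ of compact objects; it has a monoidal structure $(\otimes,\mathbf 1)$, exact in each variable, with $\otimes$ commuting with set-indexed coproducts in each variable; $\mathbf 1\in\mathbf K^c$ and $\mathbf K^c$ is closed under $\otimes$; every object of $\mathbf K^c$ has a left and a right dual. No symmetry or braiding is assumed. Thick subcategory: full triangulated subcategory closed under direct summands. Localizing subcategory: thick and closed under set-indexed coproducts. Balmer spectrum. A thick ideal of $\mathbf K^c$ is a thick subcategory closed under tensoring on either side with objects of $\mathbf K^c$. A proper thick ideal $\mathbf P$ is prime if for thick ideals $\mathbf I,\mathbf J$ of $\mathbf K^c$, $\mathbf I\otimes\mathbf J\subseteq\mathbf P$ implies $\mathbf I\subseteq\mathbf P$ or $\mathbf J\subseteq\mathbf P$. $\mathrm{Spc}\,\mathbf K^c$ is the set of prime ideals, with closed sets $\{\mathbf P:\mathbf P\cap\mathbf S=\varnothing\}$ for collections $\mathbf S$ of objects of $\mathbf K^c$; the Balmer support is $\mathrm{supp}^{\rm B}(A)=\{\mathbf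 P:A\notin\mathbf P\}$. $\mathbf K^c$ is $\mathrm{Spc}$-Noetherian if $\mathrm{Spc}\,\mathbf K^c$ is a Noetherian space. Extensions. An extension of $\mathrm{supp}^{\rm B}$ to $\mathbf K$ is a map $\tau$ from objects of $\mathbf K$ to (arbitrary) subsets of $\mathrm{Spc}\,\mathbf K^c$ with: $\tau(A)=\mathrm{supp}^{\rm B}(A)$ for $A$ compact; $\tau(\coprod_iA_i)=\bigcup_i\tau(A_i)$ for set-indexed families; $\tau(\Sigma A)=\tau(A)$; $\tau(A)\subseteq\tau(B)\cup\tau(C)$ for distinguished triangles $A\to B\to C\to\Sigma A$ in $\mathbf K$; $\tau(A\otimes B)\subseteq\tau(A)\cap\tau(B)$ for all $A,B\in\mathbf K$. It is tensorial if $\bigcup_{B\in\mathbf K^c}\tau(A\otimes B\otimes C)=\tau(A)\cap\tau(C)$ for all $A\in\mathbf K$, $C\in\mathbf K^c$; faithful if $\tau(A)=\varnothing$ implies $A\cong0$ for all $A\in\mathbf K$. Rickard idempotents. For a thick ideal $\mathbf I$ of $\mathbf K^c$, let $\mathrm{Loc}(\mathbf I)$ be the smallest localizing subcategory of $\mathbf K$ containing $\mathbf I$; $\Gamma_{\mathbf I},L_{\mathbf I}:\mathbf K\to\mathbf K$ are the unique functors with distinguished triangles $\Gamma_{\mathbf I}A\to A\to L_{\mathbf I}A\to\Sigma\Gamma_{\mathbf I}A$, where $\Gamma_{\mathbf I}A\in\mathrm{Loc}(\mathbf I)$ and $\mathrm{Hom}_{\mathbf K}(B,L_{\mathbf I}A)=0$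 for all $B\in\mathrm{Loc}(\mathbf I)$. For $S\subseteq\mathrm{Spc}\,\mathbf K^c$ specialization-closed, $\Theta(S)=\{A\in\mathbf K^c:\mathrm{supp}^{\rm B}(A)\subseteq S\}$, $\Gamma_S=\Gamma_{\Theta(S)}$, $L_S=L_{\Theta(S)}$. For a point $\mathbf P\in\mathrm{Spc}\,\mathbf K^c$: $\mathcal V(\mathbf P)=\overline{\{\mathbf P\}}$, $\mathcal Z(\mathbf P)=\{\mathbf Q:\mathbf P\notin\overline{\{\mathbf Q\}}\}$, and (treating $\mathbf P$ as a point) $\Gamma_{\mathbf P}A=\Gamma_{\mathcal V(\mathbf P)}\mathbf 1\otimes L_{\mathcal Z(\mathbf P)}\mathbf 1\otimes A$. Finally $\mathrm{Supp}^{\rm B}(A)=\{\mathbf P\in\mathrm{Spc}\,\mathbf K^c:\Gamma_{\mathbf P}A\not\cong0\}$ for $A\in\mathbf K$. *)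

theory Defs
  imports "HOL-Algebra.Free_Abelian_Groups" "HOL-Analysis.Abstract_Topology"
begin

unbundle cardinal_syntax

section \<open>Small sets\<close>

text \<open>
  The size convention is carried by a cardinal \<open>\<kappa>\<close>: the (small) sets indexing coproducts are the sets
  \<open>I :: 'i set\<close> of cardinality less than \<open>\<kappa>\<close>.  For an inaccessible \<open>\<kappa>\<close> these are, up to bijection,
  the members of a Grothendieck universe.  Of an inaccessible cardinal only uncountability and
  regularity are asked for, so that successor cardinals are covered as well.
\<close>

definition size_bound :: "'i rel \<Rightarrow> bool" where
  "size_bound \<kappa> \<longleftrightarrow> Card_order \<kappa> \<and> regularCard \<kappa> \<and> natLeq <o \<kappa>"

definition small :: "'i rel \<Rightarrow> 'a set \<Rightarrow> bool" where
  "small \<kappa> I \<longleftrightarrow> |I| <o \<kappa>"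


section \<open>Additive categories\<close>

text \<open>
  The morphisms from \<open>A\<close> to \<open>B\<close> form an abelian group \<open>HomG K A B\<close>.  As it is a \<open>monoid\<close> record,
  its addition is written \<open>\<otimes>\<close> and its zero \<open>\<one>\<close>, as in \<open>HOL-Algebra\<close>; the tensor product of \<open>K\<close> will
  be written \<open>\<boxtimes>\<close>.  Morphism sets of different pairs of objects are disjoint, so composition needs
  no object arguments.
\<close>

record ('o, 'm) precat =
  Ob :: "'o set"
  HomG :: "'o \<Rightarrow> 'o \<Rightarrow> 'm monoid"
  ident :: "'o \<Rightarrow> 'm"
  cmp :: "'m \<Rightarrow> 'm \<Rightarrow> 'm"  (infixr \<open>\<cdot>\<index>\<close> 72)

abbreviation Hom :: "('o, 'm, 'x) precat_scheme \<Rightarrow> 'o \<Rightarrow> 'o \<Rightarrow> 'm set" where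
  "Hom K A B \<equiv> carrier (HomG K A B)"

abbreviation zeroarr :: "('o, 'm, 'x) precat_scheme \<Rightarrow> 'o \<Rightarrow> 'o \<Rightarrow> 'm" where
  "zeroarr K A B \<equiv> \<one>\<^bsub>HomG K A B\<^esub>"

locale preadditive_category =
  fixes K :: "('o, 'm, 'x) precat_scheme" (structure)
  assumes Hom_group: "\<lbrakk>A \<in> Ob K; B \<in> Ob K\<rbrakk> \<Longrightarrow> comm_group (HomG K A B)"
    and Hom_disjoint: "\<lbrakk>A \<in> Ob K; B \<in> Ob K; A' \<in> Ob K; B' \<in> Ob K; f \<in> Hom K A B; f \<in> Hom K A' B'\<rbrakk>
      \<Longrightarrow> A = A' \<and> B = B'"
    and ident_Hom: "A \<in> Ob K \<Longrightarrow> ident K A \<in> Hom K A A"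
    and cmp_hom_right: "\<lbrakk>A \<in> Ob K; B \<in> Ob K; C \<in> Ob K; g \<in> Hom K B C\<rbrakk>
      \<Longrightarrow> (\<lambda>f. g \<cdot> f) \<in> hom (HomG K A B) (HomG K A C)"
    and cmp_hom_left: "\<lbrakk>A \<in> Ob K; B \<in> Ob K; C \<in> Ob K; f \<in> Hom K A B\<rbrakk>
      \<Longrightarrow> (\<lambda>g. g \<cdot> f) \<in> hom (HomG K B C) (HomG K A C)"
    and cmp_assoc: "\<lbrakk>A \<in> Ob K; B \<in> Ob K; C \<in> Ob K; D \<in> Ob K;
        f \<in> Hom K A B; g \<in> Hom K B C; h \<in> Hom K C D\<rbrakk> \<Longrightarrow> h \<cdot> (g \<cdot> f) = (h \<cdot> g) \<cdot> f"
    and ident_cmp: "\<lbrakk>A \<in> Ob K; B \<in> Ob K; f \<in> Hom K A B\<rbrakk> \<Longrightarrow> ident K B \<cdot> f = f"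
    and cmp_ident: "\<lbrakk>A \<in> Ob K; B \<in> Ob K; f \<in> Hom K A B\<rbrakk> \<Longrightarrow> f \<cdot> ident K A = f"

definition inverse_arrows :: "('o, 'm, 'x) precat_scheme \<Rightarrow> 'o \<Rightarrow> 'o \<Rightarrow> 'm \<Rightarrow> 'm \<Rightarrow> bool" where
  "inverse_arrows K A B f g \<longleftrightarrow>
     f \<in> Hom K A B \<and> g \<in> Hom K B A \<and> g \<cdot>\<^bsub>K\<^esub> f = ident K A \<and> f \<cdot>\<^bsub>K\<^esub> g = ident K B"

definition iso_arrow :: "('o, 'm, 'x) precat_scheme \<Rightarrow> 'o \<Rightarrow> 'o \<Rightarrow> 'm \<Rightarrow> bool" where
  "iso_arrow K A B f \<longleftrightarrow> (\<exists>g. inverse_arrows K A B f g)"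

definition inv_arrow :: "('o, 'm, 'x) precat_scheme \<Rightarrow> 'o \<Rightarrow> 'o \<Rightarrow> 'm \<Rightarrow> 'm" where
  "inv_arrow K A B f = (THE g. inverse_arrows K A B f g)"

definition isomorphic :: "('o, 'm, 'x) precat_scheme \<Rightarrow> 'o \<Rightarrow> 'o \<Rightarrow> bool" where
  "isomorphic K A B \<longleftrightarrow> (\<exists>f. iso_arrow K A B f)"

text \<open>\<open>zero_object K A\<close> is what \<open>A \<cong> 0\<close> means.\<close>

definition zero_object :: "('o, 'm, 'x) precat_scheme \<Rightarrow> 'o \<Rightarrow> bool" where
  "zero_object K Z \<longleftrightarrow> Z \<in> Ob K \<and> (\<forall>A\<in>Ob K. (\<exists>!f. f \<in> Hom K A Z) \<and> (\<exists>!f. f \<in> Hom K Z A))"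

definition biproduct ::
    "('o, 'm, 'x) precat_scheme \<Rightarrow> 'o \<Rightarrow> 'o \<Rightarrow> 'o \<Rightarrow> 'm \<Rightarrow> 'm \<Rightarrow> 'm \<Rightarrow> 'm \<Rightarrow> bool" where
  "biproduct K A B X i j p q \<longleftrightarrow>
     A \<in> Ob K \<and> B \<in> Ob K \<and> X \<in> Ob K \<and>
     i \<in> Hom K A X \<and> j \<in> Hom K B X \<and> p \<in> Hom K X A \<and> q \<in> Hom K X B \<and>
     p \<cdot>\<^bsub>K\<^esub> i = ident K A \<and> q \<cdot>\<^bsub>K\<^esub> j = ident K B \<and>
     p \<cdot>\<^bsub>K\<^esub> j = zeroarr K B A \<and> q \<cdot>\<^bsub>K\<^esub> i = zeroarr K A B \<and>
     (i \<cdot>\<^bsub>K\<^esub> p) \<otimes>\<^bsub>HomG K X X\<^esub> (j \<cdot>\<^bsub>K\<^esub> q) = ident K X"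

locale additive_category = preadditive_category +
  assumes zero_exists: "\<exists>Z. zero_object K Z"
    and biproduct_exists: "\<lbrakk>A \<in> Ob K; B \<in> Ob K\<rbrakk> \<Longrightarrow> \<exists>X i j p q. biproduct K A B X i j p q"

definition coproduct ::
    "('o, 'm, 'x) precat_scheme \<Rightarrow> 'i set \<Rightarrow> ('i \<Rightarrow> 'o) \<Rightarrow> 'o \<Rightarrow> ('i \<Rightarrow> 'm) \<Rightarrow> bool" where
  "coproduct K I A X \<iota> \<longleftrightarrow>
     X \<in> Ob K \<and> (\<forall>i\<in>I. A i \<in> Ob K \<and> \<iota> i \<in> Hom K (A i) X) \<and>
     (\<forall>Y\<in>Ob K. \<forall>g. (\<forall>i\<in>I. g i \<in> Hom K (A i) Y) \<longrightarrow>
        (\<exists>!h. h \<in> Hom K X Y \<and> (\<forall>i\<in>I. h \<cdot>\<^bsub>K\<^esub> \<iota> i = g i)))"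

text \<open>
  Compactness: for every small family \<open>A\<close> the canonical map from the direct sum of the groups
  \<open>Hom(C, A\<^sub>i)\<close> to \<open>Hom(C, \<Coprod>A\<^sub>i)\<close> is an isomorphism.
\<close>

definition cpt :: "'i rel \<Rightarrow> ('o, 'm, 'x) precat_scheme \<Rightarrow> 'o set" where
  "cpt \<kappa> K = {C \<in> Ob K. \<forall>(I::'i set) A X \<iota>. small \<kappa> I \<and> coproduct K I A X \<iota> \<longrightarrow>
     (\<lambda>g. gfinprod (HomG K C X) (\<lambda>i. \<iota> i \<cdot>\<^bsub>K\<^esub> g i) I)
       \<in> iso (sum_group I (\<lambda>i. HomG K C (A i))) (HomG K C X)}"

definition additive_functor ::
    "('o, 'm, 'x) precat_scheme \<Rightarrow> ('o \<Rightarrow> 'o) \<Rightarrow> ('m \<Rightarrow> 'm) \<Rightarrow> bool" where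
  "additive_functor K F Fm \<longleftrightarrow>
     (\<forall>A\<in>Ob K. F A \<in> Ob K \<and> Fm (ident K A) = ident K (F A)) \<and>
     (\<forall>A\<in>Ob K. \<forall>B\<in>Ob K. Fm \<in> hom (HomG K A B) (HomG K (F A) (F B))) \<and>
     (\<forall>A\<in>Ob K. \<forall>B\<in>Ob K. \<forall>C\<in>Ob K. \<forall>f\<in>Hom K A B. \<forall>g\<in>Hom K B C.
        Fm (g \<cdot>\<^bsub>K\<^esub> f) = Fm g \<cdot>\<^bsub>K\<^esub> Fm f)"


section \<open>Triangulated categories\<close>

text \<open>\<open>dist K A B C f g h\<close>: the triangle \<open>A \<rightarrow> B \<rightarrow> C \<rightarrow> \<Sigma>A\<close> with maps \<open>f, g, h\<close> is distinguished.\<close>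

record ('o, 'm) tricat = "('o, 'm) precat" +
  sh :: "'o \<Rightarrow> 'o"
  shm :: "'m \<Rightarrow> 'm"
  dist :: "'o \<Rightarrow> 'o \<Rightarrow> 'o \<Rightarrow> 'm \<Rightarrow> 'm \<Rightarrow> 'm \<Rightarrow> bool"

locale triangulated_category = additive_category K
  for K :: "('o, 'm, 'x) tricat_scheme" (structure) +
  assumes sh_functor: "additive_functor K (sh K) (shm K)"
    and sh_fully_faithful: "\<lbrakk>A \<in> Ob K; B \<in> Ob K\<rbrakk>
      \<Longrightarrow> bij_betw (shm K) (Hom K A B) (Hom K (sh K A) (sh K B))"
    and sh_ess_surj: "A \<in> Ob K \<Longrightarrow> \<exists>B\<in>Ob K. isomorphic K (sh K B) A"
    and dist_wf: "dist K A B C f g h \<Longrightarrow> A \<in> Ob K \<and> B \<in> Ob K \<and> C \<in> Ob K \<and>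
      f \<in> Hom K A B \<and> g \<in> Hom K B C \<and> h \<in> Hom K C (sh K A)"
    and TR1_ident: "\<lbrakk>A \<in> Ob K; zero_object K Z\<rbrakk>
      \<Longrightarrow> dist K A A Z (ident K A) (zeroarr K A Z) (zeroarr K Z (sh K A))"
    and TR1_cone: "\<lbrakk>A \<in> Ob K; B \<in> Ob K; f \<in> Hom K A B\<rbrakk> \<Longrightarrow> \<exists>C g h. dist K A B C f g h"
    and TR1_iso: "\<lbrakk>dist K A B C f g h; A' \<in> Ob K; B' \<in> Ob K; C' \<in> Ob K;
        f' \<in> Hom K A' B'; g' \<in> Hom K B' C'; h' \<in> Hom K C' (sh K A');
        iso_arrow K A A' a; iso_arrow K B B' b; iso_arrow K C C' c;
        b \<cdot> f = f' \<cdot> a; c \<cdot> g = g' \<cdot> b; shm K a \<cdot> h = h' \<cdot> c\<rbrakk>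
      \<Longrightarrow> dist K A' B' C' f' g' h'"
    and TR2: "\<lbrakk>A \<in> Ob K; B \<in> Ob K; C \<in> Ob K; f \<in> Hom K A B; g \<in> Hom K B C; h \<in> Hom K C (sh K A)\<rbrakk>
      \<Longrightarrow> dist K A B C f g h \<longleftrightarrow> dist K B C (sh K A) g h (inv\<^bsub>HomG K (sh K A) (sh K B)\<^esub> shm K f)"
    and TR3: "\<lbrakk>dist K A B C f g h; dist K A' B' C' f' g' h';
        a \<in> Hom K A A'; b \<in> Hom K B B'; b \<cdot> f = f' \<cdot> a\<rbrakk>
      \<Longrightarrow> \<exists>c\<in>Hom K C C'. c \<cdot> g = g' \<cdot> b \<and> shm K a \<cdot> h = h' \<cdot> c"
    and TR4: "\<lbrakk>dist K X Y Z' f f1 f2; dist K Y Z X' g g1 g2; dist K X Z Y' (g \<cdot> f) h1 h2\<rbrakk>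
      \<Longrightarrow> \<exists>u\<in>Hom K Z' Y'. \<exists>v\<in>Hom K Y' X'. dist K Z' Y' X' u v (shm K f1 \<cdot> g2) \<and>
            u \<cdot> f1 = h1 \<cdot> g \<and> v \<cdot> h1 = g1 \<and> h2 \<cdot> u = f2 \<and> g2 \<cdot> v = shm K f \<cdot> h2"

definition exact_functor ::
    "('o, 'm, 'x) tricat_scheme \<Rightarrow> ('o \<Rightarrow> 'o) \<Rightarrow> ('m \<Rightarrow> 'm) \<Rightarrow> bool" where
  "exact_functor K F Fm \<longleftrightarrow> additive_functor K F Fm \<and>
     (\<exists>\<phi>. (\<forall>A\<in>Ob K. iso_arrow K (F (sh K A)) (sh K (F A)) (\<phi> A)) \<and>
          (\<forall>A\<in>Ob K. \<forall>B\<in>Ob K. \<forall>f\<in>Hom K A B.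
             \<phi> B \<cdot>\<^bsub>K\<^esub> Fm (shm K f) = shm K (Fm f) \<cdot>\<^bsub>K\<^esub> \<phi> A) \<and>
          (\<forall>A B C f g h. dist K A B C f g h \<longrightarrow>
             dist K (F A) (F B) (F C) (Fm f) (Fm g) (\<phi> A \<cdot>\<^bsub>K\<^esub> Fm h)))"

text \<open>Full subcategories are given by their sets of objects.\<close>

definition triangulated_sub :: "('o, 'm, 'x) tricat_scheme \<Rightarrow> 'o set \<Rightarrow> bool" where
  "triangulated_sub K S \<longleftrightarrow> S \<subseteq> Ob K \<and> S \<noteq> {} \<and>
     (\<forall>A\<in>S. \<forall>B\<in>Ob K. isomorphic K A B \<longrightarrow> B \<in> S) \<and>
     (\<forall>A\<in>Ob K. sh K A \<in> S \<longleftrightarrow> A \<in> S) \<and>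
     (\<forall>A B C f g h. dist K A B C f g h \<and> A \<in> S \<and> B \<in> S \<longrightarrow> C \<in> S)"

definition thick :: "('o, 'm, 'x) tricat_scheme \<Rightarrow> 'o set \<Rightarrow> bool" where
  "thick K S \<longleftrightarrow> triangulated_sub K S \<and>
     (\<forall>A B X i j p q. biproduct K A B X i j p q \<and> X \<in> S \<longrightarrow> A \<in> S \<and> B \<in> S)"

definition localizing :: "'i rel \<Rightarrow> ('o, 'm, 'x) tricat_scheme \<Rightarrow> 'o set \<Rightarrow> bool" where
  "localizing \<kappa> K S \<longleftrightarrow> thick K S \<and>
     (\<forall>(I::'i set) A X \<iota>. small \<kappa> I \<and> coproduct K I A X \<iota> \<and> (\<forall>i\<in>I. A i \<in> S) \<longrightarrow> X \<in> S)"

definition Loc :: "'i rel \<Rightarrow> ('o, 'm, 'x) tricat_scheme \<Rightarrow> 'o set \<Rightarrow> 'o set" where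
  "Loc \<kappa> K G = \<Inter>{S. localizing \<kappa> K S \<and> G \<subseteq> S}"


section \<open>Rigidly-compactly-generated monoidal triangulated categories\<close>

record ('o, 'm) mtcat = "('o, 'm) tricat" +
  tens :: "'o \<Rightarrow> 'o \<Rightarrow> 'o"  (infixl \<open>\<boxtimes>\<index>\<close> 75)
  tensm :: "'m \<Rightarrow> 'm \<Rightarrow> 'm"  (infixl \<open>\<boxdot>\<index>\<close> 75)
  unt :: "'o"
  asc :: "'o \<Rightarrow> 'o \<Rightarrow> 'o \<Rightarrow> 'm"
  lun :: "'o \<Rightarrow> 'm"
  run :: "'o \<Rightarrow> 'm"

locale monoidal_triangulated_category = triangulated_category K
  for K :: "('o, 'm, 'x) mtcat_scheme" (structure) +
  assumes unt_Ob: "unt K \<in> Ob K"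
    and tens_Ob: "\<lbrakk>A \<in> Ob K; B \<in> Ob K\<rbrakk> \<Longrightarrow> A \<boxtimes> B \<in> Ob K"
    and tensm_Hom: "\<lbrakk>A \<in> Ob K; B \<in> Ob K; A' \<in> Ob K; B' \<in> Ob K; f \<in> Hom K A B; f' \<in> Hom K A' B'\<rbrakk>
      \<Longrightarrow> f \<boxdot> f' \<in> Hom K (A \<boxtimes> A') (B \<boxtimes> B')"
    and tensm_ident: "\<lbrakk>A \<in> Ob K; B \<in> Ob K\<rbrakk> \<Longrightarrow> ident K A \<boxdot> ident K B = ident K (A \<boxtimes> B)"
    and tensm_cmp: "\<lbrakk>A \<in> Ob K; B \<in> Ob K; C \<in> Ob K; A' \<in> Ob K; B' \<in> Ob K; C' \<in> Ob K;
        f \<in> Hom K A B; g \<in> Hom K B C; f' \<in> Hom K A' B'; g' \<in> Hom K B' C'\<rbrakk>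
      \<Longrightarrow> (g \<cdot> f) \<boxdot> (g' \<cdot> f') = (g \<boxdot> g') \<cdot> (f \<boxdot> f')"
    and asc_iso: "\<lbrakk>A \<in> Ob K; B \<in> Ob K; C \<in> Ob K\<rbrakk>
      \<Longrightarrow> iso_arrow K ((A \<boxtimes> B) \<boxtimes> C) (A \<boxtimes> (B \<boxtimes> C)) (asc K A B C)"
    and asc_natural: "\<lbrakk>A \<in> Ob K; B \<in> Ob K; C \<in> Ob K; A' \<in> Ob K; B' \<in> Ob K; C' \<in> Ob K;
        f \<in> Hom K A A'; g \<in> Hom K B B'; h \<in> Hom K C C'\<rbrakk>
      \<Longrightarrow> asc K A' B' C' \<cdot> ((f \<boxdot> g) \<boxdot> h) = (f \<boxdot> (g \<boxdot> h)) \<cdot> asc K A B C"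
    and lun_iso: "A \<in> Ob K \<Longrightarrow> iso_arrow K (unt K \<boxtimes> A) A (lun K A)"
    and lun_natural: "\<lbrakk>A \<in> Ob K; B \<in> Ob K; f \<in> Hom K A B\<rbrakk>
      \<Longrightarrow> lun K B \<cdot> (ident K (unt K) \<boxdot> f) = f \<cdot> lun K A"
    and run_iso: "A \<in> Ob K \<Longrightarrow> iso_arrow K (A \<boxtimes> unt K) A (run K A)"
    and run_natural: "\<lbrakk>A \<in> Ob K; B \<in> Ob K; f \<in> Hom K A B\<rbrakk>
      \<Longrightarrow> run K B \<cdot> (f \<boxdot> ident K (unt K)) = f \<cdot> run K A"
    and pentagon: "\<lbrakk>A \<in> Ob K; B \<in> Ob K; C \<in> Ob K; D \<in> Ob K\<rbrakk>
      \<Longrightarrow> (ident K A \<boxdot> asc K B C D) \<cdot> asc K A (B \<boxtimes> C) D \<cdot> (asc K A B C \<boxdot> ident K D)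
          = asc K A B (C \<boxtimes> D) \<cdot> asc K (A \<boxtimes> B) C D"
    and triangle: "\<lbrakk>A \<in> Ob K; B \<in> Ob K\<rbrakk>
      \<Longrightarrow> (ident K A \<boxdot> lun K B) \<cdot> asc K A (unt K) B = run K A \<boxdot> ident K B"
    and tens_exact_right: "A \<in> Ob K \<Longrightarrow> exact_functor K (\<lambda>B. A \<boxtimes> B) (\<lambda>f. ident K A \<boxdot> f)"
    and tens_exact_left: "A \<in> Ob K \<Longrightarrow> exact_functor K (\<lambda>B. B \<boxtimes> A) (\<lambda>f. f \<boxdot> ident K A)"

text \<open>
  \<open>D\<close> is a left dual of \<open>A\<close>: there are \<open>ev : D \<boxtimes> A \<rightarrow> \<one>\<close> and \<open>co : \<one> \<rightarrow> A \<boxtimes> D\<close> satisfying the two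
  zigzag identities.  \<open>D\<close> is a right dual of \<open>A\<close> iff \<open>A\<close> is a left dual of \<open>D\<close>.
\<close>

definition left_dual :: "('o, 'm, 'x) mtcat_scheme \<Rightarrow> 'o \<Rightarrow> 'o \<Rightarrow> bool" where
  "left_dual K A D \<longleftrightarrow>
     (\<exists>ev\<in>Hom K (D \<boxtimes>\<^bsub>K\<^esub> A) (unt K). \<exists>co\<in>Hom K (unt K) (A \<boxtimes>\<^bsub>K\<^esub> D).
        run K A \<cdot>\<^bsub>K\<^esub> (ident K A \<boxdot>\<^bsub>K\<^esub> ev) \<cdot>\<^bsub>K\<^esub> asc K A D A \<cdot>\<^bsub>K\<^esub> (co \<boxdot>\<^bsub>K\<^esub> ident K A)
          \<cdot>\<^bsub>K\<^esub> inv_arrow K (unt K \<boxtimes>\<^bsub>K\<^esub> A) A (lun K A) = ident K A \<and>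
        lun K D \<cdot>\<^bsub>K\<^esub> (ev \<boxdot>\<^bsub>K\<^esub> ident K D)
          \<cdot>\<^bsub>K\<^esub> inv_arrow K ((D \<boxtimes>\<^bsub>K\<^esub> A) \<boxtimes>\<^bsub>K\<^esub> D) (D \<boxtimes>\<^bsub>K\<^esub> (A \<boxtimes>\<^bsub>K\<^esub> D)) (asc K D A D)
          \<cdot>\<^bsub>K\<^esub> (ident K D \<boxdot>\<^bsub>K\<^esub> co)
          \<cdot>\<^bsub>K\<^esub> inv_arrow K (D \<boxtimes>\<^bsub>K\<^esub> unt K) D (run K D) = ident K D)"

definition right_dual :: "('o, 'm, 'x) mtcat_scheme \<Rightarrow> 'o \<Rightarrow> 'o \<Rightarrow> bool" where
  "right_dual K A D \<longleftrightarrow> left_dual K D A"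

text \<open>
  \<open>cpt_ess_small\<close> is the usual convention that \<open>K\<^sup>c\<close> is essentially small; it is
  implicit in speaking of the set of prime ideals, and it underlies the existence of the Rickard triangles below.
  Local smallness of \<open>K\<close> is not asked for otherwise.
\<close>

locale rigidly_compactly_generated = monoidal_triangulated_category K
  for \<kappa> :: "'i rel" and K :: "('o, 'm, 'x) mtcat_scheme" (structure) +
  assumes size_bound: "size_bound \<kappa>"
    and coproducts: "\<lbrakk>small \<kappa> I; \<And>i. i \<in> I \<Longrightarrow> F i \<in> Ob K\<rbrakk> \<Longrightarrow> \<exists>X \<iota>. coproduct K (I::'i set) F X \<iota>"
    and cpt_ess_small: "\<exists>S\<subseteq>cpt \<kappa> K. small \<kappa> S \<and> (\<forall>C\<in>cpt \<kappa> K. \<exists>C'\<in>S. isomorphic K C C') \<and>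
      (\<forall>C\<in>S. \<forall>C'\<in>S. small \<kappa> (Hom K C C'))"
    and cpt_generates: "Loc \<kappa> K (cpt \<kappa> K) = Ob K"
    and tens_coproduct_right: "\<lbrakk>A \<in> Ob K; small \<kappa> I; coproduct K (I::'i set) F X \<iota>\<rbrakk>
      \<Longrightarrow> coproduct K I (\<lambda>i. A \<boxtimes> F i) (A \<boxtimes> X) (\<lambda>i. ident K A \<boxdot> \<iota> i)"
    and tens_coproduct_left: "\<lbrakk>A \<in> Ob K; small \<kappa> I; coproduct K (I::'i set) F X \<iota>\<rbrakk>
      \<Longrightarrow> coproduct K I (\<lambda>i. F i \<boxtimes> A) (X \<boxtimes> A) (\<lambda>i. \<iota> i \<boxdot> ident K A)"
    and unt_cpt: "unt K \<in> cpt \<kappa> K"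
    and tens_cpt: "\<lbrakk>A \<in> cpt \<kappa> K; B \<in> cpt \<kappa> K\<rbrakk> \<Longrightarrow> A \<boxtimes> B \<in> cpt \<kappa> K"
    and left_dual_exists: "A \<in> cpt \<kappa> K \<Longrightarrow> \<exists>D\<in>cpt \<kappa> K. left_dual K A D"
    and right_dual_exists: "A \<in> cpt \<kappa> K \<Longrightarrow> \<exists>D\<in>cpt \<kappa> K. right_dual K A D"


section \<open>The Balmer spectrum\<close>

definition thick_ideal :: "'i rel \<Rightarrow> ('o, 'm, 'x) mtcat_scheme \<Rightarrow> 'o set \<Rightarrow> bool" where
  "thick_ideal \<kappa> K I \<longleftrightarrow> thick K I \<and> I \<subseteq> cpt \<kappa> K \<and>
     (\<forall>A\<in>I. \<forall>B\<in>cpt \<kappa> K. A \<boxtimes>\<^bsub>K\<^esub> B \<in> I \<and> B \<boxtimes>\<^bsub>K\<^esub> A \<in> I)"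

definition Spc :: "'i rel \<Rightarrow> ('o, 'm, 'x) mtcat_scheme \<Rightarrow> 'o set set" where
  "Spc \<kappa> K = {P. thick_ideal \<kappa> K P \<and> P \<noteq> cpt \<kappa> K \<and>
     (\<forall>I J. thick_ideal \<kappa> K I \<and> thick_ideal \<kappa> K J \<and> {A \<boxtimes>\<^bsub>K\<^esub> B | A B. A \<in> I \<and> B \<in> J} \<subseteq> P
        \<longrightarrow> I \<subseteq> P \<or> J \<subseteq> P)}"

text \<open>
  The sets \<open>{P. P \<inter> S = {}}\<close> are the closed sets of a topology: they are visibly stable under
  intersections, and stable under finite unions since a thick ideal contains \<open>A \<oplus> B\<close> iff it
  contains both \<open>A\<close> and \<open>B\<close>.
\<close>

definition Spc_topology :: "'i rel \<Rightarrow> ('o, 'm, 'x) mtcat_scheme \<Rightarrow> 'o set topology" where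
  "Spc_topology \<kappa> K =
     topology (\<lambda>U. \<exists>S\<subseteq>cpt \<kappa> K. U = Spc \<kappa> K - {P \<in> Spc \<kappa> K. P \<inter> S = {}})"

definition noetherian_space :: "'a topology \<Rightarrow> bool" where
  "noetherian_space X \<longleftrightarrow>
     (\<forall>F :: nat \<Rightarrow> 'a set. (\<forall>n. closedin X (F n)) \<and> decseq F \<longrightarrow> (\<exists>N. \<forall>n\<ge>N. F n = F N))"

definition Spc_Noetherian :: "'i rel \<Rightarrow> ('o, 'm, 'x) mtcat_scheme \<Rightarrow> bool" where
  "Spc_Noetherian \<kappa> K \<longleftrightarrow> noetherian_space (Spc_topology \<kappa> K)"

definition suppB :: "'i rel \<Rightarrow> ('o, 'm, 'x) mtcat_scheme \<Rightarrow> 'o \<Rightarrow> 'o set set" where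
  "suppB \<kappa> K A = {P \<in> Spc \<kappa> K. A \<notin> P}"


section \<open>Extensions of the Balmer support\<close>

definition support_extension ::
    "'i rel \<Rightarrow> ('o, 'm, 'x) mtcat_scheme \<Rightarrow> ('o \<Rightarrow> 'o set set) \<Rightarrow> bool" where
  "support_extension \<kappa> K \<tau> \<longleftrightarrow>
     (\<forall>A\<in>Ob K. \<tau> A \<subseteq> Spc \<kappa> K) \<and>
     (\<forall>A\<in>cpt \<kappa> K. \<tau> A = suppB \<kappa> K A) \<and>
     (\<forall>(I::'i set) A X \<iota>. small \<kappa> I \<and> coproduct K I A X \<iota> \<longrightarrow> \<tau> X = (\<Union>i\<in>I. \<tau> (A i))) \<and>
     (\<forall>A\<in>Ob K. \<tau> (sh K A) = \<tau> A) \<and>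
     (\<forall>A B C f g h. dist K A B C f g h \<longrightarrow> \<tau> A \<subseteq> \<tau> B \<union> \<tau> C) \<and>
     (\<forall>A\<in>Ob K. \<forall>B\<in>Ob K. \<tau> (A \<boxtimes>\<^bsub>K\<^esub> B) \<subseteq> \<tau> A \<inter> \<tau> B)"

definition tensorial :: "'i rel \<Rightarrow> ('o, 'm, 'x) mtcat_scheme \<Rightarrow> ('o \<Rightarrow> 'o set set) \<Rightarrow> bool" where
  "tensorial \<kappa> K \<tau> \<longleftrightarrow>
     (\<forall>A\<in>Ob K. \<forall>C\<in>cpt \<kappa> K. (\<Union>B\<in>cpt \<kappa> K. \<tau> (A \<boxtimes>\<^bsub>K\<^esub> B \<boxtimes>\<^bsub>K\<^esub> C)) = \<tau> A \<inter> \<tau> C)"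

definition faithful :: "('o, 'm, 'x) mtcat_scheme \<Rightarrow> ('o \<Rightarrow> 'o set set) \<Rightarrow> bool" where
  "faithful K \<tau> \<longleftrightarrow> (\<forall>A\<in>Ob K. \<tau> A = {} \<longrightarrow> zero_object K A)"


section \<open>Rickard idempotents\<close>

definition rickard_triangle ::
    "'i rel \<Rightarrow> ('o, 'm, 'x) mtcat_scheme \<Rightarrow> 'o set \<Rightarrow> 'o \<Rightarrow> 'o \<Rightarrow> 'o \<Rightarrow> bool" where
  "rickard_triangle \<kappa> K I A G L \<longleftrightarrow>
     (\<exists>f g h. dist K G A L f g h) \<and> G \<in> Loc \<kappa> K I \<and>
     (\<forall>B\<in>Loc \<kappa> K I. Hom K B L = {zeroarr K B L})"

text \<open>
  A Rickard triangle of \<open>A\<close> is unique up to isomorphism, so its outer terms, the values at \<open>A\<close> of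
  the functors \<open>\<Gamma>\<^sub>I\<close> and \<open>L\<^sub>I\<close>, are obtained by choice.
\<close>

definition Rickard :: "'i rel \<Rightarrow> ('o, 'm, 'x) mtcat_scheme \<Rightarrow> 'o set \<Rightarrow> 'o \<Rightarrow> 'o \<times> 'o" where
  "Rickard \<kappa> K I A = (SOME (G, L). rickard_triangle \<kappa> K I A G L)"

definition Gamma_ideal :: "'i rel \<Rightarrow> ('o, 'm, 'x) mtcat_scheme \<Rightarrow> 'o set \<Rightarrow> 'o \<Rightarrow> 'o" where
  "Gamma_ideal \<kappa> K I A = fst (Rickard \<kappa> K I A)"

definition L_ideal :: "'i rel \<Rightarrow> ('o, 'm, 'x) mtcat_scheme \<Rightarrow> 'o set \<Rightarrow> 'o \<Rightarrow> 'o" where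
  "L_ideal \<kappa> K I A = snd (Rickard \<kappa> K I A)"

definition Theta :: "'i rel \<Rightarrow> ('o, 'm, 'x) mtcat_scheme \<Rightarrow> 'o set set \<Rightarrow> 'o set" where
  "Theta \<kappa> K S = {A \<in> cpt \<kappa> K. suppB \<kappa> K A \<subseteq> S}"

definition Vset :: "'i rel \<Rightarrow> ('o, 'm, 'x) mtcat_scheme \<Rightarrow> 'o set \<Rightarrow> 'o set set" where
  "Vset \<kappa> K P = Spc_topology \<kappa> K closure_of {P}"

definition Zset :: "'i rel \<Rightarrow> ('o, 'm, 'x) mtcat_scheme \<Rightarrow> 'o set \<Rightarrow> 'o set set" where
  "Zset \<kappa> K P = {Q \<in> Spc \<kappa> K. P \<notin> Spc_topology \<kappa> K closure_of {Q}}"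

definition Gamma_point :: "'i rel \<Rightarrow> ('o, 'm, 'x) mtcat_scheme \<Rightarrow> 'o set \<Rightarrow> 'o \<Rightarrow> 'o" where
  "Gamma_point \<kappa> K P A =
     Gamma_ideal \<kappa> K (Theta \<kappa> K (Vset \<kappa> K P)) (unt K)
       \<boxtimes>\<^bsub>K\<^esub> L_ideal \<kappa> K (Theta \<kappa> K (Zset \<kappa> K P)) (unt K) \<boxtimes>\<^bsub>K\<^esub> A"

definition SuppB :: "'i rel \<Rightarrow> ('o, 'm, 'x) mtcat_scheme \<Rightarrow> 'o \<Rightarrow> 'o set set" where
  "SuppB \<kappa> K A = {P \<in> Spc \<kappa> K. \<not> zero_object K (Gamma_point \<kappa> K P A)}"

end

theory Submission
  imports Defs
begin

text \<open>
  An object is detected by \<open>\<sigma>\<close> through two facts about a specialization-closed set \<open>S\<close>.  First, the objects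
  \<open>X\<close> with \<open>\<sigma> X \<subseteq> S\<close> form a localizing subcategory, so \<open>\<sigma> (\<Gamma>\<^sub>S \<one>) \<subseteq> S\<close>.  Second, \<open>L\<^sub>S \<one> \<boxtimes> C\<close> vanishes for
  compact \<open>C\<close> supported in \<open>S\<close>: it lies in \<open>Loc (\<Theta> S)\<close>, and tensoring with a dual of \<open>C\<close> shows that it
  receives no nonzero morphism from there.  As \<open>\<sigma>\<close> is tensorial this makes \<open>\<sigma> (L\<^sub>S \<one>)\<close> disjoint from the support of
  every such \<open>C\<close>; these supports exhaust \<open>S\<close> because, in a Noetherian spectrum, the closure of a point \<open>Q\<close> contains the
  support of a compact object supported at \<open>Q\<close>.  The two localization triangles then give
  \<open>\<sigma> (\<Gamma>\<^sub>P A) = {P} \<inter> \<sigma> A\<close>, and faithfulness turns this into \<open>P \<in> \<sigma> A \<longleftrightarrow> \<not> \<Gamma>\<^sub>P A \<cong> 0\<close>.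

  The functors \<open>\<Gamma>\<close> and \<open>L\<close> are defined by choice, so Rickard triangles have to be shown to exist;
  they are built as sequential homotopy colimits.
\<close>

section \<open>Preadditive categories\<close>

text \<open>Without a braiding, sides matter. Of the duals of \<open>C\<close>, the one wanted is
  the \<open>D\<close> for which \<open>_ \<boxtimes> D\<close> is left adjoint to
  \<open>_ \<boxtimes> C\<close>, and all localization triangles are tensored on the right.

  The second obstacle is size. A cover by compact objects is a coproduct over a set of morphisms,
  while smallness is assumed only for the morphism sets between representatives of the compact
  objects. It first has to be propagated to all morphism sets out of compact objects. Compactness
  makes this possible, since a morphism into a coproduct is then a finite sum of morphisms through
  summands.

  A colimit is needed because killing once is not enough: passing to a cone creates new morphisms
  that vanish in \<open>A\<close>. Countably many rounds suffice, since a morphism from a compact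
  object into the homotopy colimit already lives at a finite stage.\<close>

lemma ex1_unique: "\<lbrakk>\<exists>!x. P x; P a; P b\<rbrakk> \<Longrightarrow> a = b"
  by blast

context preadditive_category
begin

text \<open>
  Since the morphism sets are disjoint, a morphism has a domain \<open>dm\<close> and a codomain \<open>cd\<close>.  They turn typing
  conditions into equations, which the simplifier can solve without guessing objects.
\<close>

definition ar :: "'m \<Rightarrow> bool" where
  "ar f \<longleftrightarrow> (\<exists>A\<in>Ob K. \<exists>B\<in>Ob K. f \<in> Hom K A B)"

definition dm :: "'m \<Rightarrow> 'o" where
  "dm f = (THE A. \<exists>B\<in>Ob K. A \<in> Ob K \<and> f \<in> Hom K A B)"

definition cd :: "'m \<Rightarrow> 'o" where
  "cd f = (THE B. \<exists>A\<in>Ob K. B \<in> Ob K \<and> f \<in> Hom K A B)"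

lemma dm_eq: "\<lbrakk>A \<in> Ob K; B \<in> Ob K; f \<in> Hom K A B\<rbrakk> \<Longrightarrow> dm f = A"
  unfolding dm_def by (rule the_equality) (use Hom_disjoint in blast)+

lemma cd_eq: "\<lbrakk>A \<in> Ob K; B \<in> Ob K; f \<in> Hom K A B\<rbrakk> \<Longrightarrow> cd f = B"
  unfolding cd_def by (rule the_equality) (use Hom_disjoint in blast)+

text \<open>As a simp rule this turns membership in a morphism set into equations; proofs that need
  \<open>Hom\<close> intact remove it.\<close>

lemma Hom_iff [simp]:
  "\<lbrakk>A \<in> Ob K; B \<in> Ob K\<rbrakk> \<Longrightarrow> f \<in> Hom K A B \<longleftrightarrow> ar f \<and> dm f = A \<and> cd f = B"
  using dm_eq cd_eq ar_def by metis

lemma dm_Ob [simp]: "ar f \<Longrightarrow> dm f \<in> Ob K"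
  and cd_Ob [simp]: "ar f \<Longrightarrow> cd f \<in> Ob K"
  using dm_eq cd_eq ar_def by metis+

lemma ar_Hom: "ar f \<Longrightarrow> f \<in> Hom K (dm f) (cd f)"
  by simp

lemma ident_simps [simp]:
  assumes "A \<in> Ob K"
  shows "ar (ident K A)" "dm (ident K A) = A" "cd (ident K A) = A"
  using ident_Hom[OF assms] assms by auto

lemma cmp_Hom:
  assumes "A \<in> Ob K" "B \<in> Ob K" "C \<in> Ob K" "f \<in> Hom K A B" "g \<in> Hom K B C"
  shows "g \<cdot> f \<in> Hom K A C"
  using cmp_hom_right[OF assms(1,2,3,5)] assms(4) by (rule hom_in_carrier)

lemma cmp_simps [simp]:
  assumes "ar f" "ar g" "dm g = cd f"
  shows "ar (g \<cdot> f)" "dm (g \<cdot> f) = dm f" "cd (g \<cdot> f) = cd g"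
  using cmp_Hom[of "dm f" "cd f" "cd g" f g] assms by auto

lemma assoc [simp]:
  "\<lbrakk>ar f; ar g; ar h; dm g = cd f; dm h = cd g\<rbrakk> \<Longrightarrow> (h \<cdot> g) \<cdot> f = h \<cdot> (g \<cdot> f)"
  using cmp_assoc[of "dm f" "cd f" "cd g" "cd h" f g h] by simp

lemma id_left [simp]: "\<lbrakk>ar f; cd f = B\<rbrakk> \<Longrightarrow> ident K B \<cdot> f = f"
  and id_right [simp]: "\<lbrakk>ar f; dm f = B\<rbrakk> \<Longrightarrow> f \<cdot> ident K B = f"
  using ident_cmp[of "dm f" "cd f" f] cmp_ident[of "dm f" "cd f" f] by auto

section \<open>Addition of morphisms\<close>

abbreviation zr :: "'o \<Rightarrow> 'o \<Rightarrow> 'm" where "zr A B \<equiv> zeroarr K A B"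

text \<open>The group is read off the first summand, so that sums carry no object annotations; this
  is the intended sum only for parallel morphisms.\<close>

definition pl :: "'m \<Rightarrow> 'm \<Rightarrow> 'm" (infixl \<open>\<^bold>+\<close> 65) where
  "f \<^bold>+ g = f \<otimes>\<^bsub>HomG K (dm f) (cd f)\<^esub> g"

definition ng :: "'m \<Rightarrow> 'm" (\<open>\<^bold>- _\<close> [81] 80) where
  "\<^bold>- f = inv\<^bsub>HomG K (dm f) (cd f)\<^esub> f"

lemma zr_simps [simp]:
  assumes "A \<in> Ob K" "B \<in> Ob K"
  shows "ar (zr A B)" "dm (zr A B) = A" "cd (zr A B) = B"
proof -
  interpret comm_group "HomG K A B" by (rule Hom_group[OF assms])
  have "zr A B \<in> Hom K A B" by (rule one_closed)
  then show "ar (zr A B)" "dm (zr A B) = A" "cd (zr A B) = B"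
    unfolding Hom_iff[OF assms] by blast+
qed

lemma
  assumes "ar f" "ar g" "dm g = dm f" "cd g = cd f"
  shows pl_simps [simp]: "ar (f \<^bold>+ g)" "dm (f \<^bold>+ g) = dm f" "cd (f \<^bold>+ g) = cd f"
    and pl_commute: "f \<^bold>+ g = g \<^bold>+ f"
proof -
  interpret comm_group "HomG K (dm f) (cd f)" by (rule Hom_group) (use assms in auto)
  have fg: "f \<in> Hom K (dm f) (cd f)" "g \<in> Hom K (dm f) (cd f)" using assms by (simp_all del: m_closed)
  have "f \<^bold>+ g \<in> Hom K (dm f) (cd f)" unfolding pl_def by (rule m_closed[OF fg])
  then show "ar (f \<^bold>+ g)" "dm (f \<^bold>+ g) = dm f" "cd (f \<^bold>+ g) = cd f"
    using assms Hom_iff[of "dm f" "cd f"] by (metis dm_Ob cd_Ob)+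
  show "f \<^bold>+ g = g \<^bold>+ f"
    using m_comm[OF fg] assms unfolding pl_def by simp
qed

lemma
  assumes "ar f"
  shows ng_simps [simp]: "ar (\<^bold>- f)" "dm (\<^bold>- f) = dm f" "cd (\<^bold>- f) = cd f"
    and pl_ng [simp]: "f \<^bold>+ \<^bold>- f = zr (dm f) (cd f)"
    and ng_pl [simp]: "\<^bold>- f \<^bold>+ f = zr (dm f) (cd f)"
    and ng_ng [simp]: "\<^bold>- (\<^bold>- f) = f"
proof -
  interpret comm_group "HomG K (dm f) (cd f)" by (rule Hom_group) (use assms in auto)
  have f: "f \<in> Hom K (dm f) (cd f)" by (rule ar_Hom[OF assms])
  have "\<^bold>- f \<in> Hom K (dm f) (cd f)" unfolding ng_def by (rule inv_closed[OF f])
  then show *: "ar (\<^bold>- f)" "dm (\<^bold>- f) = dm f" "cd (\<^bold>- f) = cd f"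
    using assms Hom_iff[of "dm f" "cd f"] by (metis dm_Ob cd_Ob)+
  show "f \<^bold>+ \<^bold>- f = zr (dm f) (cd f)"
    unfolding pl_def unfolding ng_def by (rule r_inv[OF f])
  show "\<^bold>- f \<^bold>+ f = zr (dm f) (cd f)"
    unfolding pl_def * unfolding ng_def by (rule l_inv[OF f])
  show "\<^bold>- (\<^bold>- f) = f"
    unfolding ng_def[of "\<^bold>- f"] * unfolding ng_def by (rule inv_inv[OF f])
qed

lemma zr_pl [simp]: "\<lbrakk>ar f; A = dm f; B = cd f\<rbrakk> \<Longrightarrow> zr A B \<^bold>+ f = f"
proof -
  assume *: "ar f" "A = dm f" "B = cd f"
  interpret comm_group "HomG K (dm f) (cd f)" by (rule Hom_group) (use * in auto)
  show "zr A B \<^bold>+ f = f" using l_one[OF ar_Hom[OF *(1)]] * by (simp add: pl_def)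
qed

lemma pl_zr [simp]: "\<lbrakk>ar f; A = dm f; B = cd f\<rbrakk> \<Longrightarrow> f \<^bold>+ zr A B = f"
  using pl_commute[of f "zr A B"] by simp

lemma pl_assoc:
  assumes "ar f" "ar g" "ar h" "dm g = dm f" "cd g = cd f" "dm h = dm f" "cd h = cd f"
  shows "f \<^bold>+ g \<^bold>+ h = f \<^bold>+ (g \<^bold>+ h)"
proof -
  interpret comm_group "HomG K (dm f) (cd f)" by (rule Hom_group) (use assms in auto)
  have "f \<in> Hom K (dm f) (cd f)" "g \<in> Hom K (dm f) (cd f)" "h \<in> Hom K (dm f) (cd f)"
    using assms by simp_all
  then show ?thesis using m_assoc[of f g h] assms pl_simps[of f g] by (simp add: pl_def)
qed

lemma cmp_pl [simp]:
  assumes "ar f" "ar g" "ar h" "dm g = dm f" "cd g = cd f" "dm h = cd f"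
  shows "h \<cdot> (f \<^bold>+ g) = h \<cdot> f \<^bold>+ h \<cdot> g"
  using hom_mult[OF cmp_hom_right[of "dm f" "cd f" "cd h" h], of f g] assms by (simp add: pl_def)

lemma pl_cmp [simp]:
  assumes "ar f" "ar g" "ar h" "dm g = dm f" "cd g = cd f" "cd h = dm f"
  shows "(f \<^bold>+ g) \<cdot> h = f \<cdot> h \<^bold>+ g \<cdot> h"
  using hom_mult[OF cmp_hom_left[of "dm h" "dm f" "cd f" h], of f g] assms by (simp add: pl_def)

lemma group_Hom: "\<lbrakk>A \<in> Ob K; B \<in> Ob K\<rbrakk> \<Longrightarrow> group (HomG K A B)"
  using Hom_group comm_group_def by blast

lemma cmp_zr [simp]:
  assumes "ar h" "dm h = B" "A \<in> Ob K"
  shows "h \<cdot> zr A B = zr A (cd h)"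
proof -
  have "B \<in> Ob K" "cd h \<in> Ob K" using assms by auto
  with assms show ?thesis
    using hom_one[OF cmp_hom_right[of A B "cd h" h] group_Hom[of A B] group_Hom[of A "cd h"]] by simp
qed

lemma zr_cmp [simp]:
  assumes "ar h" "cd h = B" "A \<in> Ob K"
  shows "zr B A \<cdot> h = zr (dm h) A"
proof -
  have "B \<in> Ob K" "dm h \<in> Ob K" using assms by auto
  with assms show ?thesis
    using hom_one[OF cmp_hom_left[of "dm h" B A h] group_Hom[of B A] group_Hom[of "dm h" A]] by simp
qed

text \<open>Uniqueness of inverses; compatibility of negatives with composition, and later with the
  shift, is obtained from it together with additivity.\<close>

lemma ng_unique:
  assumes "ar f" "ar g" "dm g = dm f" "cd g = cd f" "f \<^bold>+ g = zr (dm f) (cd f)"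
  shows "g = \<^bold>- f"
proof -
  have "g = \<^bold>- f \<^bold>+ f \<^bold>+ g" using assms by simp
  also have "\<dots> = \<^bold>- f" using assms by (simp add: pl_assoc del: ng_pl)
  finally show ?thesis .
qed

lemma pl_ng_eq_zr_iff:
  assumes "ar f" "ar g" "dm g = dm f" "cd g = cd f"
  shows "f \<^bold>+ \<^bold>- g = zr (dm f) (cd f) \<longleftrightarrow> f = g"
  using ng_unique[of f "\<^bold>- g"] assms by (metis ng_simps ng_ng pl_ng)

lemma cmp_ng [simp]: "\<lbrakk>ar f; ar h; dm h = cd f\<rbrakk> \<Longrightarrow> h \<cdot> \<^bold>- f = \<^bold>- (h \<cdot> f)"
  by (rule ng_unique) (simp_all flip: cmp_pl)

lemma ng_cmp [simp]: "\<lbrakk>ar f; ar h; cd h = dm f\<rbrakk> \<Longrightarrow> (\<^bold>- f) \<cdot> h = \<^bold>- (f \<cdot> h)"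
  by (rule ng_unique) (simp_all flip: pl_cmp)

lemma ng_zr [simp]: "\<lbrakk>A \<in> Ob K; B \<in> Ob K\<rbrakk> \<Longrightarrow> \<^bold>- (zr A B) = zr A B"
  by (rule ng_unique[symmetric]) simp_all

lemma ng_eq_zr_iff:
  "\<lbrakk>ar f; dm f = A; cd f = B\<rbrakk> \<Longrightarrow> \<^bold>- f = zr A B \<longleftrightarrow> f = zr A B"
  by (metis ng_ng ng_zr dm_Ob cd_Ob)

text \<open>The inverse is carried along explicitly, which avoids the definite description
  \<open>inv_arrow\<close> and makes symmetry and transitivity immediate.\<close>

definition isop :: "'o \<Rightarrow> 'o \<Rightarrow> 'm \<Rightarrow> 'm \<Rightarrow> bool" where
  "isop A B f g \<longleftrightarrow> ar f \<and> ar g \<and> dm f = A \<and> cd f = B \<and> dm g = B \<and> cd g = A \<and>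
     g \<cdot> f = ident K A \<and> f \<cdot> g = ident K B"

lemma isopD:
  assumes "isop A B f g"
  shows "ar f" "ar g" "dm f = A" "cd f = B" "dm g = B" "cd g = A"
    "g \<cdot> f = ident K A" "f \<cdot> g = ident K B" "A \<in> Ob K" "B \<in> Ob K"
  using assms unfolding isop_def by auto

text \<open>Composites are normalized by associating to the right, so an inverse pair has to be
  cancelled in front of a further factor \<open>x\<close>.\<close>

lemma isop_cancel:
  assumes "isop A B f g"
  shows "\<lbrakk>ar x; cd x = A\<rbrakk> \<Longrightarrow> g \<cdot> (f \<cdot> x) = x" "\<lbrakk>ar x; cd x = B\<rbrakk> \<Longrightarrow> f \<cdot> (g \<cdot> x) = x"
  using isopD[OF assms] assoc[of x f g] assoc[of x g f] by auto

lemma isop_sym: "isop A B f g \<Longrightarrow> isop B A g f"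
  unfolding isop_def by auto

lemma isop_id: "A \<in> Ob K \<Longrightarrow> isop A A (ident K A) (ident K A)"
  unfolding isop_def by auto

lemma isop_trans:
  assumes "isop A B f g" "isop B C f' g'"
  shows "isop A C (f' \<cdot> f) (g \<cdot> g')"
  using isopD[OF assms(1)] isopD[OF assms(2)] isop_cancel[OF assms(1)] isop_cancel[OF assms(2)]
  unfolding isop_def by auto

lemma iso_inverse_arrows:
  "\<lbrakk>A \<in> Ob K; B \<in> Ob K\<rbrakk> \<Longrightarrow> isop A B f g \<longleftrightarrow> inverse_arrows K A B f g"
  unfolding isop_def inverse_arrows_def by auto

lemma iso_arrow_iff:
  "\<lbrakk>A \<in> Ob K; B \<in> Ob K\<rbrakk> \<Longrightarrow> iso_arrow K A B f \<longleftrightarrow> (\<exists>g. isop A B f g)"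
  unfolding iso_arrow_def by (simp add: iso_inverse_arrows)

lemma isomorphic_iff:
  "\<lbrakk>A \<in> Ob K; B \<in> Ob K\<rbrakk> \<Longrightarrow> isomorphic K A B \<longleftrightarrow> (\<exists>f g. isop A B f g)"
  unfolding isomorphic_def using iso_arrow_iff by metis

lemma iso_inv_arrow:
  assumes "isop A B f g"
  shows "inv_arrow K A B f = g"
  unfolding inv_arrow_def
proof (rule the_equality)
  show "inverse_arrows K A B f g" using assms isopD[OF assms] iso_inverse_arrows by blast
  fix h assume "inverse_arrows K A B f h"
  then have h: "isop A B f h" using isopD[OF assms] iso_inverse_arrows by blast
  show "h = g"
    using isop_cancel[OF h, of g] isopD[OF h] isopD[OF assms] by simp
qed

lemma iso_arrow_inv:
  assumes "A \<in> Ob K" "B \<in> Ob K" "iso_arrow K A B f"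
  shows "isop A B f (inv_arrow K A B f)"
proof -
  obtain g where "isop A B f g" using assms iso_arrow_iff by blast
  then show ?thesis using iso_inv_arrow by simp
qed

lemma zero_objectI:
  assumes "A \<in> Ob K" "ident K A = zr A A"
  shows "zero_object K A"
  unfolding zero_object_def
proof (intro conjI ballI)
  fix B assume B: "B \<in> Ob K"
  have u: "f = zr B A" if "f \<in> Hom K B A" for f
  proof -
    have f: "ar f" "dm f = B" "cd f = A" using that assms(1) B by auto
    have "f = ident K A \<cdot> f" using f by simp
    also have "\<dots> = zr B A" unfolding assms(2) using f assms(1) by simp
    finally show ?thesis .
  qed
  have "zr B A \<in> Hom K B A" using B assms(1) by simp
  then show "\<exists>!f. f \<in> Hom K B A" by (rule ex1I) (rule u)
  have u: "f = zr A B" if "f \<in> Hom K A B" for f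
  proof -
    have f: "ar f" "dm f = A" "cd f = B" using that assms(1) B by auto
    have "f = f \<cdot> ident K A" using f by simp
    also have "\<dots> = zr A B" unfolding assms(2) using f assms(1) by simp
    finally show ?thesis .
  qed
  have "zr A B \<in> Hom K A B" using B assms(1) by simp
  then show "\<exists>!f. f \<in> Hom K A B" by (rule ex1I) (rule u)
qed (rule assms)

lemma
  assumes "zero_object K Z"
  shows zero_Ob [simp]: "Z \<in> Ob K"
    and to_zero: "\<lbrakk>ar f; dm f = A; cd f = Z\<rbrakk> \<Longrightarrow> f = zr A Z"
    and from_zero: "\<lbrakk>ar f; dm f = Z; cd f = A\<rbrakk> \<Longrightarrow> f = zr Z A"
proof -
  show Z: "Z \<in> Ob K" using assms by (simp add: zero_object_def)
  show "f = zr A Z" if "ar f" "dm f = A" "cd f = Z"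
  proof -
    have A: "A \<in> Ob K" using dm_Ob[OF that(1)] that(2) by simp
    then have *: "f \<in> Hom K A Z" "zr A Z \<in> Hom K A Z" using that Z by simp_all
    have "\<exists>!k. k \<in> Hom K A Z" using assms A by (simp add: zero_object_def del: Hom_iff)
    then show ?thesis using * by (rule ex1_unique)
  qed
  show "f = zr Z A" if "ar f" "dm f = Z" "cd f = A"
  proof -
    have A: "A \<in> Ob K" using cd_Ob[OF that(1)] that(3) by simp
    then have *: "f \<in> Hom K Z A" "zr Z A \<in> Hom K Z A" using that Z by simp_all
    have "\<exists>!k. k \<in> Hom K Z A" using assms A by (simp add: zero_object_def del: Hom_iff)
    then show ?thesis using * by (rule ex1_unique)
  qed
qed

section \<open>Coproducts and biproducts\<close>

lemma coproductD:
  assumes "coproduct K I A X \<iota>"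
  shows "X \<in> Ob K" "\<And>i. i \<in> I \<Longrightarrow> A i \<in> Ob K"
    "\<And>i. i \<in> I \<Longrightarrow> ar (\<iota> i)" "\<And>i. i \<in> I \<Longrightarrow> dm (\<iota> i) = A i" "\<And>i. i \<in> I \<Longrightarrow> cd (\<iota> i) = X"
  using assms unfolding coproduct_def by auto

lemma coproduct_ex:
  assumes "coproduct K I A X \<iota>" "Y \<in> Ob K"
    and "\<And>i. i \<in> I \<Longrightarrow> ar (g i) \<and> dm (g i) = A i \<and> cd (g i) = Y"
  obtains h where "ar h" "dm h = X" "cd h = Y" "\<And>i. i \<in> I \<Longrightarrow> h \<cdot> \<iota> i = g i"
proof -
  have "\<forall>i\<in>I. g i \<in> Hom K (A i) Y" using assms(2,3) coproductD[OF assms(1)] by simp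
  then have "\<exists>!h. h \<in> Hom K X Y \<and> (\<forall>i\<in>I. h \<cdot> \<iota> i = g i)"
    using assms(1,2) unfolding coproduct_def by blast
  then show thesis using that coproductD(1)[OF assms(1)] assms(2) by auto
qed

lemma coproduct_eqI:
  assumes "coproduct K I A X \<iota>" "ar h" "ar h'" "dm h = X" "dm h' = X" "cd h = cd h'"
    and "\<And>i. i \<in> I \<Longrightarrow> h \<cdot> \<iota> i = h' \<cdot> \<iota> i"
  shows "h = h'"
proof -
  have "\<forall>i\<in>I. h \<cdot> \<iota> i \<in> Hom K (A i) (cd h)" using assms(2-4) coproductD[OF assms(1)] by simp
  moreover have "\<forall>Y\<in>Ob K. \<forall>g. (\<forall>i\<in>I. g i \<in> Hom K (A i) Y) \<longrightarrow> (\<exists>!k. k \<in> Hom K X Y \<and> (\<forall>i\<in>I. k \<cdot> \<iota> i = g i))"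
    using assms(1) unfolding coproduct_def by (elim conjE)
  ultimately have "\<exists>!k. k \<in> Hom K X (cd h) \<and> (\<forall>i\<in>I. k \<cdot> \<iota> i = h \<cdot> \<iota> i)"
    using cd_Ob[OF assms(2)] by simp
  then show ?thesis
    by (rule ex1_unique) (use assms(2-) coproductD(1)[OF assms(1)] in simp_all)
qed

lemma coproductI:
  assumes "X \<in> Ob K" "\<And>i. i \<in> I \<Longrightarrow> A i \<in> Ob K \<and> ar (\<iota> i) \<and> dm (\<iota> i) = A i \<and> cd (\<iota> i) = X"
    and "\<And>Y g. \<lbrakk>Y \<in> Ob K; \<And>i. i \<in> I \<Longrightarrow> ar (g i) \<and> dm (g i) = A i \<and> cd (g i) = Y\<rbrakk> \<Longrightarrow>
      \<exists>h. ar h \<and> dm h = X \<and> cd h = Y \<and> (\<forall>i\<in>I. h \<cdot> \<iota> i = g i)"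
    and "\<And>h h'. \<lbrakk>ar h; ar h'; dm h = X; dm h' = X; cd h' = cd h; \<And>i. i \<in> I \<Longrightarrow> h \<cdot> \<iota> i = h' \<cdot> \<iota> i\<rbrakk> \<Longrightarrow> h = h'"
  shows "coproduct K I A X \<iota>"
  unfolding coproduct_def
proof (intro conjI ballI allI impI)
  fix Y g assume Y: "Y \<in> Ob K" and "\<forall>i\<in>I. g i \<in> Hom K (A i) Y"
  then have "\<And>i. i \<in> I \<Longrightarrow> ar (g i) \<and> dm (g i) = A i \<and> cd (g i) = Y" using assms(2) by auto
  from assms(3)[OF Y this] obtain h where h: "ar h \<and> dm h = X \<and> cd h = Y \<and> (\<forall>i\<in>I. h \<cdot> \<iota> i = g i)"
    by blast
  show "\<exists>!h. h \<in> Hom K X Y \<and> (\<forall>i\<in>I. h \<cdot> \<iota> i = g i)"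
  proof (rule ex1I)
    show "h \<in> Hom K X Y \<and> (\<forall>i\<in>I. h \<cdot> \<iota> i = g i)" using h Y assms(1) by simp
    fix h' assume "h' \<in> Hom K X Y \<and> (\<forall>i\<in>I. h' \<cdot> \<iota> i = g i)"
    then have h': "ar h'" "dm h' = X" "cd h' = Y" "\<And>i. i \<in> I \<Longrightarrow> h' \<cdot> \<iota> i = g i" using Y assms(1) by auto
    show "h' = h" by (rule assms(4)) (use h h' in auto)
  qed
qed (use assms in auto)

text \<open>Coproducts are supplied for index sets in the type \<open>'i\<close>, whereas the
  constructions index them by natural numbers or by pairs of an object and a morphism.\<close>

lemma coproduct_reindex:
  assumes X: "coproduct K I A X \<iota>" and "bij_betw e J I"
  shows "coproduct K J (\<lambda>j. A (e j)) X (\<lambda>j. \<iota> (e j))"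
proof -
  define r where "r = the_inv_into J e"
  have e: "\<And>j. j \<in> J \<Longrightarrow> e j \<in> I" using assms(2) bij_betw_apply by fast
  have r: "\<And>i. i \<in> I \<Longrightarrow> r i \<in> J" "\<And>i. i \<in> I \<Longrightarrow> e (r i) = i" "\<And>j. j \<in> J \<Longrightarrow> r (e j) = j"
    using assms(2) unfolding r_def bij_betw_def
    by (auto simp: the_inv_into_into f_the_inv_into_f the_inv_into_f_f)
  note D = coproductD[OF X]
  show ?thesis
  proof (rule coproductI)
    show "X \<in> Ob K" by (rule D)
    show "A (e j) \<in> Ob K \<and> ar (\<iota> (e j)) \<and> dm (\<iota> (e j)) = A (e j) \<and> cd (\<iota> (e j)) = X" if "j \<in> J" for j
      using D e[OF that] by simp
  next
    fix Y g assume Y: "Y \<in> Ob K" and g: "\<And>j. j \<in> J \<Longrightarrow> ar (g j) \<and> dm (g j) = A (e j) \<and> cd (g j) = Y"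
    obtain h where h: "ar h" "dm h = X" "cd h = Y" "\<And>i. i \<in> I \<Longrightarrow> h \<cdot> \<iota> i = g (r i)"
      by (rule coproduct_ex[OF X Y, of "\<lambda>i. g (r i)"]) (use g r in auto)
    show "\<exists>h. ar h \<and> dm h = X \<and> cd h = Y \<and> (\<forall>j\<in>J. h \<cdot> \<iota> (e j) = g j)"
      using h e r by (intro exI[of _ h]) simp
  next
    fix h h' assume h: "ar h" "ar h'" "dm h = X" "dm h' = X" "cd h' = cd h"
      "\<And>j. j \<in> J \<Longrightarrow> h \<cdot> \<iota> (e j) = h' \<cdot> \<iota> (e j)"
    show "h = h'"
    proof (rule coproduct_eqI[OF X h(1-4)])
      show "h \<cdot> \<iota> i = h' \<cdot> \<iota> i" if "i \<in> I" for i using h(6)[of "r i"] r that by simp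
    qed (simp add: h(5))
  qed
qed

lemma biproductD:
  assumes "biproduct K A B X i j p q"
  shows "A \<in> Ob K" "B \<in> Ob K" "X \<in> Ob K"
    "ar i" "dm i = A" "cd i = X" "ar j" "dm j = B" "cd j = X"
    "ar p" "dm p = X" "cd p = A" "ar q" "dm q = X" "cd q = B"
    "p \<cdot> i = ident K A" "q \<cdot> j = ident K B" "p \<cdot> j = zr B A" "q \<cdot> i = zr A B"
    "i \<cdot> p \<^bold>+ j \<cdot> q = ident K X"
  using assms unfolding biproduct_def pl_def by auto

lemma biproductI:
  assumes "ar i" "dm i = A" "cd i = X" "ar j" "dm j = B" "cd j = X"
    "ar p" "dm p = X" "cd p = A" "ar q" "dm q = X" "cd q = B"
    "p \<cdot> i = ident K A" "q \<cdot> j = ident K B" "p \<cdot> j = zr B A" "q \<cdot> i = zr A B"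
    "i \<cdot> p \<^bold>+ j \<cdot> q = ident K X"
  shows "biproduct K A B X i j p q"
proof -
  have "A \<in> Ob K" "B \<in> Ob K" "X \<in> Ob K" using dm_Ob cd_Ob assms by blast+
  then show ?thesis using assms unfolding biproduct_def pl_def by auto
qed

text \<open>With this the coproduct axiom of an extension yields invariance under isomorphism; the
  empty and the two-term coproduct below serve in the same way for zero objects and
  biproducts.\<close>

lemma singleton_coproduct:
  assumes "isop A B f g"
  shows "coproduct K {a} (\<lambda>_. A) B (\<lambda>_. f)"
proof (rule coproductI)
  note D = isopD[OF assms] and C = isop_cancel[OF assms]
  fix Y h assume "Y \<in> Ob K" "\<And>i. i \<in> {a} \<Longrightarrow> ar (h i) \<and> dm (h i) = A \<and> cd (h i) = Y"
  then show "\<exists>k. ar k \<and> dm k = B \<and> cd k = Y \<and> (\<forall>i\<in>{a}. k \<cdot> f = h i)"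
    using D by (intro exI[of _ "h a \<cdot> g"]) simp
next
  note D = isopD[OF assms]
  fix h h' assume h: "ar h" "ar h'" "dm h = B" "dm h' = B" "cd h' = cd h" "\<And>i. i \<in> {a} \<Longrightarrow> h \<cdot> f = h' \<cdot> f"
  then have "(h \<cdot> f) \<cdot> g = (h' \<cdot> f) \<cdot> g" by simp
  then show "h = h'" using h(1-5) D by simp
qed (use isopD[OF assms] in auto)

lemma empty_coproduct:
  assumes "zero_object K Z"
  shows "coproduct K {} A Z \<iota>"
proof (rule coproductI)
  show "\<exists>h. ar h \<and> dm h = Z \<and> cd h = Y \<and> (\<forall>i\<in>{}. h \<cdot> \<iota> i = g i)" if "Y \<in> Ob K" for Y g
    using assms that by (intro exI[of _ "zr Z Y"]) simp
  show "h = h'" if "ar h" "ar h'" "dm h = Z" "dm h' = Z" "cd h' = cd h" for h h'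
    by (rule trans[OF from_zero[OF assms that(1,3) that(5)[symmetric]] from_zero[OF assms that(2,4) refl, symmetric]])
qed (use assms in auto)

lemma biproduct_coproduct:
  assumes "biproduct K A B X i j p q" "a \<noteq> b"
  shows "coproduct K {a, b} (\<lambda>n. if n = a then A else B) X (\<lambda>n. if n = a then i else j)"
proof (rule coproductI)
  note D = biproductD[OF assms(1)]
  fix Y g assume g: "Y \<in> Ob K"
    "\<And>n. n \<in> {a, b} \<Longrightarrow> ar (g n) \<and> dm (g n) = (if n = a then A else B) \<and> cd (g n) = Y"
  show "\<exists>h. ar h \<and> dm h = X \<and> cd h = Y \<and> (\<forall>n\<in>{a, b}. h \<cdot> (if n = a then i else j) = g n)"
  proof -
    have ab: "ar (g a)" "dm (g a) = A" "cd (g a) = Y" "ar (g b)" "dm (g b) = B" "cd (g b) = Y"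
      using g(2)[of a] g(2)[of b] assms(2) by auto
    have "(g a \<cdot> p \<^bold>+ g b \<cdot> q) \<cdot> i = g a" "(g a \<cdot> p \<^bold>+ g b \<cdot> q) \<cdot> j = g b"
      using ab D by simp_all
    then show ?thesis
      using ab D(4-15) assms(2) by (intro exI[of _ "g a \<cdot> p \<^bold>+ g b \<cdot> q"]) auto
  qed
next
  note D = biproductD[OF assms(1)]
  fix h h' assume h: "ar h" "ar h'" "dm h = X" "dm h' = X" "cd h' = cd h"
    "\<And>n. n \<in> {a, b} \<Longrightarrow> h \<cdot> (if n = a then i else j) = h' \<cdot> (if n = a then i else j)"
  have "(b = a) = False" using assms(2) by blast
  then have ij: "h \<cdot> i = h' \<cdot> i" "h \<cdot> j = h' \<cdot> j"
    using h(6)[of a] h(6)[of b] by (simp_all only: insert_iff if_True if_False simp_thms)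
  have *: "k = (k \<cdot> i) \<cdot> p \<^bold>+ (k \<cdot> j) \<cdot> q" if "ar k" "dm k = X" for k
  proof -
    have "k = k \<cdot> (i \<cdot> p \<^bold>+ j \<cdot> q)" unfolding D(20) using that by simp
    also have "\<dots> = (k \<cdot> i) \<cdot> p \<^bold>+ (k \<cdot> j) \<cdot> q" using that D(1-15) by simp
    finally show ?thesis .
  qed
  show "h = h'" using *[OF h(1,3)] *[OF h(2,4)] unfolding ij by (rule trans[OF _ sym])
qed (use biproductD[OF assms(1)] in auto)

end

section \<open>Small sets\<close>

context
  fixes \<kappa> :: "'i rel"
  assumes \<kappa>: "size_bound \<kappa>"
begin

lemma Cinfinite_size_bound: "Cinfinite \<kappa>"
proof -
  have "natLeq \<le>o \<kappa>" using \<kappa> ordLess_imp_ordLeq unfolding size_bound_def by blast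
  then show ?thesis using \<kappa> cinfinite_mono natLeq_cinfinite unfolding size_bound_def by blast
qed

lemma small_image: "small \<kappa> S \<Longrightarrow> small \<kappa> (f ` S)"
  unfolding small_def using card_of_image ordLeq_ordLess_trans by blast

lemma small_subset: "\<lbrakk>small \<kappa> T; S \<subseteq> T\<rbrakk> \<Longrightarrow> small \<kappa> S"
  unfolding small_def using card_of_mono1 ordLeq_ordLess_trans by blast

text \<open>This is where regularity of the cardinal enters.\<close>

lemma small_UN: "\<lbrakk>small \<kappa> S; \<And>x. x \<in> S \<Longrightarrow> small \<kappa> (F x)\<rbrakk> \<Longrightarrow> small \<kappa> (\<Union>x\<in>S. F x)"
  unfolding small_def using \<kappa> Cinfinite_size_bound
  by (auto intro!: card_of_UNION_ordLess_infinite_Field_regularCard simp: size_bound_def)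

text \<open>The strict inequality in \<open>size_bound\<close> makes countable coproducts, and hence
  sequential homotopy colimits, available.\<close>

lemma small_nat: "small \<kappa> (UNIV :: nat set)"
  unfolding small_def using \<kappa> card_of_nat ordIso_ordLess_trans unfolding size_bound_def by blast

lemma small_finite: "finite S \<Longrightarrow> small \<kappa> S"
proof -
  assume "finite S"
  then have "|S| <o |UNIV :: nat set|" by (simp add: finite_ordLess_infinite2)
  then show ?thesis using small_nat ordLess_transitive unfolding small_def by blast
qed

lemma small_Sigma: "\<lbrakk>small \<kappa> S; \<And>x. x \<in> S \<Longrightarrow> small \<kappa> (F x)\<rbrakk> \<Longrightarrow> small \<kappa> (Sigma S F)"
proof -
  assume "small \<kappa> S" "\<And>x. x \<in> S \<Longrightarrow> small \<kappa> (F x)"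
  then have "small \<kappa> (\<Union>x\<in>S. Pair x ` F x)" by (intro small_UN small_image)
  then show ?thesis by (rule small_subset) auto
qed

text \<open>A set smaller than \<open>\<kappa>\<close> injects into \<open>Field \<kappa>\<close>,
  whose elements have type \<open>'i\<close>; its image is the index set.\<close>

lemma small_index:
  fixes J :: "'j set"
  assumes "small \<kappa> J"
  obtains e and I :: "'i set" where "bij_betw e I J" "small \<kappa> I"
proof -
  have "|J| \<le>o |Field \<kappa>|"
    using assms \<kappa> card_of_Field_ordIso ordIso_symmetric ordLess_imp_ordLeq ordLeq_ordIso_trans
    unfolding small_def size_bound_def by blast
  then obtain f :: "'j \<Rightarrow> 'i" where "inj_on f J" using card_of_ordLeq by metis
  then have "bij_betw (the_inv_into J f) (f ` J) J"
    by (simp add: bij_betw_the_inv_into inj_on_imp_bij_betw)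
  then show thesis using that small_image[OF assms] by blast
qed

text \<open>Biproducts are to be read as coproducts indexed in \<open>'i\<close>, so this type must
  have two elements.\<close>

lemma two_indices: obtains a b :: 'i where "a \<noteq> b"
proof -
  obtain e and I :: "'i set" where "bij_betw e I (UNIV :: nat set)"
    using small_index[OF small_nat] .
  then obtain a b where "e a = 0" "e b = 1" unfolding bij_betw_def by (metis UNIV_I imageE)
  then show thesis using that[of a b] by force
qed

end

lemma small_inj:
  assumes "size_bound \<kappa>" "inj_on f S" "small \<kappa> (f ` S)"
  shows "small \<kappa> S"
proof -
  have "small \<kappa> (inv_into S f ` f ` S)" by (rule small_image[OF assms(1,3)])
  then show ?thesis using assms(2) by simp
qed

section \<open>Compact objects\<close>

context preadditive_category
begin

text \<open>Compactness of \<open>C\<close> is only ever used in the form that every morphism from \<open>C\<close> to a coproduct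
  with injections \<open>\<iota>\<close> satisfies \<open>fsum\<close>; injectivity of the canonical map is automatic.\<close>

inductive fsum :: "'j set \<Rightarrow> ('j \<Rightarrow> 'm) \<Rightarrow> 'o \<Rightarrow> 'o \<Rightarrow> 'm \<Rightarrow> bool" for J \<iota> C X where
  fsum_zr: "fsum J \<iota> C X (zr C X)"
| fsum_add: "\<lbrakk>fsum J \<iota> C X f; i \<in> J; ar g; dm g = C; cd g = dm (\<iota> i)\<rbrakk> \<Longrightarrow> fsum J \<iota> C X (f \<^bold>+ \<iota> i \<cdot> g)"

lemma fsum_arr:
  assumes "fsum J \<iota> C X f" "C \<in> Ob K" "coproduct K J A X \<iota>"
  shows "ar f" "dm f = C" "cd f = X"
proof -
  note D = coproductD[OF assms(3)]
  have "ar f \<and> dm f = C \<and> cd f = X"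
    using assms(1)
  proof induction
    case fsum_zr then show ?case using assms(2) D by simp
  next
    case (fsum_add f i g) then show ?case using D(1) D(2-5)[of i] by simp
  qed
  then show "ar f" "dm f = C" "cd f = X" by auto
qed

lemma fsum_pl:
  assumes "fsum J \<iota> C X g" "fsum J \<iota> C X f" "C \<in> Ob K" "coproduct K J A X \<iota>"
  shows "fsum J \<iota> C X (f \<^bold>+ g)"
  using assms(1)
proof induction
  note D = coproductD[OF assms(4)] and f = fsum_arr[OF assms(2-4)]
  case fsum_zr then show ?case using assms(2) f by simp
next
  note D = coproductD[OF assms(4)] and f = fsum_arr[OF assms(2-4)]
  case (fsum_add g i h)
  have "f \<^bold>+ (g \<^bold>+ \<iota> i \<cdot> h) = (f \<^bold>+ g) \<^bold>+ \<iota> i \<cdot> h"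
    using fsum_arr[OF fsum_add(1) assms(3,4)] f fsum_add D(1) D(2-5)[of i] by (simp add: pl_assoc)
  then show ?case using fsum.fsum_add[OF fsum_add(6,2-5)] by simp
qed

lemma fsum_single:
  assumes "coproduct K J A X \<iota>" "i \<in> J" "ar g" "dm g = C" "cd g = A i"
  shows "fsum J \<iota> C X (\<iota> i \<cdot> g)"
proof -
  note D = coproductD[OF assms(1)]
  have "C \<in> Ob K" using dm_Ob[OF assms(3)] assms(4) by simp
  then show ?thesis
    using fsum_add[OF fsum_zr assms(2,3,4), of \<iota> X] D(1) D(2-5)[of i] assms by simp
qed

lemma fsum_cmp:
  assumes "fsum J \<iota> C X f" "ar h" "cd h = C" "coproduct K J A X \<iota>"
  shows "fsum J \<iota> (dm h) X (f \<cdot> h)"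
  using assms(1)
proof induction
  case fsum_zr
  then show ?case using assms coproductD[OF assms(4)] fsum.fsum_zr by simp
next
  note D = coproductD[OF assms(4)]
  have C: "C \<in> Ob K" using cd_Ob[OF assms(2)] assms(3) by simp
  case (fsum_add f i g)
  have "(f \<^bold>+ \<iota> i \<cdot> g) \<cdot> h = f \<cdot> h \<^bold>+ \<iota> i \<cdot> (g \<cdot> h)"
    using fsum_arr[OF fsum_add(1) C assms(4)] fsum_add D(1) D(2-5)[of i] assms by simp
  then show ?case using fsum.fsum_add[OF fsum_add(6,2), of "g \<cdot> h"] fsum_add assms by simp
qed

lemma fsum_reindex:
  "\<lbrakk>fsum I (\<lambda>j. \<iota> (e j)) C X f; e ` I \<subseteq> J\<rbrakk> \<Longrightarrow> fsum J \<iota> C X f"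
  by (induction rule: fsum.induct) (auto intro: fsum_zr fsum_add)

section \<open>Finite sums and the definition of compactness\<close>

lemma pl_HomG: "\<lbrakk>ar f; dm f = A; cd f = B\<rbrakk> \<Longrightarrow> f \<otimes>\<^bsub>HomG K A B\<^esub> g = f \<^bold>+ g"
  unfolding pl_def by simp

lemma fsum_finprod:
  assumes "coproduct K J A X \<iota>" "C \<in> Ob K" "finite F" "F \<subseteq> J"
    and g: "\<And>i. i \<in> J \<Longrightarrow> ar (g i) \<and> dm (g i) = C \<and> cd (g i) = A i"
  shows "fsum J \<iota> C X (finprod (HomG K C X) (\<lambda>i. \<iota> i \<cdot> g i) F)"
  using assms(3,4)
proof induction
  note D = coproductD[OF assms(1)]
  interpret G: comm_group "HomG K C X" by (rule Hom_group[OF assms(2) D(1)])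
  case empty then show ?case by (simp add: fsum_zr)
next
  note D = coproductD[OF assms(1)]
  interpret G: comm_group "HomG K C X" by (rule Hom_group[OF assms(2) D(1)])
  case (insert i F)
  have mem: "\<iota> j \<cdot> g j \<in> Hom K C X" if "j \<in> insert i F" for j
  proof -
    have "j \<in> J" using that insert(4) by blast
    then show ?thesis using D(1-5) g[of j] assms(2) by simp
  qed
  have "finprod (HomG K C X) (\<lambda>i. \<iota> i \<cdot> g i) (insert i F)
      = \<iota> i \<cdot> g i \<otimes>\<^bsub>HomG K C X\<^esub> finprod (HomG K C X) (\<lambda>i. \<iota> i \<cdot> g i) F"
    by (rule G.finprod_insert) (use insert(1,2) mem in auto)
  moreover have i: "i \<in> J" using insert(4) by blast
  moreover have "fsum J \<iota> C X (finprod (HomG K C X) (\<lambda>i. \<iota> i \<cdot> g i) F)" using insert by blast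
  moreover have "fsum J \<iota> C X (\<iota> i \<cdot> g i)" by (rule fsum_single[OF assms(1) i]) (use g[OF i] in auto)
  ultimately show ?case
    using fsum_pl[OF _ _ assms(2,1)] D(1) D(2-5)[OF i] g[OF i] by (simp add: pl_HomG)
qed

text \<open>Zero morphisms let a projection be prescribed on the summands. Applied to a finite sum
  it reads off a coordinate, which is why the canonical map is injective.\<close>

lemma coproduct_proj:
  assumes "coproduct K J A X \<iota>" "i \<in> J"
  obtains p where "ar p" "dm p = X" "cd p = A i" "p \<cdot> \<iota> i = ident K (A i)"
    "\<And>j. j \<in> J \<Longrightarrow> j \<noteq> i \<Longrightarrow> p \<cdot> \<iota> j = zr (A j) (A i)"
proof -
  note D = coproductD[OF assms(1)]
  obtain p where "ar p" "dm p = X" "cd p = A i"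
    "\<And>j. j \<in> J \<Longrightarrow> p \<cdot> \<iota> j = (if j = i then ident K (A i) else zr (A j) (A i))"
    by (rule coproduct_ex[OF assms(1), of "A i"
          "\<lambda>j. if j = i then ident K (A i) else zr (A j) (A i)"]) (use D assms(2) in auto)
  then show thesis using that[of p] assms(2) by auto
qed

lemma proj_finprod:
  assumes "coproduct K J A X \<iota>" "C \<in> Ob K" "finite F" "F \<subseteq> J"
    and g: "\<And>i. i \<in> J \<Longrightarrow> ar (g i) \<and> dm (g i) = C \<and> cd (g i) = A i"
    and i: "i \<in> J" and p: "ar p" "dm p = X" "cd p = A i" "p \<cdot> \<iota> i = ident K (A i)"
    "\<And>j. j \<in> J \<Longrightarrow> j \<noteq> i \<Longrightarrow> p \<cdot> \<iota> j = zr (A j) (A i)"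
  shows "p \<cdot> finprod (HomG K C X) (\<lambda>i. \<iota> i \<cdot> g i) F = (if i \<in> F then g i else zr C (A i))"
  using assms(3,4)
proof induction
  note D = coproductD[OF assms(1)]
  interpret G: comm_group "HomG K C X" by (rule Hom_group[OF assms(2) D(1)])
  case empty then show ?case using p(1-3) assms(2) i D(2) by simp
next
  note D = coproductD[OF assms(1)]
  interpret G: comm_group "HomG K C X" by (rule Hom_group[OF assms(2) D(1)])
  case (insert j F)
  have mem: "\<iota> l \<cdot> g l \<in> Hom K C X" if "l \<in> insert j F" for l
  proof -
    have "l \<in> J" using that insert(4) by blast
    then show ?thesis using D(1-5) g[of l] assms(2) by simp
  qed
  have j: "j \<in> J" using insert(4) by blast
  define s where "s = finprod (HomG K C X) (\<lambda>i. \<iota> i \<cdot> g i) F"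
  have s: "ar s" "dm s = C" "cd s = X"
    using fsum_arr[OF fsum_finprod[OF assms(1,2) insert(1) _ g] assms(2,1)] insert(4) unfolding s_def by auto
  have "finprod (HomG K C X) (\<lambda>i. \<iota> i \<cdot> g i) (insert j F) = \<iota> j \<cdot> g j \<otimes>\<^bsub>HomG K C X\<^esub> s"
    unfolding s_def by (rule G.finprod_insert) (use insert(1,2) mem in auto)
  also have "\<dots> = \<iota> j \<cdot> g j \<^bold>+ s" using D(1) D(2-5)[OF j] g[OF j] by (simp add: pl_HomG)
  finally have e: "p \<cdot> finprod (HomG K C X) (\<lambda>i. \<iota> i \<cdot> g i) (insert j F) = (p \<cdot> \<iota> j) \<cdot> g j \<^bold>+ p \<cdot> s"
    using D(1) D(2-5)[OF j] g[OF j] s p(1-3) by simp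
  have ih: "p \<cdot> s = (if i \<in> F then g i else zr C (A i))" using insert unfolding s_def by blast
  show ?case
  proof (cases "j = i")
    case True
    then show ?thesis using e ih p(4) insert(2) g[OF j] D(2)[OF j] assms(2) by simp
  next
    case False
    then show ?thesis using e ih p(5)[OF j] insert(2) g[OF j] g[OF i] D(2)[OF j] D(2)[OF i] assms(2) by simp
  qed
qed

lemma cpt_Ob: "C \<in> cpt \<kappa> K \<Longrightarrow> C \<in> Ob K"
  unfolding cpt_def by blast

lemma cpt_fsum_index:
  fixes \<kappa> :: "'i rel" and I :: "'i set"
  assumes C: "C \<in> cpt \<kappa> K" and I: "small \<kappa> I" and X: "coproduct K I A X \<iota>"
    and f: "ar f" "dm f = C" "cd f = X"
  shows "fsum I \<iota> C X f"
proof -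
  note D = coproductD[OF X] and CO = cpt_Ob[OF C]
  let ?\<Phi> = "\<lambda>g. gfinprod (HomG K C X) (\<lambda>i. \<iota> i \<cdot> g i) I"
  have "?\<Phi> \<in> iso (sum_group I (\<lambda>i. HomG K C (A i))) (HomG K C X)"
    using C I X unfolding cpt_def by blast
  moreover have "f \<in> Hom K C X" using f CO D by simp
  ultimately obtain g where g: "g \<in> carrier (sum_group I (\<lambda>i. HomG K C (A i)))" "f = ?\<Phi> g"
    unfolding Group.iso_def bij_betw_def by blast
  have gr: "\<And>i. i \<in> I \<Longrightarrow> group (HomG K C (A i))" using group_Hom CO D by blast
  have car: "carrier (sum_group I (\<lambda>i. HomG K C (A i)))
      = {x \<in> \<Pi>\<^sub>E i\<in>I. Hom K C (A i). finite {i \<in> I. x i \<noteq> zr C (A i)}}"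
    by (rule carrier_sum_group) (rule gr)
  have "g \<in> (\<Pi>\<^sub>E i\<in>I. Hom K C (A i))" using g(1) unfolding car by blast
  then have g': "ar (g i) \<and> dm (g i) = C \<and> cd (g i) = A i" if "i \<in> I" for i
    using that CO D(2)[OF that] by (auto simp: PiE_iff)
  show ?thesis
    \<comment> \<open>\<open>gfinprod\<close> is the product over the support of its summands, or
      the neutral element should that support be infinite; either way it is an
      \<open>fsum\<close>.\<close>
    unfolding g(2) gfinprod_def
    by (auto intro!: fsum_finprod[OF X CO] fsum_zr dest: g')
qed

text \<open>Projections give injectivity. Surjectivity is an induction on \<open>fsum\<close>, since
  one more term is the image of a family concentrated at a single index.\<close>

lemma cptI:
  fixes \<kappa> :: "'i rel"
  assumes CO: "C \<in> Ob K"
    and fs: "\<And>(I::'i set) A X \<iota> f. \<lbrakk>small \<kappa> I; coproduct K I A X \<iota>; ar f; dm f = C; cd f = X\<rbrakk> \<Longrightarrow> fsum I \<iota> C X f"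
  shows "C \<in> cpt \<kappa> K"
  unfolding cpt_def
proof (intro CollectI conjI allI impI CO)
  fix I :: "'i set" and A X \<iota>
  assume *: "small \<kappa> I \<and> coproduct K I A X \<iota>"
  then have X: "coproduct K I A X \<iota>" by blast
  note D = coproductD[OF X]
  let ?\<Phi> = "\<lambda>g. gfinprod (HomG K C X) (\<lambda>i. \<iota> i \<cdot> g i) I"
  let ?S = "sum_group I (\<lambda>i. HomG K C (A i))"
  have gr: "\<And>i. i \<in> I \<Longrightarrow> group (HomG K C (A i))" using group_Hom CO D by blast
  have car: "carrier (sum_group I (\<lambda>i. HomG K C (A i)))
      = {x \<in> \<Pi>\<^sub>E i\<in>I. Hom K C (A i). finite {i \<in> I. x i \<noteq> zr C (A i)}}"
    by (rule carrier_sum_group) (rule gr)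
  interpret G: comm_group "HomG K C X" by (rule Hom_group[OF CO D(1)])
  interpret S: group ?S by (rule sum_group) (rule gr)
  have hom: "?\<Phi> \<in> hom ?S (HomG K C X)"
    by (rule G.hom_group_sum) (use D CO in \<open>auto intro!: cmp_hom_right gr\<close>)
  interpret H: group_hom ?S "HomG K C X" ?\<Phi>
    by unfold_locales (rule hom)
  have g': "ar (g i) \<and> dm (g i) = C \<and> cd (g i) = A i" if "g \<in> carrier ?S" "i \<in> I" for g i
    using that CO D(2)[OF that(2)] car by (auto simp: PiE_iff)
  have fin: "finite {i \<in> I. \<iota> i \<cdot> g i \<noteq> zr C X}" if "g \<in> carrier ?S" for g
  proof (rule finite_subset)
    show "finite {i \<in> I. g i \<noteq> zr C (A i)}" using that car by auto
    show "{i \<in> I. \<iota> i \<cdot> g i \<noteq> zr C X} \<subseteq> {i \<in> I. g i \<noteq> zr C (A i)}" using D CO by auto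
  qed
  have "inj_on ?\<Phi> (carrier ?S)"
    unfolding H.inj_on_one_iff
  proof (intro allI impI)
    fix g assume g: "g \<in> carrier ?S" and z: "?\<Phi> g = zr C X"
    have "g i = zr C (A i)" if i: "i \<in> I" for i
    proof -
      obtain p where p: "ar p" "dm p = X" "cd p = A i" "p \<cdot> \<iota> i = ident K (A i)"
        "\<And>j. j \<in> I \<Longrightarrow> j \<noteq> i \<Longrightarrow> p \<cdot> \<iota> j = zr (A j) (A i)"
        by (rule coproduct_proj[OF X i]) (use that in blast)
      let ?F = "{i \<in> I. \<iota> i \<cdot> g i \<noteq> zr C X}"
      have "zr C (A i) = p \<cdot> ?\<Phi> g" unfolding z using p CO D by simp
      also have "\<dots> = p \<cdot> finprod (HomG K C X) (\<lambda>i. \<iota> i \<cdot> g i) ?F"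
        unfolding gfinprod_def using fin[OF g] by simp
      also have "\<dots> = (if i \<in> ?F then g i else zr C (A i))"
        by (rule proj_finprod[OF X CO fin[OF g]]) (use g' g i p in auto)
      finally have 1: "zr C (A i) = (if i \<in> ?F then g i else zr C (A i))" .
      show ?thesis
      proof (cases "i \<in> ?F")
        case True then show ?thesis using 1 by simp
      next
        case False
        then have "\<iota> i \<cdot> g i = zr C X" using i by simp
        then have "p \<cdot> (\<iota> i \<cdot> g i) = zr C (A i)" using p CO D by simp
        then have "(p \<cdot> \<iota> i) \<cdot> g i = zr C (A i)" using p(1-3) g'[OF g i] D(1) D(2-5)[OF i] by simp
        then show ?thesis using p(4) g'[OF g i] by simp
      qed
    qed
    moreover have "g \<in> extensional I" using g car by (auto simp: PiE_def)
    ultimately show "g = \<one>\<^bsub>?S\<^esub>" by (auto simp: extensional_def fun_eq_iff)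
  qed
  moreover have "f \<in> ?\<Phi> ` carrier ?S" if "f \<in> Hom K C X" for f
  proof -
    have "fsum I \<iota> C X f" by (rule fs[OF _ X]) (use that * CO D(1) in simp_all)
    then show ?thesis
    proof induction
      case fsum_zr
      have "?\<Phi> \<one>\<^bsub>?S\<^esub> = zr C X" by (rule H.hom_one)
      then show ?case by (rule image_eqI[OF sym S.one_closed])
    next
      case (fsum_add f i h)
      from fsum_add(6) obtain g where g: "g \<in> carrier ?S" "f = ?\<Phi> g" by (elim imageE)
      have h: "h \<in> Hom K C (A i)" using fsum_add D(1) D(2-5)[of i] CO by simp
      define e where "e = (\<lambda>j\<in>I. if j = i then h else zr C (A j))"
      have "finite {j \<in> I. e j \<noteq> zr C (A j)}"
        by (rule finite_subset[of _ "{i}"]) (auto simp: e_def)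
      then have e: "e \<in> carrier ?S"
        using h CO D(2) fsum_add(2) unfolding car by (simp add: e_def PiE_iff del: Hom_iff)
         (simp add: group.is_monoid gr)
      have ei: "\<iota> i \<cdot> e i = \<iota> i \<cdot> h" using fsum_add(2) by (simp add: e_def)
      have ej: "\<iota> j \<cdot> e j = zr C X" if "j \<in> I" "j \<noteq> i" for j
        using that D(1) D(2-5)[OF that(1)] CO by (simp add: e_def)
      have hm: "\<iota> i \<cdot> h \<in> Hom K C X" using fsum_add D(1) D(2-5)[of i] CO by simp
      \<comment> \<open>The product runs over the support, which is empty instead of
        \<open>{i}\<close> when the single term happens to vanish.\<close>
      have "j \<in> {j \<in> I. \<iota> j \<cdot> e j \<noteq> zr C X} \<longleftrightarrow> j \<in> (if \<iota> i \<cdot> h = zr C X then {} else {i})" for j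
        using ei ej[of j] fsum_add(2) by (cases "j = i") simp_all
      then have sup: "{j \<in> I. \<iota> j \<cdot> e j \<noteq> zr C X} = (if \<iota> i \<cdot> h = zr C X then {} else {i})"
        by (rule Set.set_eqI)
      have "finprod (HomG K C X) (\<lambda>j. \<iota> j \<cdot> e j) (insert i {})
          = \<iota> i \<cdot> e i \<otimes>\<^bsub>HomG K C X\<^esub> finprod (HomG K C X) (\<lambda>j. \<iota> j \<cdot> e j) {}"
        by (rule G.finprod_insert) (use hm ei in \<open>auto simp del: Hom_iff\<close>)
      then have "finprod (HomG K C X) (\<lambda>j. \<iota> j \<cdot> e j) {i} = \<iota> i \<cdot> h"
        using hm ei by (simp del: Hom_iff)
      then have Pe: "?\<Phi> e = \<iota> i \<cdot> h"
        unfolding gfinprod_def sup by auto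
      have "?\<Phi> (g \<otimes>\<^bsub>?S\<^esub> e) = ?\<Phi> g \<otimes>\<^bsub>HomG K C X\<^esub> ?\<Phi> e" by (rule H.hom_mult[OF g(1) e])
      moreover have "ar f" "dm f = C" "cd f = X" using fsum_arr[OF fsum_add(1) CO X] by auto
      ultimately have "f \<^bold>+ \<iota> i \<cdot> h = ?\<Phi> (g \<otimes>\<^bsub>?S\<^esub> e)" unfolding g(2)[symmetric] Pe by (simp add: pl_HomG)
      then show ?case by (rule image_eqI[OF _ S.m_closed[OF g(1) e]])
    qed
  qed
  ultimately have "bij_betw ?\<Phi> (carrier ?S) (Hom K C X)"
    unfolding bij_betw_def using H.hom_closed by blast
  then show "?\<Phi> \<in> iso ?S (HomG K C X)" using hom unfolding Group.iso_def by blast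
qed

lemma cpt_fsum:
  fixes J :: "'j set" and \<kappa> :: "'i rel"
  assumes "size_bound \<kappa>" "C \<in> cpt \<kappa> K" "small \<kappa> J" "coproduct K J A X \<iota>" "ar f" "dm f = C" "cd f = X"
  shows "fsum J \<iota> C X f"
proof -
  obtain e and I :: "'i set" where e: "bij_betw e I J" "small \<kappa> I" using small_index[OF assms(1,3)] .
  have "fsum I (\<lambda>j. \<iota> (e j)) C X f"
    by (rule cpt_fsum_index[OF assms(2) e(2) coproduct_reindex[OF assms(4) e(1)] assms(5-7)])
  then show ?thesis by (rule fsum_reindex) (use e(1) in \<open>simp add: bij_betw_def\<close>)
qed

lemma cpt_iso:
  fixes \<kappa> :: "'i rel"
  assumes "C \<in> cpt \<kappa> K" "isop C D f g"
  shows "D \<in> cpt \<kappa> K"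
proof (rule cptI)
  note I = isopD[OF assms(2)]
  show "D \<in> Ob K" by (rule I)
  fix J :: "'i set" and A X \<iota> h assume h: "small \<kappa> J" "coproduct K J A X \<iota>" "ar h" "dm h = D" "cd h = X"
  have "fsum J \<iota> C X (h \<cdot> f)" by (rule cpt_fsum_index[OF assms(1) h(1,2)]) (use I h in auto)
  from fsum_cmp[OF this I(2,6) h(2)] show "fsum J \<iota> D X h" using I h by simp
qed

text \<open>This serves the topology of the spectrum, where the intersection of two open sets is
  described by biproducts.\<close>

lemma cpt_biproduct:
  fixes \<kappa> :: "'i rel"
  assumes "A \<in> cpt \<kappa> K" "B \<in> cpt \<kappa> K" "biproduct K A B X i j p q"
  shows "X \<in> cpt \<kappa> K"
proof (rule cptI)
  note D = biproductD[OF assms(3)]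
  show X: "X \<in> Ob K" by (rule D)
  fix J :: "'i set" and F Y \<iota> h assume h: "small \<kappa> J" "coproduct K J F Y \<iota>" "ar h" "dm h = X" "cd h = Y"
  have "fsum J \<iota> A Y (h \<cdot> i)" by (rule cpt_fsum_index[OF assms(1) h(1,2)]) (use D h in auto)
  from fsum_cmp[OF this D(10,12) h(2)] have 1: "fsum J \<iota> X Y ((h \<cdot> i) \<cdot> p)" using D by simp
  have "fsum J \<iota> B Y (h \<cdot> j)" by (rule cpt_fsum_index[OF assms(2) h(1,2)]) (use D h in auto)
  from fsum_cmp[OF this D(13,15) h(2)] have 2: "fsum J \<iota> X Y ((h \<cdot> j) \<cdot> q)" using D by simp
  have "h = h \<cdot> (i \<cdot> p \<^bold>+ j \<cdot> q)" unfolding D(20) using h by simp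
  also have "\<dots> = (h \<cdot> i) \<cdot> p \<^bold>+ (h \<cdot> j) \<cdot> q" using h D(1-15) by simp
  finally show "fsum J \<iota> X Y h" using fsum_pl[OF 2 1 X h(2)] by simp
qed

lemma coproduct_cong:
  assumes "coproduct K J A X \<iota>" "\<And>i. i \<in> J \<Longrightarrow> A i = A' i"
  shows "coproduct K J A' X \<iota>"
  using assms(1) unfolding coproduct_def by (simp add: assms(2) cong: ball_cong del: Hom_iff)

lemma Hom_isop:
  assumes "isop C C' u v" "isop A A' s t"
  shows "Hom K C A \<subseteq> (\<lambda>f. t \<cdot> (f \<cdot> u)) ` Hom K C' A'"
proof
  note U = isopD[OF assms(1)] and V = isopD[OF assms(2)]
  fix f assume "f \<in> Hom K C A"
  then have f: "ar f" "dm f = C" "cd f = A" using U V by auto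
  have "t \<cdot> ((s \<cdot> (f \<cdot> v)) \<cdot> u) = t \<cdot> (s \<cdot> (f \<cdot> (v \<cdot> u)))" using f U(1-6) V(1-6) by simp
  also have "\<dots> = f" unfolding U(7) using f isop_cancel(1)[OF assms(2), of f] by simp
  finally have "f = t \<cdot> ((s \<cdot> (f \<cdot> v)) \<cdot> u)" ..
  moreover have "s \<cdot> (f \<cdot> v) \<in> Hom K C' A'" using f U V by simp
  ultimately show "f \<in> (\<lambda>f. t \<cdot> (f \<cdot> u)) ` Hom K C' A'" by (rule image_eqI)
qed

end

section \<open>Triangulated categories\<close>

context triangulated_category
begin

lemma sh_Ob [simp]: "A \<in> Ob K \<Longrightarrow> sh K A \<in> Ob K"
  using sh_functor unfolding additive_functor_def by simp

lemma shm_ident [simp]: "A \<in> Ob K \<Longrightarrow> shm K (ident K A) = ident K (sh K A)"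
  using sh_functor unfolding additive_functor_def by simp

lemma shm_hom: "\<lbrakk>A \<in> Ob K; B \<in> Ob K\<rbrakk> \<Longrightarrow> shm K \<in> hom (HomG K A B) (HomG K (sh K A) (sh K B))"
  using sh_functor unfolding additive_functor_def by simp

lemma shm_simps [simp]:
  assumes "ar f"
  shows "ar (shm K f)" "dm (shm K f) = sh K (dm f)" "cd (shm K f) = sh K (cd f)"
  using hom_in_carrier[OF shm_hom ar_Hom[OF assms]] assms by auto

lemma shm_cmp [simp]: "\<lbrakk>ar f; ar g; dm g = cd f\<rbrakk> \<Longrightarrow> shm K (g \<cdot> f) = shm K g \<cdot> shm K f"
proof -
  assume f: "ar f" "ar g" "dm g = cd f"
  have "\<forall>A\<in>Ob K. \<forall>B\<in>Ob K. \<forall>C\<in>Ob K. \<forall>f\<in>Hom K A B. \<forall>g\<in>Hom K B C. shm K (g \<cdot> f) = shm K g \<cdot> shm K f"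
    using sh_functor unfolding additive_functor_def by (elim conjE)
  moreover have "g \<in> Hom K (cd f) (cd g)" using f by simp
  ultimately show ?thesis using f ar_Hom[OF f(1)] dm_Ob[OF f(1)] cd_Ob[OF f(1)] cd_Ob[OF f(2)] by blast
qed

lemma shm_pl [simp]: "\<lbrakk>ar f; ar g; dm g = dm f; cd g = cd f\<rbrakk> \<Longrightarrow> shm K (f \<^bold>+ g) = shm K f \<^bold>+ shm K g"
  using hom_mult[OF shm_hom[of "dm f" "cd f"], of f g] by (simp add: pl_def)

lemma shm_zr [simp]: "\<lbrakk>A \<in> Ob K; B \<in> Ob K\<rbrakk> \<Longrightarrow> shm K (zr A B) = zr (sh K A) (sh K B)"
  using hom_one[OF shm_hom group_Hom group_Hom] by simp

lemma shm_ng [simp]: "ar f \<Longrightarrow> shm K (\<^bold>- f) = \<^bold>- (shm K f)"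
  by (rule ng_unique) (simp_all flip: shm_pl)

lemma shm_inj:
  assumes "ar f" "ar g" "dm g = dm f" "cd g = cd f" "shm K f = shm K g"
  shows "f = g"
proof -
  have "inj_on (shm K) (Hom K (dm f) (cd f))"
    using sh_fully_faithful[of "dm f" "cd f"] assms(1) unfolding bij_betw_def by simp
  then show ?thesis by (rule inj_onD) (use assms in simp_all)
qed

lemma shm_full:
  assumes "ar h" "dm h = sh K A" "cd h = sh K B" "A \<in> Ob K" "B \<in> Ob K"
  obtains f where "ar f" "dm f = A" "cd f = B" "h = shm K f"
proof -
  have "h \<in> shm K ` Hom K A B"
    using sh_fully_faithful[of A B] assms unfolding bij_betw_def by simp
  then obtain f where "f \<in> Hom K A B" "h = shm K f" by (elim imageE)
  moreover from this(1) have "ar f" "dm f = A" "cd f = B" using assms by auto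
  ultimately show thesis using that by blast
qed

lemma sh_isop: "isop A B f g \<Longrightarrow> isop (sh K A) (sh K B) (shm K f) (shm K g)"
  unfolding isop_def by (auto simp flip: shm_cmp)

lemma desuspend:
  assumes "A \<in> Ob K"
  obtains B f g where "B \<in> Ob K" "isop (sh K B) A f g"
proof -
  obtain B where B: "B \<in> Ob K" "isomorphic K (sh K B) A" using sh_ess_surj[OF assms] by blast
  then obtain f g where "isop (sh K B) A f g" using isomorphic_iff[OF sh_Ob assms] by blast
  then show thesis using that B by blast
qed

lemma zero_sh: "zero_object K Z \<Longrightarrow> zero_object K (sh K Z)"
proof -
  assume Z: "zero_object K Z"
  have "ident K Z = zr Z Z" by (rule to_zero[OF Z]) (use Z in auto)
  then have "shm K (ident K Z) = shm K (zr Z Z)" by simp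
  then show ?thesis using Z by (intro zero_objectI) auto
qed

lemma distD:
  assumes "dist K A B C f g h"
  shows "A \<in> Ob K" "B \<in> Ob K" "C \<in> Ob K"
    "ar f" "dm f = A" "cd f = B" "ar g" "dm g = B" "cd g = C" "ar h" "dm h = C" "cd h = sh K A"
  using dist_wf[OF assms] by auto

lemma rotate:
  assumes "dist K A B C f g h"
  shows "dist K B C (sh K A) g h (\<^bold>- (shm K f))"
proof -
  note D = distD[OF assms]
  have "\<^bold>- (shm K f) = inv\<^bsub>HomG K (sh K A) (sh K B)\<^esub> shm K f" using D unfolding ng_def by simp
  then show ?thesis using TR2[of A B C f g h] assms D by simp
qed

text \<open>\<open>TR1_ident\<close> is applied with the zero object \<open>sh K Z\<close> and the
  triangle is rotated backwards, which \<open>TR2\<close> allows as it is an equivalence.\<close>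

lemma zero_dist:
  assumes "A \<in> Ob K" "zero_object K Z"
  shows "dist K Z A A (zr Z A) (ident K A) (zr A (sh K Z))"
proof -
  have Z: "Z \<in> Ob K" using assms by simp
  note sZ = zero_sh[OF assms(2)]
  have "dist K A A (sh K Z) (ident K A) (zr A (sh K Z)) (zr (sh K Z) (sh K A))"
    by (rule TR1_ident[OF assms(1) sZ])
  moreover have "inv\<^bsub>HomG K (sh K Z) (sh K A)\<^esub> shm K (zr Z A) = zr (sh K Z) (sh K A)"
    using assms(1) Z monoid.inv_one[OF group.is_monoid[OF group_Hom[of "sh K Z" "sh K A"]]] by simp
  ultimately show ?thesis
    using TR2[of Z A A "zr Z A" "ident K A" "zr A (sh K Z)"] assms Z by simp
qed

text \<open>\<open>TR3\<close> maps the identity triangle of \<open>A\<close> to the given one, so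
  the composite factors through a zero object.\<close>

lemma dist_comp:
  assumes "dist K A B C f g h"
  shows "g \<cdot> f = zr A C"
proof -
  note D = distD[OF assms]
  obtain Z where Z: "zero_object K Z" using zero_exists by blast
  have "\<exists>c\<in>Hom K Z C. c \<cdot> zr A Z = g \<cdot> f \<and> shm K (ident K A) \<cdot> zr Z (sh K A) = h \<cdot> c"
    by (rule TR3[OF TR1_ident[OF D(1) Z] assms]) (use D Z in simp_all)
  then obtain c where c: "c \<in> Hom K Z C" "c \<cdot> zr A Z = g \<cdot> f" by blast
  then have "g \<cdot> f = c \<cdot> zr A Z" by simp
  also have "\<dots> = zr A C" using c(1) D Z by simp
  finally show ?thesis .
qed

text \<open>The pair of the zero morphism and \<open>x\<close> maps the triangle to
  \<open>Z \<rightarrow> M \<rightarrow> M\<close>, where \<open>M\<close> is the codomain of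
  \<open>x\<close>; the third component supplied by \<open>TR3\<close> is the factorization.\<close>

lemma weak_coker:
  assumes "dist K A B C f g h" "ar x" "dm x = B" "x \<cdot> f = zr A (cd x)"
  obtains y where "ar y" "dm y = C" "cd y = cd x" "x = y \<cdot> g"
proof -
  note D = distD[OF assms(1)]
  obtain Z where Z: "zero_object K Z" using zero_exists by blast
  have M: "cd x \<in> Ob K" using assms(2) by simp
  have "\<exists>c\<in>Hom K C (cd x). c \<cdot> g = ident K (cd x) \<cdot> x \<and> shm K (zr A Z) \<cdot> h = zr (cd x) (sh K Z) \<cdot> c"
    by (rule TR3[OF assms(1) zero_dist[OF M Z]]) (use D Z assms M in simp_all)
  then obtain c where c: "c \<in> Hom K C (cd x)" "c \<cdot> g = ident K (cd x) \<cdot> x" by blast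
  have "ar c" "dm c = C" "cd c = cd x" using c(1) D M by simp_all
  moreover have "x = c \<cdot> g" unfolding c(2) using assms(2) by simp
  ultimately show thesis by (rule that)
qed

text \<open>\<open>TR3\<close> only fills in the third morphism, so both triangles are rotated once.
  The morphism found between suspensions is then desuspended, and the two signs cancel.\<close>

lemma weak_ker:
  assumes "dist K A B C f g h" "ar x" "cd x = B" "g \<cdot> x = zr (dm x) C"
  obtains y where "ar y" "dm y = dm x" "cd y = A" "x = f \<cdot> y"
proof -
  note D = distD[OF assms(1)]
  obtain Z where Z: "zero_object K Z" using zero_exists by blast
  define M where "M = dm x"
  have M: "M \<in> Ob K" using assms(2) unfolding M_def by simp
  have 1: "dist K M Z (sh K M) (zr M Z) (zr Z (sh K M)) (\<^bold>- (shm K (ident K M)))"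
    by (rule rotate[OF TR1_ident[OF M Z]])
  have "\<exists>c\<in>Hom K (sh K M) (sh K A). c \<cdot> zr Z (sh K M) = h \<cdot> zr Z C \<and>
      shm K x \<cdot> \<^bold>- (shm K (ident K M)) = \<^bold>- (shm K f) \<cdot> c"
    by (rule TR3[OF 1 rotate[OF assms(1)]]) (use D Z assms M M_def in simp_all)
  then obtain c where c': "c \<in> Hom K (sh K M) (sh K A)"
    "shm K x \<cdot> \<^bold>- (shm K (ident K M)) = \<^bold>- (shm K f) \<cdot> c"
    by blast
  then have c: "ar c" "dm c = sh K M" "cd c = sh K A" using D M by simp_all
  obtain y where y: "ar y" "dm y = M" "cd y = A" "c = shm K y"
    using shm_full[OF c(1-3) M D(1)] .
  have "\<^bold>- (shm K x) = \<^bold>- (shm K (f \<cdot> y))"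
    using c'(2) y D assms(2) M unfolding M_def by simp
  then have "\<^bold>- (\<^bold>- (shm K x)) = \<^bold>- (\<^bold>- (shm K (f \<cdot> y)))" by (rule arg_cong)
  then have "shm K x = shm K (f \<cdot> y)" using assms(2) D y by simp
  then have "x = f \<cdot> y" by (rule shm_inj[rotated -1]) (use D y assms(2,3) M_def in simp_all)
  then show thesis using that y M_def by blast
qed

lemma weak_ker2:
  assumes "dist K A B C f g h" "ar x" "cd x = C" "h \<cdot> x = zr (dm x) (sh K A)"
  obtains y where "ar y" "dm y = dm x" "cd y = B" "x = g \<cdot> y"
  using weak_ker[OF rotate[OF assms(1)] assms(2-4)] .

text \<open>As \<open>i\<close> is split by \<open>p\<close>, the connecting morphism
  \<open>h\<close> vanishes, so \<open>g\<close> has a section. The factor \<open>u\<close> of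
  \<open>q\<close> through \<open>g\<close> is then inverse to \<open>g \<cdot> j\<close>.\<close>

lemma biproduct_dist:
  assumes "biproduct K A B X i j p q"
  obtains C g h u v where "dist K A X C i g h" "isop C B u v"
proof -
  note D = biproductD[OF assms]
  obtain C g h where T: "dist K A X C i g h"
    using TR1_cone[of A X i] D by auto
  note E = distD[OF T]
  have hz: "h = zr C (sh K A)"
  proof -
    have "\<^bold>- (shm K i) \<cdot> h = zr C (sh K X)" by (rule dist_comp[OF rotate[OF rotate[OF T]]])
    then have "shm K p \<cdot> (\<^bold>- (shm K i) \<cdot> h) = zr C (sh K A)" using D E by simp
    then have "\<^bold>- ((shm K p \<cdot> shm K i) \<cdot> h) = zr C (sh K A)" using D E by simp
    then have "\<^bold>- h = zr C (sh K A)" using D E by (simp flip: shm_cmp)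
    then show ?thesis using E ng_eq_zr_iff by blast
  qed
  obtain u where u: "ar u" "dm u = C" "cd u = B" "q = u \<cdot> g"
    by (rule weak_coker[OF T D(13,14)]) (use D in auto)
  obtain s where s: "ar s" "dm s = dm (ident K C)" "cd s = X" "ident K C = g \<cdot> s"
    by (rule weak_ker2[OF T, of "ident K C"]) (use E hz in simp, use E in simp, use E hz in simp, blast)
  have gi: "g \<cdot> i = zr A C" by (rule dist_comp[OF T])
  have "g = g \<cdot> (i \<cdot> p \<^bold>+ j \<cdot> q)" unfolding D(20) using E by simp
  also have "\<dots> = (g \<cdot> i) \<cdot> p \<^bold>+ g \<cdot> (j \<cdot> q)" using D(1-15) E by simp
  also have "\<dots> = (g \<cdot> j) \<cdot> q" unfolding gi using D(1-15) E by simp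
  finally have gjq: "(g \<cdot> j) \<cdot> q = g" by simp
  have "u \<cdot> (g \<cdot> j) = (u \<cdot> g) \<cdot> j" using D u E by simp
  then have 1: "u \<cdot> (g \<cdot> j) = ident K B" unfolding u(4)[symmetric] D(17) .
  have "(g \<cdot> j) \<cdot> u = (g \<cdot> j) \<cdot> (u \<cdot> (g \<cdot> s))" unfolding s(4)[symmetric] using u by simp
  also have "\<dots> = ((g \<cdot> j) \<cdot> (u \<cdot> g)) \<cdot> s" using D E u(1-3) s(1-3) by simp
  also have "\<dots> = ident K C" unfolding u(4)[symmetric] gjq s(4) ..
  finally have 2: "(g \<cdot> j) \<cdot> u = ident K C" .
  have "isop C B u (g \<cdot> j)" unfolding isop_def using 1 2 D(1-15) E u(1-3) by auto
  then show thesis using that T by blast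
qed

section \<open>Thick and localizing subcategories\<close>

lemma triangulated_subD:
  assumes "triangulated_sub K S"
  shows "S \<subseteq> Ob K" "\<And>A B f g. \<lbrakk>A \<in> S; isop A B f g\<rbrakk> \<Longrightarrow> B \<in> S"
    "\<And>A. A \<in> Ob K \<Longrightarrow> sh K A \<in> S \<longleftrightarrow> A \<in> S"
    "\<And>A B C f g h. \<lbrakk>dist K A B C f g h; A \<in> S; B \<in> S\<rbrakk> \<Longrightarrow> C \<in> S"
proof -
  show 1: "S \<subseteq> Ob K" and "\<And>A. A \<in> Ob K \<Longrightarrow> sh K A \<in> S \<longleftrightarrow> A \<in> S"
    and "\<And>A B C f g h. \<lbrakk>dist K A B C f g h; A \<in> S; B \<in> S\<rbrakk> \<Longrightarrow> C \<in> S"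
    using assms unfolding triangulated_sub_def by blast+
  have 2: "\<forall>A\<in>S. \<forall>B\<in>Ob K. isomorphic K A B \<longrightarrow> B \<in> S"
    using assms unfolding triangulated_sub_def by blast
  fix A B f g assume "A \<in> S" "isop A B f g"
  then show "B \<in> S" using 1 2 isomorphic_iff[of A B] isopD[of A B f g] by blast
qed

lemma triangulated_sub_third:
  assumes "triangulated_sub K S" "dist K A B C f g h"
  shows "\<lbrakk>A \<in> S; C \<in> S\<rbrakk> \<Longrightarrow> B \<in> S" "\<lbrakk>B \<in> S; C \<in> S\<rbrakk> \<Longrightarrow> A \<in> S"
proof -
  note D = distD[OF assms(2)] and S = triangulated_subD[OF assms(1)]
  show "A \<in> S" if "B \<in> S" "C \<in> S"
    using S(4)[OF rotate[OF assms(2)] that] S(3)[OF D(1)] by simp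
  show "B \<in> S" if "A \<in> S" "C \<in> S"
    using S(4)[OF rotate[OF rotate[OF assms(2)]] that(2)] S(3)[OF D(1)] S(3)[OF D(2)] that(1) by simp
qed

lemma triangulated_sub_zero:
  assumes "triangulated_sub K S" "zero_object K Z"
  shows "Z \<in> S"
proof -
  obtain A where "A \<in> S" using assms(1) unfolding triangulated_sub_def by blast
  then show ?thesis
    using triangulated_subD(1,4)[OF assms(1)] TR1_ident[OF _ assms(2), of A] by blast
qed

lemma triangulated_sub_biproduct:
  assumes "triangulated_sub K S" "biproduct K A B X i j p q" "A \<in> S" "B \<in> S"
  shows "X \<in> S"
proof -
  obtain C g h u v where T: "dist K A X C i g h" and C: "isop C B u v"
    by (rule biproduct_dist[OF assms(2)])
  have "C \<in> S" using triangulated_subD(2)[OF assms(1) assms(4) isop_sym[OF C]] .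
  then show ?thesis using triangulated_sub_third(1)[OF assms(1) T assms(3)] by blast
qed

lemma thickI:
  assumes "S \<subseteq> Ob K" "\<And>Z. zero_object K Z \<Longrightarrow> Z \<in> S"
    and "\<And>A B f g. \<lbrakk>A \<in> S; isop A B f g\<rbrakk> \<Longrightarrow> B \<in> S"
    and "\<And>A. A \<in> S \<Longrightarrow> sh K A \<in> S" "\<And>A. \<lbrakk>A \<in> Ob K; sh K A \<in> S\<rbrakk> \<Longrightarrow> A \<in> S"
    and "\<And>A B C f g h. \<lbrakk>dist K A B C f g h; A \<in> S; B \<in> S\<rbrakk> \<Longrightarrow> C \<in> S"
    and "\<And>A B X i j p q. \<lbrakk>biproduct K A B X i j p q; X \<in> S\<rbrakk> \<Longrightarrow> A \<in> S \<and> B \<in> S"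
  shows "thick K S"
  unfolding thick_def triangulated_sub_def
proof (intro conjI ballI allI impI)
  show "S \<noteq> {}" using assms(2) zero_exists by blast
  show "S \<subseteq> Ob K" by (rule assms(1))
  show "sh K A \<in> S \<longleftrightarrow> A \<in> S" if "A \<in> Ob K" for A using assms(4)[of A] assms(5)[OF that] by (rule iffI[rotated])
  show "B \<in> S" if A: "A \<in> S" and B: "B \<in> Ob K" and AB: "isomorphic K A B" for A B
  proof -
    obtain f g where "isop A B f g" using A B AB assms(1) isomorphic_iff[of A B] by blast
    then show ?thesis by (rule assms(3)[OF A])
  qed
  show "C \<in> S" if "dist K A B C f g h \<and> A \<in> S \<and> B \<in> S" for A B C f g h
    using that by (elim conjE) (rule assms(6))
  show "A \<in> S" "B \<in> S" if "biproduct K A B X i j p q \<and> X \<in> S" for A B X i j p q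
    using that assms(7)[of A B X i j p q] by simp_all
qed

lemma localizingI:
  fixes \<kappa> :: "'i rel"
  assumes "S \<subseteq> Ob K" "\<And>Z. zero_object K Z \<Longrightarrow> Z \<in> S"
    and "\<And>A B f g. \<lbrakk>A \<in> S; isop A B f g\<rbrakk> \<Longrightarrow> B \<in> S"
    and "\<And>A. A \<in> S \<Longrightarrow> sh K A \<in> S" "\<And>A. \<lbrakk>A \<in> Ob K; sh K A \<in> S\<rbrakk> \<Longrightarrow> A \<in> S"
    and "\<And>A B C f g h. \<lbrakk>dist K A B C f g h; A \<in> S; B \<in> S\<rbrakk> \<Longrightarrow> C \<in> S"
    and "\<And>A B X i j p q. \<lbrakk>biproduct K A B X i j p q; X \<in> S\<rbrakk> \<Longrightarrow> A \<in> S \<and> B \<in> S"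
    and "\<And>(I::'i set) A X \<iota>. \<lbrakk>small \<kappa> I; coproduct K I A X \<iota>; \<And>i. i \<in> I \<Longrightarrow> A i \<in> S\<rbrakk> \<Longrightarrow> X \<in> S"
  shows "localizing \<kappa> K S"
  unfolding localizing_def
proof (intro conjI allI impI)
  show "thick K S" by (rule thickI[OF assms(1-7)])
  fix I :: "'i set" and A X \<iota> assume *: "small \<kappa> I \<and> coproduct K I A X \<iota> \<and> (\<forall>i\<in>I. A i \<in> S)"
  show "X \<in> S" by (rule assms(8)[of I A X \<iota>]) (use * in simp_all)
qed

lemma localizing_sub: "localizing \<kappa> K S \<Longrightarrow> triangulated_sub K S"
  and localizing_biproduct: "\<lbrakk>localizing \<kappa> K S; biproduct K A B X i j p q; X \<in> S\<rbrakk> \<Longrightarrow> A \<in> S \<and> B \<in> S"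
  unfolding localizing_def thick_def by blast+

lemma localizing_coproduct_index:
  fixes \<kappa> :: "'i rel" and I :: "'i set"
  shows "\<lbrakk>localizing \<kappa> K S; small \<kappa> I; coproduct K I A X \<iota>; \<And>i. i \<in> I \<Longrightarrow> A i \<in> S\<rbrakk> \<Longrightarrow> X \<in> S"
  unfolding localizing_def by blast

lemma localizing_coproduct:
  fixes \<kappa> :: "'i rel" and J :: "'j set"
  assumes "size_bound \<kappa>" "localizing \<kappa> K S" "small \<kappa> J" "coproduct K J A X \<iota>" "\<And>i. i \<in> J \<Longrightarrow> A i \<in> S"
  shows "X \<in> S"
proof -
  obtain e and I :: "'i set" where e: "bij_betw e I J" "small \<kappa> I" using small_index[OF assms(1,3)] .
  show ?thesis
    by (rule localizing_coproduct_index[OF assms(2) e(2) coproduct_reindex[OF assms(4) e(1)]])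
     (use e(1) assms(5) bij_betw_apply in fast)
qed

lemma localizing_Ob: "localizing \<kappa> K (Ob K)"
  by (rule localizingI) (auto dest: isopD distD biproductD coproductD)

lemma localizing_Loc: 
  fixes \<kappa> :: "'i rel"
  assumes "G \<subseteq> Ob K"
  shows "localizing \<kappa> K (Loc \<kappa> K G)"
proof (rule localizingI)
  show "Loc \<kappa> K G \<subseteq> Ob K" unfolding Loc_def using assms localizing_Ob by blast
  show "Z \<in> Loc \<kappa> K G" if "zero_object K Z" for Z
    unfolding Loc_def using triangulated_sub_zero[OF localizing_sub that] by blast
  show "B \<in> Loc \<kappa> K G" if "A \<in> Loc \<kappa> K G" "isop A B f g" for A B f g
    using triangulated_subD(2)[OF localizing_sub _ that(2)] that(1) unfolding Loc_def by blast
  show "sh K A \<in> Loc \<kappa> K G" if "A \<in> Loc \<kappa> K G" for A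
    using triangulated_subD(1,3)[OF localizing_sub] that unfolding Loc_def by blast
  show "A \<in> Loc \<kappa> K G" if "A \<in> Ob K" "sh K A \<in> Loc \<kappa> K G" for A
    using triangulated_subD(3)[OF localizing_sub] that unfolding Loc_def by blast
  show "C \<in> Loc \<kappa> K G" if "dist K A B C f g h" "A \<in> Loc \<kappa> K G" "B \<in> Loc \<kappa> K G" for A B C f g h
    using triangulated_subD(4)[OF localizing_sub that(1)] that(2,3) unfolding Loc_def by blast
  show "A \<in> Loc \<kappa> K G \<and> B \<in> Loc \<kappa> K G" if "biproduct K A B X i j p q" "X \<in> Loc \<kappa> K G" for A B X i j p q
    using localizing_biproduct[OF _ that(1)] that(2) unfolding Loc_def by blast
  show "X \<in> Loc \<kappa> K G" if "small \<kappa> I" "coproduct K I A X \<iota>" "\<And>i. i \<in> I \<Longrightarrow> A i \<in> Loc \<kappa> K G"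
    for I :: "'i set" and A X \<iota>
    using localizing_coproduct_index[OF _ that(1,2)] that(3) unfolding Loc_def by blast
qed

lemma Loc_least: "\<lbrakk>localizing \<kappa> K S; G \<subseteq> S\<rbrakk> \<Longrightarrow> Loc \<kappa> K G \<subseteq> S"
  unfolding Loc_def by blast

lemma Loc_contains: "G \<subseteq> Loc \<kappa> K G"
  unfolding Loc_def by blast

section \<open>Coproducts, compactness and suspension\<close>

text \<open>Every test object is a suspension up to isomorphism, and on suspensions full
  faithfulness moves both the given family and the uniqueness question back to
  \<open>X\<close>.\<close>

lemma coproduct_sh:
  assumes X: "coproduct K J A X \<iota>"
  shows "coproduct K J (\<lambda>i. sh K (A i)) (sh K X) (\<lambda>i. shm K (\<iota> i))"
proof (rule coproductI)
  note D = coproductD[OF X]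
  show "sh K X \<in> Ob K" using D by simp
  show "sh K (A i) \<in> Ob K \<and> ar (shm K (\<iota> i)) \<and> dm (shm K (\<iota> i)) = sh K (A i) \<and> cd (shm K (\<iota> i)) = sh K X"
    if "i \<in> J" for i using D(2-5)[OF that] by simp
next
  note D = coproductD[OF X]
  fix Y g assume Y: "Y \<in> Ob K" and g: "\<And>i. i \<in> J \<Longrightarrow> ar (g i) \<and> dm (g i) = sh K (A i) \<and> cd (g i) = Y"
  obtain N u v where N: "N \<in> Ob K" and uv: "isop (sh K N) Y u v" using desuspend[OF Y] .
  note U = isopD[OF uv]
  have "\<exists>k. ar k \<and> dm k = A i \<and> cd k = N \<and> v \<cdot> g i = shm K k" if i: "i \<in> J" for i
  proof -
    obtain k where "ar k" "dm k = A i" "cd k = N" "v \<cdot> g i = shm K k"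
      by (rule shm_full[of "v \<cdot> g i" "A i" N]) ((use g[OF i] U N D(2)[OF i] in simp_all)[5], blast)
    then show ?thesis by blast
  qed
  then have "\<forall>i\<in>J. \<exists>k. ar k \<and> dm k = A i \<and> cd k = N \<and> v \<cdot> g i = shm K k" by blast
  from bchoice[OF this] obtain k
    where k: "\<And>i. i \<in> J \<Longrightarrow> ar (k i) \<and> dm (k i) = A i \<and> cd (k i) = N \<and> v \<cdot> g i = shm K (k i)" by blast
  obtain h where h: "ar h" "dm h = X" "cd h = N" "\<And>i. i \<in> J \<Longrightarrow> h \<cdot> \<iota> i = k i"
    by (rule coproduct_ex[OF X N, of k]) (use k in simp, blast)
  have "(u \<cdot> shm K h) \<cdot> shm K (\<iota> i) = g i" if i: "i \<in> J" for i
  proof -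
    have "(u \<cdot> shm K h) \<cdot> shm K (\<iota> i) = u \<cdot> shm K (h \<cdot> \<iota> i)" using h(1-3) U D(2-5)[OF i] by simp
    also have "\<dots> = u \<cdot> (v \<cdot> g i)" using h(4)[OF i] k[OF i] by simp
    also have "\<dots> = g i" using isop_cancel[OF uv] g[OF i] by simp
    finally show ?thesis .
  qed
  moreover have "ar (u \<cdot> shm K h)" "dm (u \<cdot> shm K h) = sh K X" "cd (u \<cdot> shm K h) = Y" using h(1-3) U by simp_all
  ultimately show "\<exists>h. ar h \<and> dm h = sh K X \<and> cd h = Y \<and> (\<forall>i\<in>J. h \<cdot> shm K (\<iota> i) = g i)"
    by (intro exI[of _ "u \<cdot> shm K h"] conjI ballI)
next
  note D = coproductD[OF X]
  fix h h' assume h: "ar h" "ar h'" "dm h = sh K X" "dm h' = sh K X" "cd h' = cd h"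
    "\<And>i. i \<in> J \<Longrightarrow> h \<cdot> shm K (\<iota> i) = h' \<cdot> shm K (\<iota> i)"
  have Y: "cd h \<in> Ob K" using h by simp
  obtain N u v where N: "N \<in> Ob K" and uv: "isop (sh K N) (cd h) u v" using desuspend[OF Y] .
  note U = isopD[OF uv]
  obtain k where k: "ar k" "dm k = X" "cd k = N" "v \<cdot> h = shm K k"
    by (rule shm_full[of "v \<cdot> h" X N]) ((use h U N D(1) in simp_all)[5], blast)
  obtain k' where k': "ar k'" "dm k' = X" "cd k' = N" "v \<cdot> h' = shm K k'"
    by (rule shm_full[of "v \<cdot> h'" X N]) ((use h U N D(1) in simp_all)[5], blast)
  have "k = k'"
  proof (rule coproduct_eqI[OF X k(1) k'(1) k(2) k'(2)])
    show "cd k = cd k'" using k(3) k'(3) by simp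
    fix i assume i: "i \<in> J"
    have "shm K (k \<cdot> \<iota> i) = (v \<cdot> h) \<cdot> shm K (\<iota> i)" unfolding k(4) using k(1-3) D(2-5)[OF i] by simp
    also have "\<dots> = v \<cdot> (h \<cdot> shm K (\<iota> i))" using h(1-5) U D(2-5)[OF i] by simp
    also have "\<dots> = v \<cdot> (h' \<cdot> shm K (\<iota> i))" using h(6)[OF i] by simp
    also have "\<dots> = (v \<cdot> h') \<cdot> shm K (\<iota> i)" using h(1-5) U D(2-5)[OF i] by simp
    also have "\<dots> = shm K (k' \<cdot> \<iota> i)" unfolding k'(4) using k'(1-3) D(2-5)[OF i] by simp
    finally show "k \<cdot> \<iota> i = k' \<cdot> \<iota> i"
      by (rule shm_inj[rotated -1]) (use k(1-3) k'(1-3) D(2-5)[OF i] in simp_all)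
  qed
  then have "u \<cdot> (v \<cdot> h) = u \<cdot> (v \<cdot> h')" using k(4) k'(4) by simp
  then show "h = h'" unfolding isop_cancel(2)[OF uv h(1) refl] isop_cancel(2)[OF uv h(2,5)] .
qed

text \<open>The shift reaches the objects only up to isomorphism, so the identifications
  \<open>\<beta> i\<close> and \<open>y\<close> have to be kept, along with their compatibility with
  the injections.\<close>

lemma coproduct_desuspend:
  assumes X: "coproduct K J A X \<iota>"
  obtains B Y \<beta> \<beta>' y y' j where "coproduct K J B Y j" "isop (sh K Y) X y y'"
    "\<And>i. i \<in> J \<Longrightarrow> isop (sh K (B i)) (A i) (\<beta> i) (\<beta>' i)"
    "\<And>i. i \<in> J \<Longrightarrow> y \<cdot> shm K (j i) = \<iota> i \<cdot> \<beta> i"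
proof -
  note D = coproductD[OF X]
  obtain Y y y' where Y: "Y \<in> Ob K" and y: "isop (sh K Y) X y y'" using desuspend[OF D(1)] .
  note U = isopD[OF y]
  have "\<exists>B b b'. B \<in> Ob K \<and> isop (sh K B) (A i) b b'" if "i \<in> J" for i
    using desuspend[OF D(2)[OF that]] by blast
  then obtain B \<beta> \<beta>' where B: "\<And>i. i \<in> J \<Longrightarrow> B i \<in> Ob K \<and> isop (sh K (B i)) (A i) (\<beta> i) (\<beta>' i)"
    by metis
  have b: "isop (sh K (B i)) (A i) (\<beta> i) (\<beta>' i)" "B i \<in> Ob K" if "i \<in> J" for i
    using B[OF that] by auto
  have "\<exists>k. ar k \<and> dm k = B i \<and> cd k = Y \<and> y' \<cdot> (\<iota> i \<cdot> \<beta> i) = shm K k" if i: "i \<in> J" for i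
  proof -
    obtain k where "ar k" "dm k = B i" "cd k = Y" "y' \<cdot> (\<iota> i \<cdot> \<beta> i) = shm K k"
      by (rule shm_full[of "y' \<cdot> (\<iota> i \<cdot> \<beta> i)" "B i" Y]) ((use b(2)[OF i] isopD[OF b(1)[OF i]] U Y D(2-5)[OF i] in simp_all)[5], blast)
    then show ?thesis by blast
  qed
  then have "\<forall>i\<in>J. \<exists>k. ar k \<and> dm k = B i \<and> cd k = Y \<and> y' \<cdot> (\<iota> i \<cdot> \<beta> i) = shm K k" by blast
  from bchoice[OF this] obtain j
    where j: "\<And>i. i \<in> J \<Longrightarrow> ar (j i) \<and> dm (j i) = B i \<and> cd (j i) = Y \<and> y' \<cdot> (\<iota> i \<cdot> \<beta> i) = shm K (j i)" by blast
  have yj: "y \<cdot> shm K (j i) = \<iota> i \<cdot> \<beta> i" if i: "i \<in> J" for i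
  proof -
    have "y \<cdot> shm K (j i) = y \<cdot> (y' \<cdot> (\<iota> i \<cdot> \<beta> i))" using j[OF i] by simp
    also have "\<dots> = \<iota> i \<cdot> \<beta> i" using isop_cancel(2)[OF y] isopD[OF b(1)[OF i]] D(3-5)[OF i] by simp
    finally show ?thesis .
  qed
  have "coproduct K J B Y j"
  proof (rule coproductI)
    show "Y \<in> Ob K" by (rule Y)
    show "B i \<in> Ob K \<and> ar (j i) \<and> dm (j i) = B i \<and> cd (j i) = Y" if "i \<in> J" for i
      using j[OF that] b(2)[OF that] by simp
  next
    fix N g assume N: "N \<in> Ob K" and g: "\<And>i. i \<in> J \<Longrightarrow> ar (g i) \<and> dm (g i) = B i \<and> cd (g i) = N"
    have sN: "sh K N \<in> Ob K" using N by simp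
    obtain h where h: "ar h" "dm h = X" "cd h = sh K N" "\<And>i. i \<in> J \<Longrightarrow> h \<cdot> \<iota> i = shm K (g i) \<cdot> \<beta>' i"
      by (rule coproduct_ex[OF X sN, of "\<lambda>i. shm K (g i) \<cdot> \<beta>' i"])
        (use g isopD[OF b(1)] in simp, blast)
    obtain k where k: "ar k" "dm k = Y" "cd k = N" "h \<cdot> y = shm K k"
      by (rule shm_full[of "h \<cdot> y" Y N]) ((use h(1-3) U N Y in simp_all)[5], blast)
    have "k \<cdot> j i = g i" if i: "i \<in> J" for i
    proof -
      note E = isopD[OF b(1)[OF i]]
      have "shm K (k \<cdot> j i) = (h \<cdot> y) \<cdot> shm K (j i)" unfolding k(4) using k(1-3) j[OF i] by simp
      also have "\<dots> = h \<cdot> (y \<cdot> shm K (j i))" using h(1-3) U j[OF i] by simp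
      also have "\<dots> = (h \<cdot> \<iota> i) \<cdot> \<beta> i" unfolding yj[OF i] using h(1-3) D(2-5)[OF i] E by simp
      also have "\<dots> = shm K (g i)" unfolding h(4)[OF i] using g[OF i] E by simp
      finally show ?thesis
        by (rule shm_inj[rotated -1]) (use k(1-3) j[OF i] g[OF i] in simp_all)
    qed
    then show "\<exists>h. ar h \<and> dm h = Y \<and> cd h = N \<and> (\<forall>i\<in>J. h \<cdot> j i = g i)"
      by (intro exI[of _ k] conjI ballI k(1-3))
  next
    fix h h' assume h: "ar h" "ar h'" "dm h = Y" "dm h' = Y" "cd h' = cd h"
      "\<And>i. i \<in> J \<Longrightarrow> h \<cdot> j i = h' \<cdot> j i"
    have "shm K h \<cdot> y' = shm K h' \<cdot> y'"
    proof (rule coproduct_eqI[OF X])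
      fix i assume i: "i \<in> J"
      note E = isopD[OF b(1)[OF i]]
      have *: "(shm K l \<cdot> y') \<cdot> \<iota> i = shm K (l \<cdot> j i) \<cdot> \<beta>' i" if l: "ar l" "dm l = Y" for l
      proof -
        have "shm K (l \<cdot> j i) \<cdot> \<beta>' i = (shm K l \<cdot> (y' \<cdot> (\<iota> i \<cdot> \<beta> i))) \<cdot> \<beta>' i" using l j[OF i] by simp
        also have "\<dots> = (shm K l \<cdot> y') \<cdot> (\<iota> i \<cdot> (\<beta> i \<cdot> \<beta>' i))" using l U D(2-5)[OF i] E(1-6) by simp
        also have "\<dots> = (shm K l \<cdot> y') \<cdot> \<iota> i" using D(3-5)[OF i] E(8) by simp
        finally show ?thesis ..
      qed
      show "(shm K h \<cdot> y') \<cdot> \<iota> i = (shm K h' \<cdot> y') \<cdot> \<iota> i"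
        unfolding *[OF h(1,3)] *[OF h(2,4)] h(6)[OF i] ..
    qed (use h(1-5) U in simp_all)
    then have "(shm K h \<cdot> y') \<cdot> y = (shm K h' \<cdot> y') \<cdot> y" by simp
    then have "shm K h = shm K h'" using h(1-5) U by simp
    then show "h = h'" by (rule shm_inj[rotated -1]) (use h(1-5) in simp_all)
  qed
  then show thesis using that y b(1) yj by blast
qed

text \<open>The target coproduct is desuspended, the corresponding morphism out of \<open>C\<close>
  is decomposed there, and the finite sum is suspended term by term.\<close>

lemma cpt_sh:
  fixes \<kappa> :: "'i rel"
  assumes "C \<in> cpt \<kappa> K"
  shows "sh K C \<in> cpt \<kappa> K"
proof (rule cptI)
  have C: "C \<in> Ob K" using assms cpt_Ob by blast
  then show "sh K C \<in> Ob K" by simp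
  fix J :: "'i set" and A X \<iota> f
  assume J: "small \<kappa> J" and X: "coproduct K J A X \<iota>" and f: "ar f" "dm f = sh K C" "cd f = X"
  note D = coproductD[OF X]
  obtain B Y \<beta> \<beta>' y y' j where Y: "coproduct K J B Y j" and y: "isop (sh K Y) X y y'"
    and b: "\<And>i. i \<in> J \<Longrightarrow> isop (sh K (B i)) (A i) (\<beta> i) (\<beta>' i)"
    and yj: "\<And>i. i \<in> J \<Longrightarrow> y \<cdot> shm K (j i) = \<iota> i \<cdot> \<beta> i"
    by (rule coproduct_desuspend[OF X]) blast
  note E = coproductD[OF Y] and U = isopD[OF y]
  obtain k where k: "ar k" "dm k = C" "cd k = Y" "y' \<cdot> f = shm K k"
    by (rule shm_full[of "y' \<cdot> f" C Y]) ((use f U C E(1) in simp_all)[5], blast)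
  have "fsum J \<iota> (sh K C) X (y \<cdot> shm K k)" if "fsum J j C Y k" for k
    using that
  proof induction
    case fsum_zr
    then show ?case using fsum.fsum_zr C E(1) U by simp
  next
    case (fsum_add k i g)
    note G = E(2-5)[OF fsum_add(2)] and L = fsum_arr[OF fsum_add(1) C Y] and M = isopD[OF b[OF fsum_add(2)]]
    have "y \<cdot> shm K (k \<^bold>+ j i \<cdot> g) = y \<cdot> shm K k \<^bold>+ (y \<cdot> shm K (j i)) \<cdot> shm K g"
      using fsum_add(3-5) G L U E by simp
    also have "\<dots> = y \<cdot> shm K k \<^bold>+ \<iota> i \<cdot> (\<beta> i \<cdot> shm K g)"
      unfolding yj[OF fsum_add(2)] using fsum_add(3-5) G M D(2-5)[OF fsum_add(2)] by simp
    finally show ?case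
      using fsum.fsum_add[OF fsum_add(6,2), of "\<beta> i \<cdot> shm K g"] fsum_add(3-5) G M D(2-5)[OF fsum_add(2)] by simp
  qed
  from this[OF cpt_fsum_index[OF assms J Y k(1-3)]]
  show "fsum J \<iota> (sh K C) X f" unfolding k(4)[symmetric] isop_cancel(2)[OF y f(1,3)] .
qed

text \<open>Here the given coproduct is suspended instead, and fullness desuspends the coordinates
  of the decomposition.\<close>

lemma cpt_desuspend:
  fixes \<kappa> :: "'i rel"
  assumes "sh K C \<in> cpt \<kappa> K" and C: "C \<in> Ob K"
  shows "C \<in> cpt \<kappa> K"
proof (rule cptI[OF C])
  fix J :: "'i set" and A X \<iota> f
  assume J: "small \<kappa> J" and X: "coproduct K J A X \<iota>" and f: "ar f" "dm f = C" "cd f = X"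
  note D = coproductD[OF X]
  have *: "\<exists>f. fsum J \<iota> C X f \<and> k = shm K f" if "fsum J (\<lambda>i. shm K (\<iota> i)) (sh K C) (sh K X) k" for k
    using that
  proof induction
    case fsum_zr
    then show ?case using fsum.fsum_zr[of J \<iota> C X] C D(1) by (intro exI[of _ "zr C X"]) simp
  next
    case (fsum_add k i g)
    obtain f where f: "fsum J \<iota> C X f" "k = shm K f" using fsum_add by blast
    note L = fsum_arr[OF f(1) C X] and G = D(2-5)[OF fsum_add(2)]
    obtain g' where g': "ar g'" "dm g' = C" "cd g' = A i" "g = shm K g'"
      by (rule shm_full[of g C "A i"]) ((use fsum_add(3-5) G C in simp_all)[5], blast)
    have "fsum J \<iota> C X (f \<^bold>+ \<iota> i \<cdot> g')"
      by (rule fsum.fsum_add[OF f(1) fsum_add(2)]) (use g' G in simp_all)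
    moreover have "shm K (f \<^bold>+ \<iota> i \<cdot> g') = k \<^bold>+ shm K (\<iota> i) \<cdot> g"
      unfolding f(2) g'(4) using L G g'(1-3) by simp
    ultimately show ?case by force
  qed
  have "fsum J (\<lambda>i. shm K (\<iota> i)) (sh K C) (sh K X) (shm K f)"
    by (rule cpt_fsum_index[OF assms(1) J coproduct_sh[OF X]]) (use f in simp_all)
  from *[OF this] obtain f' where f': "fsum J \<iota> C X f'" "shm K f = shm K f'" by blast
  have "f = f'" by (rule shm_inj[OF _ _ _ _ f'(2)]) (use f fsum_arr[OF f'(1) C X] in simp_all)
  then show "fsum J \<iota> C X f" using f' by simp
qed

section \<open>Orthogonality\<close>

text \<open>The vanishing condition of a Rickard triangle, phrased by \<open>dm\<close> and
  \<open>cd\<close> so that it can be applied to morphisms without carriers.\<close>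

definition orth :: "'o \<Rightarrow> 'o \<Rightarrow> bool" where
  "orth B M \<longleftrightarrow> (\<forall>f. ar f \<and> dm f = B \<and> cd f = M \<longrightarrow> f = zr B M)"

lemma orthD: "\<lbrakk>orth B M; ar f; dm f = B; cd f = M\<rbrakk> \<Longrightarrow> f = zr B M"
  unfolding orth_def by blast

lemma orth_iff: "\<lbrakk>B \<in> Ob K; M \<in> Ob K\<rbrakk> \<Longrightarrow> orth B M \<longleftrightarrow> Hom K B M = {zr B M}"
  unfolding orth_def by (auto simp del: Hom_iff simp flip: Hom_iff) auto

lemma orth_isop_left:
  assumes "orth B M" "isop B B' u v" "M \<in> Ob K"
  shows "orth B' M"
  unfolding orth_def
proof (intro allI impI)
  fix f assume f: "ar f \<and> dm f = B' \<and> cd f = M"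
  note U = isopD[OF assms(2)]
  have "f \<cdot> u = zr B M" by (rule orthD[OF assms(1)]) (use f U in simp_all)
  then have "(f \<cdot> u) \<cdot> v = zr B' M" using U assms(3) by simp
  then show "f = zr B' M" using f U by simp
qed

lemma orth_isop_right:
  assumes "orth B M" "isop M M' u v" "B \<in> Ob K"
  shows "orth B M'"
  unfolding orth_def
proof (intro allI impI)
  fix f assume f: "ar f \<and> dm f = B \<and> cd f = M'"
  note U = isopD[OF assms(2)]
  have "v \<cdot> f = zr B M" by (rule orthD[OF assms(1)]) (use f U in simp_all)
  then have "u \<cdot> (v \<cdot> f) = zr B M'" using U assms(3) by simp
  then show "f = zr B M'" using f isop_cancel(2)[OF assms(2)] by simp
qed

lemma orth_sh:
  assumes "B \<in> Ob K" "M \<in> Ob K"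
  shows "orth (sh K B) (sh K M) \<longleftrightarrow> orth B M"
proof
  assume o: "orth (sh K B) (sh K M)"
  show "orth B M"
    unfolding orth_def
  proof (intro allI impI)
    fix f assume f: "ar f \<and> dm f = B \<and> cd f = M"
    have "shm K f = zr (sh K B) (sh K M)" by (rule orthD[OF o]) (use f in simp_all)
    then have "shm K f = shm K (zr B M)" using assms by simp
    then show "f = zr B M" by (rule shm_inj[rotated -1]) (use f assms in simp_all)
  qed
next
  assume o: "orth B M"
  show "orth (sh K B) (sh K M)"
    unfolding orth_def
  proof (intro allI impI)
    fix f assume f: "ar f \<and> dm f = sh K B \<and> cd f = sh K M"
    obtain k where k: "ar k" "dm k = B" "cd k = M" "f = shm K k"
      by (rule shm_full[of f B M]) ((use f assms in simp_all)[5], blast)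
    have "k = zr B M" by (rule orthD[OF o k(1-3)])
    then show "f = zr (sh K B) (sh K M)" unfolding k(4) using assms by simp
  qed
qed

text \<open>Stability under the shift in both directions; the inverse shift exists only up to
  isomorphism, hence the last clause.\<close>

definition sh_closed :: "'o set \<Rightarrow> bool" where
  "sh_closed S \<longleftrightarrow> S \<subseteq> Ob K \<and> (\<forall>C\<in>S. sh K C \<in> S) \<and> (\<forall>C\<in>S. \<exists>C'\<in>S. \<exists>f g. isop (sh K C') C f g)"

text \<open>The objects orthogonal to the whole right orthogonal of \<open>S\<close> form a localizing subcategory.\<close>

lemma Loc_orth:
  fixes \<kappa> :: "'i rel"
  assumes S: "sh_closed S" and M: "M \<in> Ob K" "\<And>C. C \<in> S \<Longrightarrow> orth C M" and B: "B \<in> Loc \<kappa> K S"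
  shows "orth B M"
proof -
  \<comment> \<open>A single \<open>M\<close> would not do, because the objects orthogonal to
    \<open>M\<close> alone need not be stable under shifts. The whole right orthogonal
    \<open>R\<close> of \<open>S\<close> inherits shift stability from \<open>S\<close>.\<close>
  define R where "R = {N \<in> Ob K. \<forall>C\<in>S. orth C N}"
  have SO: "S \<subseteq> Ob K" using S unfolding sh_closed_def by blast
  have R_sh: "sh K N \<in> R" if "N \<in> R" for N
  proof -
    have N: "N \<in> Ob K" using that unfolding R_def by blast
    have "orth C (sh K N)" if C: "C \<in> S" for C
    proof -
      obtain C' f g where C': "C' \<in> S" "isop (sh K C') C f g" using S C unfolding sh_closed_def by blast
      have "orth C' N" using \<open>N \<in> R\<close> C' unfolding R_def by blast
      then have "orth (sh K C') (sh K N)" using orth_sh N C' SO by blast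
      then show ?thesis by (rule orth_isop_left[OF _ C'(2)]) (use N in simp)
    qed
    then show ?thesis using N unfolding R_def by simp
  qed
  have R_de: "\<exists>N'\<in>R. \<exists>u v. isop (sh K N') N u v" if NR: "N \<in> R" for N
  proof -
    have N: "N \<in> Ob K" using that unfolding R_def by blast
    obtain N' u v where N': "N' \<in> Ob K" "isop (sh K N') N u v" using desuspend[OF N] .
    have "orth C N'" if C: "C \<in> S" for C
    proof -
      have sC: "sh K C \<in> S" "C \<in> Ob K" using S C unfolding sh_closed_def by blast+
      then have "orth (sh K C) N" using NR unfolding R_def by blast
      then have "orth (sh K C) (sh K N')" by (rule orth_isop_right[OF _ isop_sym[OF N'(2)]]) (use sC in simp)
      then show ?thesis using orth_sh[OF sC(2) N'(1)] by blast
    qed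
    then have "N' \<in> R" using N' unfolding R_def by blast
    then show ?thesis using N' by blast
  qed
  have RO: "R \<subseteq> Ob K" unfolding R_def by blast
  let ?T = "{X \<in> Ob K. \<forall>N\<in>R. orth X N}"
  have T_sh: "sh K X \<in> ?T" if X: "X \<in> ?T" for X
  proof -
    have "orth (sh K X) N" if N: "N \<in> R" for N
    proof -
      obtain N' u v where N': "N' \<in> R" "isop (sh K N') N u v" using R_de[OF N] by blast
      have "orth (sh K X) (sh K N')" using orth_sh N' X RO by blast
      then show ?thesis by (rule orth_isop_right[OF _ N'(2)]) (use X in simp)
    qed
    then show ?thesis using X by simp
  qed
  have "localizing \<kappa> K ?T"
  proof (rule localizingI)
    show "?T \<subseteq> Ob K" by blast
    show "Z \<in> ?T" if Z: "zero_object K Z" for Z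
      using from_zero[OF Z] Z unfolding orth_def by auto
    show "Y \<in> ?T" if "X \<in> ?T" "isop X Y f g" for X Y f g
      using orth_isop_left[OF _ that(2)] that(1) isopD(10)[OF that(2)] RO by blast
    show "sh K X \<in> ?T" if "X \<in> ?T" for X by (rule T_sh[OF that])
    show "X \<in> ?T" if X: "X \<in> Ob K" "sh K X \<in> ?T" for X
    proof -
      have "orth X N" if N: "N \<in> R" for N
      proof -
        have "orth (sh K X) (sh K N)" using R_sh[OF N] X by blast
        then show ?thesis using orth_sh X N RO by blast
      qed
      then show ?thesis using X by simp
    qed
    show "Z \<in> ?T" if T: "dist K X Y Z f g h" "X \<in> ?T" "Y \<in> ?T" for X Y Z f g h
    proof -
      note D = distD[OF T(1)]
      have "orth Z N" if N: "N \<in> R" for N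
        unfolding orth_def
      proof (intro allI impI)
        fix k assume k: "ar k \<and> dm k = Z \<and> cd k = N"
        have NO: "N \<in> Ob K" using N RO by blast
        have oY: "orth Y N" using T(3) N by blast
        have "k \<cdot> g = zr Y N" by (rule orthD[OF oY]) (use k D in simp_all)
        then have "k \<cdot> g = zr Y (cd k)" using k by simp
        then obtain l where l: "ar l" "dm l = sh K X" "cd l = cd k" "k = l \<cdot> h"
          by (rule weak_coker[OF rotate[OF T(1)], rotated -2]) (use k in blast)+
        have "sh K X \<in> ?T" by (rule T_sh[OF T(2)])
        then have oX: "orth (sh K X) N" using N by blast
        have "l = zr (sh K X) N" by (rule orthD[OF oX]) (use k l in simp_all)
        then show "k = zr Z N" unfolding l(4) using D NO by simp
      qed
      then show ?thesis using D by simp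
    qed
    show "X \<in> ?T \<and> Y \<in> ?T" if b: "biproduct K X Y W i j p q" "W \<in> ?T" for X Y W i j p q
    proof -
      note D = biproductD[OF b(1)]
      have *: "orth U N" if N: "N \<in> R" and r: "ar r" "dm r = U" "cd r = W" "ar s" "dm s = W" "cd s = U" "s \<cdot> r = ident K U" for U r s N
        unfolding orth_def
      proof (intro allI impI)
        fix f assume f: "ar f \<and> dm f = U \<and> cd f = N"
        have oW: "orth W N" using b(2) N by blast
        have "f \<cdot> s = zr W N" by (rule orthD[OF oW]) (use f r in simp_all)
        then have "(f \<cdot> s) \<cdot> r = zr U N" using r N RO by auto
        then show "f = zr U N" using f r by simp
      qed
      show ?thesis using *[OF _ D(4-6) D(10-12) D(16)] *[OF _ D(7-9) D(13-15) D(17)] D(1,2) by blast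
    qed
    show "X \<in> ?T" if X: "small \<kappa> I" "coproduct K I A X \<iota>" "\<And>i. i \<in> I \<Longrightarrow> A i \<in> ?T" for I :: "'i set" and A X \<iota>
    proof -
      note D = coproductD[OF X(2)]
      have "orth X N" if N: "N \<in> R" for N
        unfolding orth_def
      proof (intro allI impI)
        fix f assume f: "ar f \<and> dm f = X \<and> cd f = N"
        have NO: "N \<in> Ob K" using N RO by blast
        show "f = zr X N"
        proof (rule coproduct_eqI[OF X(2)])
          fix i assume i: "i \<in> I"
          have oA: "orth (A i) N" using X(3)[OF i] N by blast
          have "f \<cdot> \<iota> i = zr (A i) N" by (rule orthD[OF oA]) (use f D(2-5)[OF i] in simp_all)
          then show "f \<cdot> \<iota> i = zr X N \<cdot> \<iota> i" using D(2-5)[OF i] NO by simp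
        qed (use f D(1) NO in simp_all)
      qed
      then show ?thesis using D(1) by simp
    qed
  qed
  moreover have "S \<subseteq> ?T" using SO unfolding R_def by blast
  ultimately have "B \<in> ?T" using Loc_least B by blast
  moreover have "M \<in> R" using M unfolding R_def by blast
  ultimately show ?thesis by blast
qed

section \<open>Exact functors\<close>

lemma additive_functorD:
  assumes "additive_functor K F Fm"
  shows "\<And>A. A \<in> Ob K \<Longrightarrow> F A \<in> Ob K" "\<And>A. A \<in> Ob K \<Longrightarrow> Fm (ident K A) = ident K (F A)"
    "\<And>f. ar f \<Longrightarrow> ar (Fm f)" "\<And>f. ar f \<Longrightarrow> dm (Fm f) = F (dm f)" "\<And>f. ar f \<Longrightarrow> cd (Fm f) = F (cd f)"
    "\<And>f g. \<lbrakk>ar f; ar g; dm g = cd f\<rbrakk> \<Longrightarrow> Fm (g \<cdot> f) = Fm g \<cdot> Fm f"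
    "\<And>f g. \<lbrakk>ar f; ar g; dm g = dm f; cd g = cd f\<rbrakk> \<Longrightarrow> Fm (f \<^bold>+ g) = Fm f \<^bold>+ Fm g"
    "\<And>A B. \<lbrakk>A \<in> Ob K; B \<in> Ob K\<rbrakk> \<Longrightarrow> Fm (zr A B) = zr (F A) (F B)"
proof -
  show F: "\<And>A. A \<in> Ob K \<Longrightarrow> F A \<in> Ob K" "\<And>A. A \<in> Ob K \<Longrightarrow> Fm (ident K A) = ident K (F A)"
    using assms unfolding additive_functor_def by simp_all
  have hom: "\<And>A B. \<lbrakk>A \<in> Ob K; B \<in> Ob K\<rbrakk> \<Longrightarrow> Fm \<in> hom (HomG K A B) (HomG K (F A) (F B))"
    using assms unfolding additive_functor_def by simp
  show t: "\<And>f. ar f \<Longrightarrow> ar (Fm f)" "\<And>f. ar f \<Longrightarrow> dm (Fm f) = F (dm f)" "\<And>f. ar f \<Longrightarrow> cd (Fm f) = F (cd f)"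
    using hom_in_carrier[OF hom ar_Hom] F(1) by auto
  show "Fm (f \<^bold>+ g) = Fm f \<^bold>+ Fm g" if "ar f" "ar g" "dm g = dm f" "cd g = cd f" for f g
    using hom_mult[OF hom[of "dm f" "cd f"], of f g] that t by (simp add: pl_def)
  show "\<And>A B. \<lbrakk>A \<in> Ob K; B \<in> Ob K\<rbrakk> \<Longrightarrow> Fm (zr A B) = zr (F A) (F B)"
    using hom_one[OF hom group_Hom group_Hom] F(1) by simp
  show "Fm (g \<cdot> f) = Fm g \<cdot> Fm f" if f: "ar f" "ar g" "dm g = cd f" for f g
  proof -
    have "\<forall>A\<in>Ob K. \<forall>B\<in>Ob K. \<forall>C\<in>Ob K. \<forall>f\<in>Hom K A B. \<forall>g\<in>Hom K B C. Fm (g \<cdot> f) = Fm g \<cdot> Fm f"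
      using assms unfolding additive_functor_def by (elim conjE)
    moreover have "g \<in> Hom K (cd f) (cd g)" using f by simp
    ultimately show ?thesis using ar_Hom[OF f(1)] dm_Ob[OF f(1)] cd_Ob[OF f(1)] cd_Ob[OF f(2)] by blast
  qed
qed

lemma additive_functor_isop:
  assumes "additive_functor K F Fm" "isop A B f g"
  shows "isop (F A) (F B) (Fm f) (Fm g)"
  using isopD[OF assms(2)] additive_functorD[OF assms(1)] unfolding isop_def by (simp flip: additive_functorD(6)[OF assms(1)])

lemma additive_functor_zero:
  assumes "additive_functor K F Fm" "zero_object K Z"
  shows "zero_object K (F Z)"
proof -
  note F = additive_functorD[OF assms(1)]
  have Z: "Z \<in> Ob K" using assms(2) by simp
  have "ident K Z = zr Z Z" by (rule to_zero[OF assms(2)]) (use Z in auto)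
  then have "Fm (ident K Z) = Fm (zr Z Z)" by simp
  then show ?thesis using Z F by (intro zero_objectI) auto
qed

lemma additive_functor_biproduct:
  assumes "additive_functor K F Fm" "biproduct K A B X i j p q"
  shows "biproduct K (F A) (F B) (F X) (Fm i) (Fm j) (Fm p) (Fm q)"
proof -
  note F = additive_functorD[OF assms(1)] and D = biproductD[OF assms(2)]
  show ?thesis
  proof (rule biproductI)
    show "Fm p \<cdot> Fm i = ident K (F A)" using F(6)[of i p] F(2) D by simp
    show "Fm q \<cdot> Fm j = ident K (F B)" using F(6)[of j q] F(2) D by simp
    show "Fm p \<cdot> Fm j = zr (F B) (F A)" using F(6)[of j p] F(8) D by simp
    show "Fm q \<cdot> Fm i = zr (F A) (F B)" using F(6)[of i q] F(8) D by simp
    have "Fm (i \<cdot> p \<^bold>+ j \<cdot> q) = Fm i \<cdot> Fm p \<^bold>+ Fm j \<cdot> Fm q"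
      using F(6)[of p i] F(6)[of q j] F(7)[of "i \<cdot> p" "j \<cdot> q"] D(1-15) by simp
    then show "Fm i \<cdot> Fm p \<^bold>+ Fm j \<cdot> Fm q = ident K (F X)" unfolding D(20) using F(2)[OF D(3)] by simp
  qed (use F(3-5) D(1-15) in simp_all)
qed

lemma exact_functorE:
  assumes "exact_functor K F Fm"
  obtains \<phi> \<psi> where "additive_functor K F Fm"
    "\<And>A. A \<in> Ob K \<Longrightarrow> isop (F (sh K A)) (sh K (F A)) (\<phi> A) (\<psi> A)"
    "\<And>A B C f g h. dist K A B C f g h \<Longrightarrow> dist K (F A) (F B) (F C) (Fm f) (Fm g) (\<phi> A \<cdot> Fm h)"
proof -
  have a: "additive_functor K F Fm" using assms unfolding exact_functor_def by (rule conjunct1)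
  obtain \<phi> where p': "\<forall>A\<in>Ob K. iso_arrow K (F (sh K A)) (sh K (F A)) (\<phi> A)"
    "\<forall>A B C f g h. dist K A B C f g h \<longrightarrow> dist K (F A) (F B) (F C) (Fm f) (Fm g) (\<phi> A \<cdot> Fm h)"
    using assms unfolding exact_functor_def by (elim conjE exE) (rule that)
  then have p: "\<And>A. A \<in> Ob K \<Longrightarrow> iso_arrow K (F (sh K A)) (sh K (F A)) (\<phi> A)"
    "\<And>A B C f g h. dist K A B C f g h \<Longrightarrow> dist K (F A) (F B) (F C) (Fm f) (Fm g) (\<phi> A \<cdot> Fm h)"
    by (simp, metis)
  have "isop (F (sh K A)) (sh K (F A)) (\<phi> A) (inv_arrow K (F (sh K A)) (sh K (F A)) (\<phi> A))" if "A \<in> Ob K" for A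
    by (rule iso_arrow_inv[OF _ _ p(1)[OF that]]) (use additive_functorD(1)[OF a] that in simp_all)
  from that[OF a this p(2)] show thesis .
qed

text \<open>Pulling a localizing subcategory back along an exact functor that preserves coproducts
  reduces a claim about all objects of \<open>Loc\<close> to one about its generators.\<close>

lemma localizing_preimage:
  fixes \<kappa> :: "'i rel"
  assumes "exact_functor K F Fm" and S: "localizing \<kappa> K S"
    and cop: "\<And>(I::'i set) A X \<iota>. \<lbrakk>small \<kappa> I; coproduct K I A X \<iota>\<rbrakk> \<Longrightarrow>
      coproduct K I (\<lambda>i. F (A i)) (F X) (\<lambda>i. Fm (\<iota> i))"
  shows "localizing \<kappa> K {X \<in> Ob K. F X \<in> S}"
proof -
  obtain \<phi> \<psi> where F: "additive_functor K F Fm"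
    and phi: "\<And>A. A \<in> Ob K \<Longrightarrow> isop (F (sh K A)) (sh K (F A)) (\<phi> A) (\<psi> A)"
    and ex: "\<And>A B C f g h. dist K A B C f g h \<Longrightarrow> dist K (F A) (F B) (F C) (Fm f) (Fm g) (\<phi> A \<cdot> Fm h)"
    by (rule exact_functorE[OF assms(1)]) blast
  note T = triangulated_subD[OF localizing_sub[OF S]] and FO = additive_functorD(1)[OF F]
  have sh: "F (sh K X) \<in> S \<longleftrightarrow> F X \<in> S" if X: "X \<in> Ob K" for X
    using T(2)[OF _ phi[OF X]] T(2)[OF _ isop_sym[OF phi[OF X]]] T(3)[OF FO[OF X]] by blast
  show ?thesis
  proof (rule localizingI)
    show "Z \<in> {X \<in> Ob K. F X \<in> S}" if "zero_object K Z" for Z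
      using triangulated_sub_zero[OF localizing_sub[OF S] additive_functor_zero[OF F that]] that by simp
    show "B \<in> {X \<in> Ob K. F X \<in> S}" if "A \<in> {X \<in> Ob K. F X \<in> S}" "isop A B f g" for A B f g
      using T(2)[OF _ additive_functor_isop[OF F that(2)]] that(1) isopD(10)[OF that(2)] by simp
    show "sh K A \<in> {X \<in> Ob K. F X \<in> S}" if "A \<in> {X \<in> Ob K. F X \<in> S}" for A
      using that sh by simp
    show "A \<in> {X \<in> Ob K. F X \<in> S}" if "A \<in> Ob K" "sh K A \<in> {X \<in> Ob K. F X \<in> S}" for A
      using that sh by simp
    show "C \<in> {X \<in> Ob K. F X \<in> S}" if "dist K A B C f g h" "A \<in> {X \<in> Ob K. F X \<in> S}" "B \<in> {X \<in> Ob K. F X \<in> S}"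
      for A B C f g h
      using T(4)[OF ex[OF that(1)]] that(2,3) distD(3)[OF that(1)] by simp
    show "A \<in> {X \<in> Ob K. F X \<in> S} \<and> B \<in> {X \<in> Ob K. F X \<in> S}" if "biproduct K A B X i j p q" "X \<in> {X \<in> Ob K. F X \<in> S}"
      for A B X i j p q
      using localizing_biproduct[OF S additive_functor_biproduct[OF F that(1)]] that(2) biproductD(1,2)[OF that(1)] by simp
    show "X \<in> {X \<in> Ob K. F X \<in> S}" if "small \<kappa> I" "coproduct K I A X \<iota>" "\<And>i. i \<in> I \<Longrightarrow> A i \<in> {X \<in> Ob K. F X \<in> S}"
      for I :: "'i set" and A X \<iota>
      using localizing_coproduct_index[OF S that(1) cop[OF that(1,2)]] that(3) coproductD(1)[OF that(2)] by simp
  qed blast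
qed

section \<open>Sequential homotopy colimits\<close>

context
  fixes \<kappa> :: "'i rel" and G :: "nat \<Rightarrow> 'o" and t :: "nat \<Rightarrow> 'm" and U H :: 'o and \<iota> :: "nat \<Rightarrow> 'm" and s q h :: 'm
  assumes size: "size_bound \<kappa>"
    and t: "\<And>n. ar (t n)" "\<And>n. dm (t n) = G n" "\<And>n. cd (t n) = G (Suc n)"
    and U: "coproduct K UNIV G U \<iota>"
    and s: "\<And>n. s \<cdot> \<iota> n = \<iota> n \<^bold>+ \<^bold>- (\<iota> (Suc n) \<cdot> t n)"
    and H: "dist K U U H s q h"
begin

lemma hocolim_simps [simp]:
  "U \<in> Ob K" "G n \<in> Ob K" "ar (\<iota> n)" "dm (\<iota> n) = G n" "cd (\<iota> n) = U"
  "H \<in> Ob K" "ar s" "dm s = U" "cd s = U" "ar q" "dm q = U" "cd q = H" "ar h" "dm h = H" "cd h = sh K U"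
  "ar (t n)" "dm (t n) = G n" "cd (t n) = G (Suc n)"
  using coproductD[OF U] distD[OF H] t by auto

text \<open>\<open>s\<close> is the identity minus the shift \<open>T\<close> of the telescope, so
  \<open>s \<cdot> w = 0\<close> means \<open>w = T \<cdot> w\<close>. Let \<open>E k\<close> keep
  the first \<open>k\<close> summands. As \<open>T\<close> raises the index, induction gives
  \<open>E k \<cdot> w = 0\<close> for every \<open>k\<close>; yet by compactness \<open>w\<close>
  meets only finitely many summands, so some \<open>E N\<close> fixes it.\<close>

lemma telescope_mono:
  assumes C: "C \<in> cpt \<kappa> K" and w: "ar w" "dm w = C" "cd w = U" "s \<cdot> w = zr C U"
  shows "w = zr C U"
proof -
  have CO: "C \<in> Ob K" using C cpt_Ob by blast
  have UO: "U \<in> Ob K" by simp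
  obtain T where T: "ar T" "dm T = U" "cd T = U" "\<And>n. T \<cdot> \<iota> n = \<iota> (Suc n) \<cdot> t n"
    by (rule coproduct_ex[OF U UO, of "\<lambda>n. \<iota> (Suc n) \<cdot> t n"]) (simp, blast)
  have "\<exists>E. ar E \<and> dm E = U \<and> cd E = U \<and> (\<forall>n. E \<cdot> \<iota> n = (if n < k then \<iota> n else zr (G n) U))" for k :: nat
  proof -
    obtain E where "ar E" "dm E = U" "cd E = U" "\<And>n. n \<in> UNIV \<Longrightarrow> E \<cdot> \<iota> n = (if n < k then \<iota> n else zr (G n) U)"
      by (rule coproduct_ex[OF U UO, of "\<lambda>n. if n < k then \<iota> n else zr (G n) U"]) (simp, blast)
    then show ?thesis by (intro exI[of _ E]) simp
  qed
  then obtain E where E': "\<And>k. ar (E k) \<and> dm (E k) = U \<and> cd (E k) = U \<and>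
      (\<forall>n. E k \<cdot> \<iota> n = (if n < k then \<iota> n else zr (G n) U))"
    using choice[of "\<lambda>k E. ar E \<and> dm E = U \<and> cd E = U \<and> (\<forall>n. E \<cdot> \<iota> n = (if n < k then \<iota> n else zr (G n) U))"] by blast
  then have E: "ar (E k)" "dm (E k) = U" "cd (E k) = U"
    "E k \<cdot> \<iota> n = (if n < k then \<iota> n else zr (G n) U)" for k n by simp_all
  have sT: "s = ident K U \<^bold>+ \<^bold>- T"
    by (rule coproduct_eqI[OF U]) (use T s in simp_all)
  \<comment> \<open>\<open>T\<close> moves summand \<open>n\<close> to summand \<open>Suc n\<close>,
    whence the bound grows by one.\<close>
  have ET: "E (Suc k) \<cdot> T = T \<cdot> E k" for k
  proof (rule coproduct_eqI[OF U])
    fix n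
    have "(E (Suc k) \<cdot> T) \<cdot> \<iota> n = (E (Suc k) \<cdot> \<iota> (Suc n)) \<cdot> t n" using T E(1-3)[of "Suc k"] by simp
    also have "\<dots> = (T \<cdot> E k) \<cdot> \<iota> n" using E T by simp
    finally show "(E (Suc k) \<cdot> T) \<cdot> \<iota> n = (T \<cdot> E k) \<cdot> \<iota> n" .
  qed (use T E in simp_all)
  have "w \<^bold>+ \<^bold>- (T \<cdot> w) = zr C U" using w T unfolding sT by simp
  then have wT: "w = T \<cdot> w" using pl_ng_eq_zr_iff[of w "T \<cdot> w"] w T by simp
  have E0: "E 0 = zr U U" by (rule coproduct_eqI[OF U]) (use E in simp_all)
  have Ek: "E k \<cdot> w = zr C U" for k
  proof (induction k)
    case 0 then show ?case unfolding E0 using w by simp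
  next
    case (Suc k)
    have "E (Suc k) \<cdot> w = E (Suc k) \<cdot> (T \<cdot> w)" using wT by (rule arg_cong)
    also have "\<dots> = (E (Suc k) \<cdot> T) \<cdot> w" using w T E(1-3) by simp
    also have "\<dots> = T \<cdot> (E k \<cdot> w)" unfolding ET using w T E(1-3) by simp
    also have "\<dots> = zr C U" unfolding Suc using T CO by simp
    finally show ?case .
  qed
  have "fsum UNIV \<iota> C U w" by (rule cpt_fsum[OF size C small_nat[OF size] U w(1-3)])
  then have "\<exists>N. \<forall>M\<ge>N. E M \<cdot> w = w"
  proof induction
    case fsum_zr show ?case using E CO by simp
  next
    case (fsum_add f i g)
    obtain N where N: "\<And>M. M \<ge> N \<Longrightarrow> E M \<cdot> f = f" using fsum_add(6) by blast
    note f = fsum_arr[OF fsum_add(1) CO U]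
    have "E M \<cdot> (f \<^bold>+ \<iota> i \<cdot> g) = f \<^bold>+ \<iota> i \<cdot> g" if M: "M \<ge> max N (Suc i)" for M
    proof -
      have "E M \<cdot> (f \<^bold>+ \<iota> i \<cdot> g) = E M \<cdot> f \<^bold>+ (E M \<cdot> \<iota> i) \<cdot> g"
        using f fsum_add(3-5) E(1-3) by simp
      also have "\<dots> = f \<^bold>+ \<iota> i \<cdot> g" using N[of M] M E(4)[of M i] by simp
      finally show ?thesis .
    qed
    then show ?case by blast
  qed
  then obtain N where "E N \<cdot> w = w" by blast
  then show ?thesis unfolding Ek by (rule sym)
qed

lemma hocolim_step:
  assumes "ar z" "cd z = G n"
  shows "q \<cdot> (\<iota> n \<cdot> z) = q \<cdot> (\<iota> (Suc n) \<cdot> (t n \<cdot> z))"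
proof -
  have "(q \<cdot> s) \<cdot> \<iota> n = zr (G n) H" unfolding dist_comp[OF H] by simp
  then have "q \<cdot> \<iota> n \<^bold>+ \<^bold>- (q \<cdot> (\<iota> (Suc n) \<cdot> t n)) = zr (G n) H" by (simp add: s)
  then have "q \<cdot> \<iota> n = q \<cdot> (\<iota> (Suc n) \<cdot> t n)"
    using pl_ng_eq_zr_iff[of "q \<cdot> \<iota> n" "q \<cdot> (\<iota> (Suc n) \<cdot> t n)"] by simp
  then have "(q \<cdot> \<iota> n) \<cdot> z = (q \<cdot> (\<iota> (Suc n) \<cdot> t n)) \<cdot> z" by simp
  then show ?thesis using assms by simp
qed

lemma hocolim_shift:
  assumes "ar z" "dm z = C" "cd z = G n"
  shows "\<exists>z'. ar z' \<and> dm z' = C \<and> cd z' = G (n + k) \<and> q \<cdot> (\<iota> n \<cdot> z) = q \<cdot> (\<iota> (n + k) \<cdot> z')"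
proof (induction k)
  case 0 show ?case using assms by (intro exI[of _ z]) simp
next
  case (Suc k)
  then obtain z' where z': "ar z'" "dm z' = C" "cd z' = G (n + k)" "q \<cdot> (\<iota> n \<cdot> z) = q \<cdot> (\<iota> (n + k) \<cdot> z')"
    by blast
  then show ?case using hocolim_step[OF z'(1,3)] by (intro exI[of _ "t (n + k) \<cdot> z'"]) simp
qed

text \<open>The connecting morphism \<open>h\<close> ends in a suspension, so
  \<open>telescope_mono\<close> is applied to a desuspension of \<open>C\<close>; it shows that
  \<open>h\<close> kills \<open>x\<close>. Thus \<open>x\<close> lifts to the coproduct, and its
  finitely many terms can be pushed to a common stage.\<close>

lemma cpt_hocolim:
  assumes C: "C \<in> cpt \<kappa> K" and x: "ar x" "dm x = C" "cd x = H"
  shows "\<exists>n y. ar y \<and> dm y = C \<and> cd y = G n \<and> x = q \<cdot> (\<iota> n \<cdot> y)"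
proof -
  have CO: "C \<in> Ob K" using C cpt_Ob by blast
  obtain C' u v where C': "C' \<in> Ob K" "isop (sh K C') C u v" using desuspend[OF CO] .
  note I = isopD[OF C'(2)]
  have cC': "C' \<in> cpt \<kappa> K" by (rule cpt_desuspend[OF cpt_iso[OF C isop_sym[OF C'(2)]] C'(1)])
  obtain w where w: "ar w" "dm w = C'" "cd w = U" "h \<cdot> (x \<cdot> u) = shm K w"
    by (rule shm_full[of "h \<cdot> (x \<cdot> u)" C' U]) ((use x I C' in simp_all)[5], blast)
  have "\<^bold>- (shm K s) \<cdot> h = zr H (sh K U)" by (rule dist_comp[OF rotate[OF rotate[OF H]]])
  then have sh0: "shm K s \<cdot> h = zr H (sh K U)" using ng_eq_zr_iff[of "shm K s \<cdot> h"] by simp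
  have "shm K (s \<cdot> w) = shm K s \<cdot> (h \<cdot> (x \<cdot> u))" unfolding w(4) using w(1-3) by simp
  also have "\<dots> = (shm K s \<cdot> h) \<cdot> (x \<cdot> u)" using x I by simp
  also have "\<dots> = shm K (zr C' U)" unfolding sh0 using x I C' by simp
  finally have "s \<cdot> w = zr C' U" by (rule shm_inj[rotated -1]) (use w(1-3) C' in simp_all)
  then have "w = zr C' U" by (rule telescope_mono[OF cC' w(1-3)])
  then have "h \<cdot> (x \<cdot> u) = zr (sh K C') (sh K U)" unfolding w(4) using C' by simp
  then have "(h \<cdot> (x \<cdot> u)) \<cdot> v = zr C (sh K U)" using I by simp
  then have hx: "h \<cdot> x = zr C (sh K U)" using x I by simp
  then have "h \<cdot> x = zr (dm x) (sh K U)" using x by simp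
  from weak_ker2[OF H x(1,3) this] obtain y where y: "ar y" "dm y = dm x" "cd y = U" "x = q \<cdot> y" by blast
  have y2: "dm y = C" using y(2) x(2) by simp
  have "fsum UNIV \<iota> C U y" by (rule cpt_fsum[OF size C small_nat[OF size] U y(1) y2 y(3)])
  then have "\<exists>n z. ar z \<and> dm z = C \<and> cd z = G n \<and> q \<cdot> y = q \<cdot> (\<iota> n \<cdot> z)"
  proof induction
    case fsum_zr show ?case using CO by (intro exI[of _ 0] exI[of _ "zr C (G 0)"]) simp
  next
    case (fsum_add f i g)
    note f = fsum_arr[OF fsum_add(1) CO U]
    obtain n z where z: "ar z" "dm z = C" "cd z = G n" "q \<cdot> f = q \<cdot> (\<iota> n \<cdot> z)" using fsum_add(6) by blast
    have g: "ar g" "dm g = C" "cd g = G i" using fsum_add(3-5) by simp_all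
    \<comment> \<open>Moving one term on by \<open>i\<close> and the other by \<open>n\<close>
      brings both to stage \<open>n + i\<close>.\<close>
    obtain z' where z': "ar z'" "dm z' = C" "cd z' = G (n + i)" "q \<cdot> (\<iota> n \<cdot> z) = q \<cdot> (\<iota> (n + i) \<cdot> z')"
      using hocolim_shift[OF z(1-3), of i] by blast
    obtain g' where g': "ar g'" "dm g' = C" "cd g' = G (i + n)" "q \<cdot> (\<iota> i \<cdot> g) = q \<cdot> (\<iota> (i + n) \<cdot> g')"
      using hocolim_shift[OF g, of n] by blast
    have "q \<cdot> (f \<^bold>+ \<iota> i \<cdot> g) = q \<cdot> f \<^bold>+ q \<cdot> (\<iota> i \<cdot> g)" using f g by simp
    also have "\<dots> = q \<cdot> (\<iota> (n + i) \<cdot> (z' \<^bold>+ g'))"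
      unfolding z(4) z'(4) g'(4) using z'(1-3) g'(1-3) by (simp add: add.commute)
    finally show ?case using z'(1-3) g'(1-3)
      by (intro exI[of _ "n + i"] exI[of _ "z' \<^bold>+ g'"]) (simp add: add.commute)
  qed
  then show ?thesis unfolding y(4) .
qed

end

end

section \<open>Rickard triangles\<close>

context rigidly_compactly_generated
begin

lemma coproducts_any:
  fixes J :: "'j set"
  assumes "small \<kappa> J" "\<And>j. j \<in> J \<Longrightarrow> F j \<in> Ob K"
  obtains X \<iota> where "coproduct K J F X \<iota>"
proof -
  obtain e and I :: "'i set" where e: "bij_betw e I J" "small \<kappa> I" using small_index[OF size_bound assms(1)] .
  have "\<And>i. i \<in> I \<Longrightarrow> F (e i) \<in> Ob K" using e(1) assms(2) bij_betw_apply by fast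
  then obtain X \<iota> where X: "coproduct K I (\<lambda>i. F (e i)) X \<iota>"
    using coproducts[OF e(2), of "\<lambda>i. F (e i)"] by blast
  have "coproduct K J F X (\<lambda>j. \<iota> (the_inv_into I e j))"
    by (rule coproduct_cong[OF coproduct_reindex[OF X bij_betw_the_inv_into[OF e(1)]]])
      (use e(1) in \<open>simp add: f_the_inv_into_f_bij_betw\<close>)
  then show thesis by (rule that)
qed

section \<open>Smallness of the morphism sets out of compact objects\<close>

lemma small_Hom_isop:
  "\<lbrakk>isop C C' u v; isop A A' s t; small \<kappa> (Hom K C' A')\<rbrakk> \<Longrightarrow> small \<kappa> (Hom K C A)"
  by (rule small_subset[OF size_bound small_image[OF size_bound] Hom_isop])

text \<open>Each application of \<open>\<Phi>\<close> allows one more term through a summand. All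
  finite sums are therefore reached in countably many stages, each of them small.\<close>

lemma small_Hom_coproduct:
  assumes C: "C \<in> cpt \<kappa> K" and I: "small \<kappa> (I :: 'i set)" "coproduct K I A X \<iota>"
    and A: "\<And>i. i \<in> I \<Longrightarrow> small \<kappa> (Hom K C (A i))"
  shows "small \<kappa> (Hom K C X)"
proof -
  have CO: "C \<in> Ob K" using C cpt_Ob by blast
  note D = coproductD[OF I(2)]
  define \<Phi> where "\<Phi> = (\<lambda>S. \<Union>i\<in>I. (\<lambda>(f, g). f \<^bold>+ \<iota> i \<cdot> g) ` (S \<times> Hom K C (A i)))"
  have sm: "small \<kappa> ((\<Phi> ^^ n) {zr C X})" for n
  proof (induction n)
    case 0 show ?case by (simp add: small_finite[OF size_bound])
  next
    case (Suc n)
    then show ?case using A I(1)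
      by (auto simp: \<Phi>_def intro!: small_UN[OF size_bound] small_image[OF size_bound] small_Sigma[OF size_bound])
  qed
  have "\<exists>n. f \<in> (\<Phi> ^^ n) {zr C X}" if "fsum I \<iota> C X f" for f
    using that
  proof induction
    case fsum_zr show ?case by (rule exI[of _ 0]) simp
  next
    case (fsum_add f i g)
    then obtain n where n: "f \<in> (\<Phi> ^^ n) {zr C X}" by blast
    have "g \<in> Hom K C (A i)" using fsum_add(3-5) D(2,4)[OF fsum_add(2)] CO by simp
    then have "(f, g) \<in> (\<Phi> ^^ n) {zr C X} \<times> Hom K C (A i)" using n by blast
    then have "f \<^bold>+ \<iota> i \<cdot> g \<in> (\<lambda>(f, g). f \<^bold>+ \<iota> i \<cdot> g) ` ((\<Phi> ^^ n) {zr C X} \<times> Hom K C (A i))"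
      by (rule rev_image_eqI) simp
    then have "f \<^bold>+ \<iota> i \<cdot> g \<in> \<Phi> ((\<Phi> ^^ n) {zr C X})" by (subst \<Phi>_def) (rule UN_I[OF fsum_add(2)])
    then show ?case by (intro exI[of _ "Suc n"]) simp
  qed
  then have "Hom K C X \<subseteq> (\<Union>n. (\<Phi> ^^ n) {zr C X})"
    using cpt_fsum_index[OF C I] CO D(1) by auto
  then show ?thesis
    by (rule small_subset[OF size_bound small_UN[OF size_bound small_nat[OF size_bound]], rotated]) (rule sm)
qed

text \<open>A morphism into the cone differs from a chosen lift of its image under \<open>h\<close>
  by a morphism that factors through \<open>g\<close>, so it is determined by a pair of data from
  small sets.\<close>

lemma small_Hom_cone:
  assumes T: "dist K X Y Z f g h" and C: "C \<in> Ob K" and s: "small \<kappa> (Hom K C Y)" "small \<kappa> (Hom K C (sh K X))"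
  shows "small \<kappa> (Hom K C Z)"
proof -
  note D = distD[OF T]
  \<comment> \<open>Where \<open>k\<close> has no lift, \<open>r k\<close> is arbitrary; this is
    harmless, since only an inclusion into the union is claimed.\<close>
  define r where "r k = (SOME z. z \<in> Hom K C Z \<and> h \<cdot> z = k)" for k
  have "Hom K C Z \<subseteq> (\<Union>k\<in>Hom K C (sh K X). (\<lambda>y. r k \<^bold>+ g \<cdot> y) ` Hom K C Y)"
  proof
    fix z assume zH: "z \<in> Hom K C Z"
    then have z: "ar z" "dm z = C" "cd z = Z" using C D by simp_all
    have "r (h \<cdot> z) \<in> Hom K C Z \<and> h \<cdot> r (h \<cdot> z) = h \<cdot> z"
      unfolding r_def by (rule someI[of _ z]) (use zH in simp)
    then have r: "ar (r (h \<cdot> z))" "dm (r (h \<cdot> z)) = C" "cd (r (h \<cdot> z)) = Z" "h \<cdot> r (h \<cdot> z) = h \<cdot> z"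
      using C D by simp_all
    define d where "d = z \<^bold>+ \<^bold>- r (h \<cdot> z)"
    have d: "ar d" "dm d = C" "cd d = Z" unfolding d_def using z r(1-3) by simp_all
    have "h \<cdot> d = zr (dm d) (sh K X)" unfolding d(2) unfolding d_def using z r D by simp
    from weak_ker2[OF T d(1,3) this] obtain y where y: "ar y" "dm y = dm d" "cd y = Y" "d = g \<cdot> y" by blast
    have "r (h \<cdot> z) \<^bold>+ g \<cdot> y = z"
    proof -
      have "r (h \<cdot> z) \<^bold>+ d = z \<^bold>+ (\<^bold>- r (h \<cdot> z) \<^bold>+ r (h \<cdot> z))"
        unfolding d_def using z r(1-3) pl_commute[of "r (h \<cdot> z)" "z \<^bold>+ \<^bold>- r (h \<cdot> z)"] by (simp add: pl_assoc del: ng_pl)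
      then show ?thesis unfolding y(4) using z r(1-3) by simp
    qed
    moreover have "y \<in> Hom K C Y" using y(1-3) d C D by simp
    moreover have "h \<cdot> z \<in> Hom K C (sh K X)" using z D C by simp
    ultimately show "z \<in> (\<Union>k\<in>Hom K C (sh K X). (\<lambda>y. r k \<^bold>+ g \<cdot> y) ` Hom K C Y)" by force
  qed
  then show ?thesis
    by (rule small_subset[OF size_bound small_UN[OF size_bound s(2)], rotated]) (rule small_image[OF size_bound s(1)])
qed

lemma desuspend_cpt:
  assumes "C \<in> cpt \<kappa> K"
  obtains C' u v where "C' \<in> cpt \<kappa> K" "isop (sh K C') C u v"
proof -
  obtain C' u v where C': "C' \<in> Ob K" "isop (sh K C') C u v" using desuspend[OF cpt_Ob[OF assms]] .
  have "C' \<in> cpt \<kappa> K" by (rule cpt_desuspend[OF cpt_iso[OF assms isop_sym[OF C'(2)]] C'(1)])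
  then show thesis by (rule that[OF _ C'(2)])
qed

text \<open>The objects for which this holds form a localizing subcategory. It contains the compact
  objects by their essential smallness, and these generate.\<close>

lemma small_Hom:
  assumes "C \<in> cpt \<kappa> K" "A \<in> Ob K"
  shows "small \<kappa> (Hom K C A)"
proof -
  let ?T = "{A \<in> Ob K. \<forall>C\<in>cpt \<kappa> K. small \<kappa> (Hom K C A)}"
  have T_sh: "sh K A \<in> ?T" if A: "A \<in> ?T" for A
  proof -
    have AO: "A \<in> Ob K" using A by blast
    have "small \<kappa> (Hom K C (sh K A))" if C: "C \<in> cpt \<kappa> K" for C
    proof -
      obtain C' u v where C': "C' \<in> cpt \<kappa> K" "isop (sh K C') C u v" using desuspend_cpt[OF C] .
      have "shm K ` Hom K C' A = Hom K (sh K C') (sh K A)"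
        using sh_fully_faithful[OF cpt_Ob[OF C'(1)] AO] unfolding bij_betw_def by (rule conjunct2)
      moreover have "small \<kappa> (shm K ` Hom K C' A)" by (rule small_image[OF size_bound]) (use A C'(1) in blast)
      ultimately have "small \<kappa> (Hom K (sh K C') (sh K A))" by (simp only:)
      with small_Hom_isop[OF isop_sym[OF C'(2)] isop_id[of "sh K A"]] show ?thesis using AO by (simp del: Hom_iff)
    qed
    then show ?thesis using AO by simp
  qed
  have "localizing \<kappa> K ?T"
  proof (rule localizingI)
    show "?T \<subseteq> Ob K" by blast
    show "Z \<in> ?T" if Z: "zero_object K Z" for Z
    proof -
      have "Hom K C Z \<subseteq> {zr C Z}" if "C \<in> cpt \<kappa> K" for C
      proof
        fix f assume "f \<in> Hom K C Z"
        then have "f = zr C Z" using to_zero[OF Z, of f C] zero_Ob[OF Z] cpt_Ob[OF that] by auto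
        then show "f \<in> {zr C Z}" by blast
      qed
      note hz = this
      have "small \<kappa> (Hom K C Z)" if "C \<in> cpt \<kappa> K" for C
        by (rule small_subset[OF size_bound small_finite[OF size_bound] hz[OF that]]) simp
      then show ?thesis using zero_Ob[OF Z] by blast
    qed
    show "B \<in> ?T" if A: "A \<in> ?T" and AB: "isop A B f g" for A B f g
    proof -
      have "small \<kappa> (Hom K C B)" if "C \<in> cpt \<kappa> K" for C
        by (rule small_Hom_isop[OF isop_id[OF cpt_Ob[OF that]] isop_sym[OF AB]]) (use A that in blast)
      then show ?thesis using isopD(10)[OF AB] by blast
    qed
    show "sh K A \<in> ?T" if "A \<in> ?T" for A by (rule T_sh[OF that])
    show "A \<in> ?T" if A: "A \<in> Ob K" "sh K A \<in> ?T" for A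
    proof -
      have "small \<kappa> (Hom K C A)" if C: "C \<in> cpt \<kappa> K" for C
      proof -
        have "bij_betw (shm K) (Hom K C A) (Hom K (sh K C) (sh K A))"
          by (rule sh_fully_faithful[OF cpt_Ob[OF C] A(1)])
        moreover have "small \<kappa> (Hom K (sh K C) (sh K A))" using A(2) cpt_sh[OF C] by blast
        ultimately show ?thesis unfolding bij_betw_def by (elim conjE) (rule small_inj[OF size_bound, of "shm K"], simp_all del: Hom_iff)
      qed
      then show ?thesis using A(1) by blast
    qed
    show "Z \<in> ?T" if T: "dist K X Y Z f g h" "X \<in> ?T" "Y \<in> ?T" for X Y Z f g h
    proof -
      have "small \<kappa> (Hom K C Z)" if "C \<in> cpt \<kappa> K" for C
        by (rule small_Hom_cone[OF T(1) cpt_Ob[OF that]]) (use T(3) T_sh[OF T(2)] that in blast)+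
      then show ?thesis using distD(3)[OF T(1)] by blast
    qed
    show "X \<in> ?T \<and> Y \<in> ?T" if b: "biproduct K X Y W i j p q" "W \<in> ?T" for X Y W i j p q
    proof -
      note D = biproductD[OF b(1)]
      have *: "small \<kappa> (Hom K C V)" if C: "C \<in> cpt \<kappa> K" and r: "ar r" "dm r = V" "cd r = W" "ar s" "dm s = W" "cd s = V" "s \<cdot> r = ident K V" for V r s C
      proof -
        have V: "V \<in> Ob K" using dm_Ob[OF r(1)] r(2) by simp
        have "f \<in> (\<lambda>f. s \<cdot> f) ` Hom K C W" if "f \<in> Hom K C V" for f
        proof (rule image_eqI)
          have f: "ar f" "dm f = C" "cd f = V" using that V cpt_Ob[OF C] by simp_all
          then have "s \<cdot> (r \<cdot> f) = (s \<cdot> r) \<cdot> f" using r(1-6) by simp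
          also have "\<dots> = f" unfolding r(7) using f by simp
          finally show "f = s \<cdot> (r \<cdot> f)" ..
          show "r \<cdot> f \<in> Hom K C W" using f r(1-3) D(3) cpt_Ob[OF C] by simp
        qed
        then have "Hom K C V \<subseteq> (\<lambda>f. s \<cdot> f) ` Hom K C W" by (rule subsetI)
        then show ?thesis by (rule small_subset[OF size_bound small_image[OF size_bound], rotated]) (use b(2) C in blast)
      qed
      have "\<forall>C\<in>cpt \<kappa> K. small \<kappa> (Hom K C X)" using *[OF _ D(4-6) D(10-12) D(16)] by (rule ballI)
      moreover have "\<forall>C\<in>cpt \<kappa> K. small \<kappa> (Hom K C Y)" using *[OF _ D(7-9) D(13-15) D(17)] by (rule ballI)
      ultimately show ?thesis using D(1,2) by blast
    qed
    show "X \<in> ?T" if "small \<kappa> I" "coproduct K I A X \<iota>" "\<And>i. i \<in> I \<Longrightarrow> A i \<in> ?T" for I :: "'i set" and A X \<iota>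
    proof -
      have "small \<kappa> (Hom K C X)" if C: "C \<in> cpt \<kappa> K" for C
        by (rule small_Hom_coproduct[OF C \<open>small \<kappa> I\<close> \<open>coproduct K I A X \<iota>\<close>]) (use C \<open>\<And>i. i \<in> I \<Longrightarrow> A i \<in> ?T\<close> in blast)
      then show ?thesis using coproductD(1)[OF that(2)] by blast
    qed
  qed
  moreover have "cpt \<kappa> K \<subseteq> ?T"
  proof -
    obtain S where S: "S \<subseteq> cpt \<kappa> K" "\<forall>C\<in>cpt \<kappa> K. \<exists>C'\<in>S. isomorphic K C C'" "\<forall>C\<in>S. \<forall>C'\<in>S. small \<kappa> (Hom K C C')"
      using cpt_ess_small by blast
    have iso: "\<exists>C'\<in>S. \<exists>u v. isop C C' u v" if C: "C \<in> cpt \<kappa> K" for C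
    proof -
      obtain C' where "C' \<in> S" "isomorphic K C C'" using S(2) C by blast
      moreover have "C' \<in> Ob K" using calculation(1) S(1) cpt_Ob by blast
      ultimately show ?thesis using isomorphic_iff[OF cpt_Ob[OF C], of C'] by blast
    qed
    have "small \<kappa> (Hom K C A)" if C: "C \<in> cpt \<kappa> K" and A: "A \<in> cpt \<kappa> K" for C A
    proof -
      obtain C' u v where C': "C' \<in> S" "isop C C' u v" using iso[OF C] by blast
      obtain A' s t where A': "A' \<in> S" "isop A A' s t" using iso[OF A] by blast
      show ?thesis by (rule small_Hom_isop[OF C'(2) A'(2)]) (use S(3) C'(1) A'(1) in blast)
    qed
    then show ?thesis using cpt_Ob by blast
  qed
  ultimately have "Loc \<kappa> K (cpt \<kappa> K) \<subseteq> ?T" by (rule Loc_least)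
  then show ?thesis using assms unfolding cpt_generates by blast
qed

section \<open>Construction of the Rickard triangles\<close>

lemma Loc_mono: "\<lbrakk>S \<subseteq> Loc \<kappa> K T; T \<subseteq> Ob K\<rbrakk> \<Longrightarrow> Loc \<kappa> K S \<subseteq> Loc \<kappa> K T"
  by (rule Loc_least[OF localizing_Loc])

text \<open>\<open>U\<close> has one copy of \<open>C\<close> for every morphism in
  \<open>F C\<close>, and \<open>p\<close> restricts to that morphism. Keeping \<open>F\<close>
  variable serves two purposes: covering all morphisms into \<open>A\<close>, and covering just
  those to be killed, in which case the last clause says which morphisms still extend.\<close>

lemma covering:
  assumes S: "S \<subseteq> cpt \<kappa> K" "small \<kappa> S" and A: "A \<in> Ob K" and F: "\<And>C. C \<in> S \<Longrightarrow> F C \<subseteq> Hom K C A"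
  obtains U p where "U \<in> Loc \<kappa> K S" "ar p" "dm p = U" "cd p = A"
    "\<And>C x. \<lbrakk>C \<in> S; x \<in> F C\<rbrakk> \<Longrightarrow> \<exists>y. ar y \<and> dm y = C \<and> cd y = U \<and> x = p \<cdot> y"
    "\<And>b. \<lbrakk>ar b; dm b = A; \<And>C x. \<lbrakk>C \<in> S; x \<in> F C\<rbrakk> \<Longrightarrow> b \<cdot> x = zr C (cd b)\<rbrakk> \<Longrightarrow> b \<cdot> p = zr U (cd b)"
proof -
  have SO: "S \<subseteq> Ob K" using S(1) cpt_Ob by blast
  have x: "ar x \<and> dm x = C \<and> cd x = A" if "C \<in> S" "x \<in> F C" for C x
  proof -
    have "x \<in> Hom K C A" using F that by blast
    moreover have "C \<in> Ob K" using SO that(1) by blast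
    ultimately show ?thesis using A by simp
  qed
  have sm: "small \<kappa> (Sigma S F)"
    by (rule small_Sigma[OF size_bound S(2) small_subset[OF size_bound small_Hom F]]) (use S(1) A in auto)
  obtain U \<iota> where U: "coproduct K (Sigma S F) fst U \<iota>"
    by (rule coproducts_any[OF sm, of fst]) (use SO in auto)
  note D = coproductD[OF U]
  obtain p where p: "ar p" "dm p = U" "cd p = A" "\<And>i. i \<in> Sigma S F \<Longrightarrow> p \<cdot> \<iota> i = snd i"
    by (rule coproduct_ex[OF U A, of snd]) (use x in force, blast)
  have "U \<in> Loc \<kappa> K S"
    by (rule localizing_coproduct[OF size_bound localizing_Loc[OF SO] sm U]) (use Loc_contains in force)
  moreover have "\<exists>y. ar y \<and> dm y = C \<and> cd y = U \<and> z = p \<cdot> y" if "C \<in> S" "z \<in> F C" for C z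
  proof -
    have i: "(C, z) \<in> Sigma S F" using that by blast
    show ?thesis using D(3-5)[OF i] p(4)[OF i] by (intro exI[of _ "\<iota> (C, z)"]) simp
  qed
  moreover have "b \<cdot> p = zr U (cd b)"
    if b: "ar b" "dm b = A" "\<And>C x. \<lbrakk>C \<in> S; x \<in> F C\<rbrakk> \<Longrightarrow> b \<cdot> x = zr C (cd b)" for b
  proof (rule coproduct_eqI[OF U])
    fix i assume i: "i \<in> Sigma S F"
    have "(b \<cdot> p) \<cdot> \<iota> i = b \<cdot> (p \<cdot> \<iota> i)" using b(1,2) p(1-3) D(3-5)[OF i] by simp
    also have "\<dots> = zr (fst i) (cd b)" unfolding p(4)[OF i] by (rule b(3)) (use i in auto)
    finally show "(b \<cdot> p) \<cdot> \<iota> i = zr U (cd b) \<cdot> \<iota> i" using b(1) D(3-5)[OF i] by simp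
  qed (use b(1,2) p(1-3) D(1) in simp_all)
  ultimately show thesis by (rule that[OF _ p(1-3)])
qed

text \<open>Starting from a cover of \<open>A\<close> by objects of \<open>S\<close>, one successively kills the morphisms from \<open>S\<close>
  that vanish in \<open>A\<close>; in the homotopy colimit every morphism that vanishes in \<open>A\<close> vanishes.\<close>

lemma Loc_approximates:
  assumes S: "S \<subseteq> cpt \<kappa> K" "small \<kappa> S" and A: "A \<in> Ob K"
  obtains H a where "H \<in> Loc \<kappa> K S" "ar a" "dm a = H" "cd a = A"
    "\<And>C x. \<lbrakk>C \<in> S; ar x; dm x = C; cd x = A\<rbrakk> \<Longrightarrow> \<exists>y. ar y \<and> dm y = C \<and> cd y = H \<and> x = a \<cdot> y"
    "\<And>C x. \<lbrakk>C \<in> S; ar x; dm x = C; cd x = H; a \<cdot> x = zr C A\<rbrakk> \<Longrightarrow> x = zr C H"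
proof -
  have SO: "S \<subseteq> Ob K" using S(1) cpt_Ob by blast
  have LO: "Loc \<kappa> K S \<subseteq> Ob K" using triangulated_subD(1)[OF localizing_sub[OF localizing_Loc[OF SO]]] .
  \<comment> \<open>Lifting of all morphisms from \<open>S\<close> is recorded for stage
    \<open>0\<close> only, as a lift there passes on to the homotopy colimit.\<close>
  let ?P = "\<lambda>n (G, a). G \<in> Loc \<kappa> K S \<and> ar a \<and> dm a = G \<and> cd a = A \<and>
      (n = (0::nat) \<longrightarrow> (\<forall>C\<in>S. \<forall>x\<in>Hom K C A. \<exists>y. ar y \<and> dm y = C \<and> cd y = G \<and> x = a \<cdot> y))"
  let ?R = "\<lambda>(G, a) (G', a') t. ar t \<and> dm t = G \<and> cd t = G' \<and> a' \<cdot> t = a \<and>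
      (\<forall>C\<in>S. \<forall>x. ar x \<and> dm x = C \<and> cd x = G \<and> a \<cdot> x = zr C A \<longrightarrow> t \<cdot> x = zr C G')"
  have "\<exists>s. \<forall>n. ?P n (s n) \<and> (\<exists>t. ?R (s n) (s (Suc n)) t)"
  proof (rule dependent_nat_choice)
    obtain G a where G: "G \<in> Loc \<kappa> K S" "ar a" "dm a = G" "cd a = A"
      "\<And>C x. \<lbrakk>C \<in> S; x \<in> Hom K C A\<rbrakk> \<Longrightarrow> \<exists>y. ar y \<and> dm y = C \<and> cd y = G \<and> x = a \<cdot> y"
      by (rule covering[OF S A, of "\<lambda>C. Hom K C A"]) (rule subset_refl, blast)
    show "\<exists>s. ?P 0 s" by (rule exI[of _ "(G, a)"]) (use G in \<open>simp del: Hom_iff\<close>)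
  next
    fix s :: "'o \<times> 'm" and n assume "?P n s"
    then obtain G a where s: "s = (G, a)" and G: "G \<in> Loc \<kappa> K S" "ar a" "dm a = G" "cd a = A"
      by (cases s) simp
    have GO: "G \<in> Ob K" using G(1) LO by blast
    obtain U p where U: "U \<in> Loc \<kappa> K S" "ar p" "dm p = U" "cd p = G"
      and cov: "\<And>C x. \<lbrakk>C \<in> S; x \<in> {x \<in> Hom K C G. a \<cdot> x = zr C A}\<rbrakk> \<Longrightarrow> \<exists>y. ar y \<and> dm y = C \<and> cd y = U \<and> x = p \<cdot> y"
      and van: "\<And>b. \<lbrakk>ar b; dm b = G; \<And>C x. \<lbrakk>C \<in> S; x \<in> {x \<in> Hom K C G. a \<cdot> x = zr C A}\<rbrakk> \<Longrightarrow> b \<cdot> x = zr C (cd b)\<rbrakk>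
        \<Longrightarrow> b \<cdot> p = zr U (cd b)"
      by (rule covering[OF S GO, of "\<lambda>C. {x \<in> Hom K C G. a \<cdot> x = zr C A}"]) (blast, blast)
    have ap: "a \<cdot> p = zr U (cd a)" by (rule van[OF G(2,3)]) (simp add: G(4))
    have UO: "U \<in> Ob K" using U(1) LO by blast
    \<comment> \<open>Whatever factors through \<open>p\<close>, hence every morphism from
      \<open>S\<close> that vanishes in \<open>A\<close>, dies in the cone of \<open>p\<close>; and
      \<open>a\<close> extends to that cone since it kills \<open>p\<close>.\<close>
    obtain G' t h where T: "dist K U G G' p t h" using TR1_cone[OF UO GO, of p] U UO GO by auto
    note D = distD[OF T]
    obtain a' where a': "ar a'" "dm a' = G'" "cd a' = cd a" "a = a' \<cdot> t" by (rule weak_coker[OF T G(2,3) ap]) blast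
    have G': "G' \<in> Loc \<kappa> K S" by (rule triangulated_subD(4)[OF localizing_sub[OF localizing_Loc[OF SO]] T U(1) G(1)])
    have "t \<cdot> x = zr C G'" if C: "C \<in> S" and x: "ar x" "dm x = C" "cd x = G" "a \<cdot> x = zr C A" for C x
    proof -
      have CO: "C \<in> Ob K" using C SO by blast
      have "x \<in> {x \<in> Hom K C G. a \<cdot> x = zr C A}" using x CO GO by simp
      then obtain y where y: "ar y" "dm y = C" "cd y = U" "x = p \<cdot> y" using cov[OF C] by blast
      have "t \<cdot> x = (t \<cdot> p) \<cdot> y" unfolding y(4) using y(1-3) D by simp
      then show ?thesis unfolding dist_comp[OF T] using y(1-3) D by simp
    qed
    then have "?R s (G', a') t" unfolding s using D(7-9) a'(4)[symmetric] by simp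
    moreover have "?P (Suc n) (G', a')" using G' a'(1-3) G(4) by simp
    ultimately show "\<exists>s'. ?P (Suc n) s' \<and> (\<exists>t. ?R s s' t)" by (intro exI[of _ "(G', a')"] conjI exI[of _ t])
  qed
  then obtain s where "\<forall>n. ?P n (s n) \<and> (\<exists>t. ?R (s n) (s (Suc n)) t)" by (rule exE)
  then have s: "\<And>n. ?P n (s n)" "\<And>n. \<exists>t. ?R (s n) (s (Suc n)) t" by simp_all
  have "\<forall>n. \<exists>t. ?R (s n) (s (Suc n)) t" using s(2) by (rule allI)
  then obtain t where "\<forall>n. ?R (s n) (s (Suc n)) (t n)" using choice[OF \<open>\<forall>n. \<exists>t. ?R (s n) (s (Suc n)) t\<close>] by (elim exE)
  then have t': "\<And>n. ?R (s n) (s (Suc n)) (t n)" by (rule spec)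
  define G where "G n = fst (s n)" for n
  define a where "a n = snd (s n)" for n
  have sn: "s n = (G n, a n)" for n unfolding G_def a_def by simp
  have G: "G n \<in> Loc \<kappa> K S" "ar (a n)" "dm (a n) = G n" "cd (a n) = A" for n
    using s(1)[of n] unfolding sn by simp_all
  have surj: "\<exists>y. ar y \<and> dm y = C \<and> cd y = G 0 \<and> x = a 0 \<cdot> y" if "C \<in> S" "x \<in> Hom K C A" for C x
    using s(1)[of 0] that unfolding sn by (simp del: Hom_iff)
  have t: "ar (t n)" "dm (t n) = G n" "cd (t n) = G (Suc n)" "a (Suc n) \<cdot> t n = a n" for n
    using t'[of n] unfolding sn by simp_all
  have kill: "t n \<cdot> x = zr C (G (Suc n))"
    if "C \<in> S" "ar x" "dm x = C" "cd x = G n" "a n \<cdot> x = zr C A" for n C x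
    using t'[of n] that unfolding sn by simp
  have GO: "G n \<in> Ob K" for n using G(1) LO by blast
  obtain U \<iota> where U: "coproduct K UNIV G U \<iota>"
    by (rule coproducts_any[OF small_nat[OF size_bound], of G]) (rule GO, blast)
  note D = coproductD[OF U]
  have i: "ar (\<iota> n)" "dm (\<iota> n) = G n" "cd (\<iota> n) = U" for n using D by simp_all
  obtain sg where sg: "ar sg" "dm sg = U" "cd sg = U" "\<And>n. n \<in> UNIV \<Longrightarrow> sg \<cdot> \<iota> n = \<iota> n \<^bold>+ \<^bold>- (\<iota> (Suc n) \<cdot> t n)"
    by (rule coproduct_ex[OF U D(1), of "\<lambda>n. \<iota> n \<^bold>+ \<^bold>- (\<iota> (Suc n) \<cdot> t n)"]) (use i t in simp, blast)
  obtain b where b: "ar b" "dm b = U" "cd b = A" "\<And>n. n \<in> UNIV \<Longrightarrow> b \<cdot> \<iota> n = a n"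
    by (rule coproduct_ex[OF U A, of a]) (use G in simp, blast)
  obtain H q h where T: "dist K U U H sg q h" using TR1_cone[OF D(1) D(1), of sg] sg(1-3) D(1) by auto
  note E = distD[OF T]
  have bs: "b \<cdot> sg = zr U (cd b)"
  proof (rule coproduct_eqI[OF U])
    fix n
    have "(b \<cdot> sg) \<cdot> \<iota> n = b \<cdot> (sg \<cdot> \<iota> n)" using b(1-3) sg(1-3) i by simp
    also have "\<dots> = b \<cdot> \<iota> n \<^bold>+ \<^bold>- ((b \<cdot> \<iota> (Suc n)) \<cdot> t n)" using sg(4)[of n] b(1-3) i t(1-3) by simp
    also have "\<dots> = zr U (cd b) \<cdot> \<iota> n" using b t(4) G i A by simp
    finally show "(b \<cdot> sg) \<cdot> \<iota> n = zr U (cd b) \<cdot> \<iota> n" .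
  qed (use b(1-3) sg(1-3) A D(1) in simp_all)
  obtain c where c: "ar c" "dm c = H" "cd c = cd b" "b = c \<cdot> q" by (rule weak_coker[OF T b(1,2) bs]) blast
  have L: "localizing \<kappa> K (Loc \<kappa> K S)" by (rule localizing_Loc[OF SO])
  have UL: "U \<in> Loc \<kappa> K S" by (rule localizing_coproduct[OF size_bound L small_nat[OF size_bound] U]) (rule G)
  have HL: "H \<in> Loc \<kappa> K S" by (rule triangulated_subD(4)[OF localizing_sub[OF L] T UL UL])
  have cqi: "c \<cdot> (q \<cdot> (\<iota> n \<cdot> y)) = a n \<cdot> y" if y: "ar y" "cd y = G n" for n y
  proof -
    have "c \<cdot> (q \<cdot> (\<iota> n \<cdot> y)) = ((c \<cdot> q) \<cdot> \<iota> n) \<cdot> y" using c(1-3) E i y by simp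
    also have "\<dots> = a n \<cdot> y" unfolding c(4)[symmetric] using b(4)[of n] by simp
    finally show ?thesis .
  qed
  have 1: "\<exists>y. ar y \<and> dm y = C \<and> cd y = H \<and> x = c \<cdot> y" if C: "C \<in> S" and x: "ar x" "dm x = C" "cd x = A" for C x
  proof -
    have "C \<in> Ob K" using C SO by blast
    then have "x \<in> Hom K C A" using x A by simp
    then obtain y where y: "ar y" "dm y = C" "cd y = G 0" "x = a 0 \<cdot> y" using surj[OF C] by blast
    then have "x = c \<cdot> (q \<cdot> (\<iota> 0 \<cdot> y))" using cqi[OF y(1,3)] by simp
    then show ?thesis using y(1-3) E i by (intro exI[of _ "q \<cdot> (\<iota> 0 \<cdot> y)"]) simp
  qed
  have 2: "x = zr C H" if C: "C \<in> S" and x: "ar x" "dm x = C" "cd x = H" "c \<cdot> x = zr C A" for C x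
  proof -
    have CO: "C \<in> Ob K" and Cc: "C \<in> cpt \<kappa> K" using C SO S(1) by blast+
    have sg4: "sg \<cdot> \<iota> n = \<iota> n \<^bold>+ \<^bold>- (\<iota> (Suc n) \<cdot> t n)" for n using sg(4) by simp
    obtain n y where y: "ar y" "dm y = C" "cd y = G n" "x = q \<cdot> (\<iota> n \<cdot> y)"
      using cpt_hocolim[OF size_bound t(1-3) U sg4 T Cc x(1-3)] by blast
    \<comment> \<open>A representative of \<open>x\<close> at stage \<open>n\<close> vanishes in
      \<open>A\<close>, so the next transition morphism kills it, while \<open>q\<close> does not
      distinguish the two stages.\<close>
    have "a n \<cdot> y = zr C A" using cqi[OF y(1,3)] x(4) unfolding y(4) by simp
    then have "t n \<cdot> y = zr C (G (Suc n))" by (rule kill[OF C y(1-3)])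
    then have "x = q \<cdot> (\<iota> (Suc n) \<cdot> zr C (G (Suc n)))"
      using hocolim_step[OF size_bound t(1-3) U sg4 T y(1,3)] unfolding y(4) by simp
    then show ?thesis using i E CO by simp
  qed
  have "cd c = A" using c(3) b(3) by simp
  from that[OF HL c(1,2) this 1 2] show thesis .
qed

text \<open>\<open>L\<close> is the cone of the approximation by a small skeleton \<open>S\<close>
  of \<open>I\<close>. For a morphism \<open>x\<close> from \<open>S\<close> to \<open>L\<close>,
  injectivity on a desuspension gives \<open>h \<cdot> x = 0\<close>, so \<open>x\<close> comes from
  \<open>A\<close>; surjectivity then routes it through \<open>g \<cdot> a = 0\<close>. Replacing
  \<open>S\<close> by \<open>I\<close> is a matter of isomorphisms, and \<open>Loc_orth\<close>
  extends the vanishing to \<open>Loc\<close>.\<close>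

lemma rickard_ex:
  assumes I: "I \<subseteq> cpt \<kappa> K" "\<And>A B f g. \<lbrakk>A \<in> I; isop A B f g\<rbrakk> \<Longrightarrow> B \<in> I" "sh_closed I" and A: "A \<in> Ob K"
  shows "\<exists>G L. rickard_triangle \<kappa> K I A G L"
proof -
  obtain S' where S': "S' \<subseteq> cpt \<kappa> K" "small \<kappa> S'" "\<forall>C\<in>cpt \<kappa> K. \<exists>C'\<in>S'. isomorphic K C C'"
    using cpt_ess_small by (elim exE conjE) (rule that)
  define S where "S = S' \<inter> I"
  have S: "S \<subseteq> cpt \<kappa> K" "small \<kappa> S" "S \<subseteq> I"
    unfolding S_def using S'(1) small_subset[OF size_bound S'(2)] by blast+
  have IO: "I \<subseteq> Ob K" using I(1) cpt_Ob by blast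
  have skel: "\<exists>C'\<in>S. \<exists>u v. isop C C' u v" if C: "C \<in> I" for C
  proof -
    have Cc: "C \<in> cpt \<kappa> K" using I(1) C by blast
    obtain C' where C': "C' \<in> S'" "isomorphic K C C'" using S'(3) Cc by blast
    have "C' \<in> Ob K" using C'(1) S'(1) cpt_Ob by blast
    then obtain u v where uv: "isop C C' u v" using isomorphic_iff[OF cpt_Ob[OF Cc]] C'(2) by blast
    have "C' \<in> S" using I(2)[OF C uv] C'(1) unfolding S_def by blast
    then show ?thesis using uv by blast
  qed
  obtain G a where G: "G \<in> Loc \<kappa> K S" "ar a" "dm a = G" "cd a = A"
    and surj: "\<And>C x. \<lbrakk>C \<in> S; ar x; dm x = C; cd x = A\<rbrakk> \<Longrightarrow> \<exists>y. ar y \<and> dm y = C \<and> cd y = G \<and> x = a \<cdot> y"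
    and inj: "\<And>C x. \<lbrakk>C \<in> S; ar x; dm x = C; cd x = G; a \<cdot> x = zr C A\<rbrakk> \<Longrightarrow> x = zr C G"
    by (rule Loc_approximates[OF S(1,2) A]) blast
  have "S \<subseteq> Loc \<kappa> K I" using S(3) Loc_contains[of I \<kappa>] by blast
  then have GI: "G \<in> Loc \<kappa> K I" using Loc_mono[OF _ IO] G(1) by blast
  have GO: "G \<in> Ob K" using dm_Ob[OF G(2)] G(3) by simp
  obtain L g h where T: "dist K G A L a g h" using TR1_cone[OF GO A, of a] G GO A by auto
  note D = distD[OF T]
  have orthS: "orth C L" if C: "C \<in> S" for C
    unfolding orth_def
  proof (intro allI impI)
    fix x assume "ar x \<and> dm x = C \<and> cd x = L"
    then have x: "ar x" "dm x = C" "cd x = L" by simp_all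
    have CI: "C \<in> I" and CO: "C \<in> Ob K" using C S(3) IO by blast+
    \<comment> \<open>The desuspension of \<open>C\<close> has to be replaced by an isomorphic
      object of \<open>S\<close>, because \<open>inj\<close> speaks of \<open>S\<close>
      only.\<close>
    obtain C1 u1 v1 where C1: "C1 \<in> I" "isop (sh K C1) C u1 v1" using I(3) CI unfolding sh_closed_def by blast
    obtain C' u2 v2 where C': "C' \<in> S" "isop C1 C' u2 v2" using skel[OF C1(1)] by blast
    obtain u v where uv: "isop (sh K C') C u v" using isop_trans[OF sh_isop[OF isop_sym[OF C'(2)]] C1(2)] by blast
    note U = isopD[OF uv]
    have C'O: "C' \<in> Ob K" using C'(1) S(3) IO by blast
    obtain w where w: "ar w" "dm w = C'" "cd w = G" "h \<cdot> (x \<cdot> u) = shm K w"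
      by (rule shm_full[of "h \<cdot> (x \<cdot> u)" C' G]) ((use x U C'O D in simp_all)[5], blast)
    have "\<^bold>- (shm K a) \<cdot> h = zr L (sh K A)" by (rule dist_comp[OF rotate[OF rotate[OF T]]])
    then have ah: "shm K a \<cdot> h = zr L (sh K A)" using ng_eq_zr_iff[of "shm K a \<cdot> h"] D by simp
    have "shm K (a \<cdot> w) = shm K a \<cdot> (h \<cdot> (x \<cdot> u))" unfolding w(4) using w(1-3) D by simp
    also have "\<dots> = (shm K a \<cdot> h) \<cdot> (x \<cdot> u)" using x U D by simp
    also have "\<dots> = shm K (zr C' A)" unfolding ah using x U C'O D by simp
    finally have "a \<cdot> w = zr C' A" by (rule shm_inj[rotated -1]) (use w(1-3) C'O D in simp_all)
    then have "w = zr C' G" by (rule inj[OF C'(1) w(1-3)])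
    then have "h \<cdot> (x \<cdot> u) = zr (sh K C') (sh K G)" unfolding w(4) using C'O D by simp
    then have "(h \<cdot> (x \<cdot> u)) \<cdot> v = zr C (sh K G)" using U D by simp
    then have "h \<cdot> x = zr (dm x) (sh K G)" using x U D by simp
    from weak_ker2[OF T x(1,3) this] obtain y where y: "ar y" "dm y = dm x" "cd y = A" "x = g \<cdot> y" by blast
    have y2: "dm y = C" using y(2) x(2) by simp
    obtain z where z: "ar z" "dm z = C" "cd z = G" "y = a \<cdot> z" using surj[OF C y(1) y2 y(3)] by blast
    have "x = (g \<cdot> a) \<cdot> z" unfolding y(4) z(4) using z(1-3) D by simp
    then show "x = zr C L" unfolding dist_comp[OF T] using z(1-3) D by simp
  qed
  have "orth C L" if C: "C \<in> I" for C
  proof -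
    obtain C' u v where C': "C' \<in> S" "isop C C' u v" using skel[OF C] by blast
    show ?thesis by (rule orth_isop_left[OF orthS[OF C'(1)] isop_sym[OF C'(2)] D(3)])
  qed
  then have "orth B L" if "B \<in> Loc \<kappa> K I" for B by (rule Loc_orth[OF I(3) D(3) _ that])
  moreover have "Loc \<kappa> K I \<subseteq> Ob K" using triangulated_subD(1)[OF localizing_sub[OF localizing_Loc[OF IO]]] .
  ultimately have "Hom K B L = {zr B L}" if "B \<in> Loc \<kappa> K I" for B
    using orth_iff[of B L] D(3) that by (simp only: subset_eq)
  then have "rickard_triangle \<kappa> K I A G L" unfolding rickard_triangle_def using T GI by blast
  then show ?thesis by blast
qed

end

section \<open>Tensor products and duality\<close>

context monoidal_triangulated_category
begin

lemma tens_simps [simp]: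
  assumes "ar f" "ar g"
  shows "ar (f \<boxdot> g)" "dm (f \<boxdot> g) = dm f \<boxtimes> dm g" "cd (f \<boxdot> g) = cd f \<boxtimes> cd g"
proof -
  have "f \<boxdot> g \<in> Hom K (dm f \<boxtimes> dm g) (cd f \<boxtimes> cd g)"
    by (rule tensm_Hom) (use assms in simp_all)
  then show "ar (f \<boxdot> g)" "dm (f \<boxdot> g) = dm f \<boxtimes> dm g" "cd (f \<boxdot> g) = cd f \<boxtimes> cd g"
    using assms by (simp_all add: tens_Ob)
qed

declare tens_Ob [simp] unt_Ob [simp]

lemma interchange:
  "\<lbrakk>ar f; ar g; ar f'; ar g'; dm g = cd f; dm g' = cd f'\<rbrakk> \<Longrightarrow> (g \<cdot> f) \<boxdot> (g' \<cdot> f') = (g \<boxdot> g') \<cdot> (f \<boxdot> f')"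
  by (rule tensm_cmp[of "dm f" "cd f" "cd g" "dm f'" "cd f'" "cd g'"]) simp_all

lemma zr_tens: "\<lbrakk>A \<in> Ob K; B \<in> Ob K; C \<in> Ob K\<rbrakk> \<Longrightarrow> zr A B \<boxdot> ident K C = zr (A \<boxtimes> C) (B \<boxtimes> C)"
  using additive_functorD(8)[of "\<lambda>B. B \<boxtimes> C" "\<lambda>f. f \<boxdot> ident K C"] tens_exact_left[of C]
  unfolding exact_functor_def by blast

lemma asc_isop:
  assumes "A \<in> Ob K" "B \<in> Ob K" "C \<in> Ob K"
  shows "isop ((A \<boxtimes> B) \<boxtimes> C) (A \<boxtimes> (B \<boxtimes> C)) (asc K A B C)
    (inv_arrow K ((A \<boxtimes> B) \<boxtimes> C) (A \<boxtimes> (B \<boxtimes> C)) (asc K A B C))"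
  by (rule iso_arrow_inv[OF _ _ asc_iso]) (use assms in simp_all)

lemma run_isop: "A \<in> Ob K \<Longrightarrow> isop (A \<boxtimes> unt K) A (run K A) (inv_arrow K (A \<boxtimes> unt K) A (run K A))"
  by (rule iso_arrow_inv[OF _ _ run_iso]) simp_all

lemma lun_isop: "A \<in> Ob K \<Longrightarrow> isop (unt K \<boxtimes> A) A (lun K A) (inv_arrow K (unt K \<boxtimes> A) A (lun K A))"
  by (rule iso_arrow_inv[OF _ _ lun_iso]) simp_all

lemma asc_simps [simp]:
  assumes "A \<in> Ob K" "B \<in> Ob K" "C \<in> Ob K"
  shows "ar (asc K A B C)" "dm (asc K A B C) = (A \<boxtimes> B) \<boxtimes> C" "cd (asc K A B C) = A \<boxtimes> (B \<boxtimes> C)"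
  using isopD[OF asc_isop[OF assms]] by simp_all

lemma run_simps [simp]:
  assumes "A \<in> Ob K"
  shows "ar (run K A)" "dm (run K A) = A \<boxtimes> unt K" "cd (run K A) = A"
  using isopD[OF run_isop[OF assms]] by simp_all

lemma lun_simps [simp]:
  assumes "A \<in> Ob K"
  shows "ar (lun K A)" "dm (lun K A) = unt K \<boxtimes> A" "cd (lun K A) = A"
  using isopD[OF lun_isop[OF assms]] by simp_all

lemma isop_epi:
  assumes "isop A B f g" "ar x" "ar y" "dm x = B" "dm y = B" "x \<cdot> f = y \<cdot> f"
  shows "x = y"
proof -
  note I = isopD[OF assms(1)]
  have "x = (x \<cdot> f) \<cdot> g" using I assms(2,4) by simp
  also have "\<dots> = (y \<cdot> f) \<cdot> g" by (rule arg_cong[OF assms(6)])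
  also have "\<dots> = y" using I assms(3,5) by simp
  finally show ?thesis .
qed

lemma isop_mono:
  assumes "isop A B f g" "ar x" "ar y" "cd x = A" "cd y = A" "f \<cdot> x = f \<cdot> y"
  shows "x = y"
proof -
  have "x = g \<cdot> (f \<cdot> x)" using isop_cancel(1)[OF assms(1,2,4)] by (rule sym)
  also have "\<dots> = g \<cdot> (f \<cdot> y)" by (rule arg_cong[OF assms(6)])
  also have "\<dots> = y" by (rule isop_cancel(1)[OF assms(1,3,5)])
  finally show ?thesis .
qed

text \<open>The unit of the adjunction between \<open>_ \<boxtimes> D\<close> and \<open>_ \<boxtimes> C\<close> is only needed up to the
  endomorphism \<open>u\<close> below, so the coherence between \<open>run\<close> and \<open>asc\<close> need not be derived.\<close>

lemma orth_dual:
  assumes "left_dual K D C" and L: "L \<in> Ob K" and X: "X \<in> Ob K" and C: "C \<in> Ob K" and D: "D \<in> Ob K"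
    and o: "orth (X \<boxtimes> D) L"
  shows "orth X (L \<boxtimes> C)"
  unfolding orth_def
proof (intro allI impI)
  fix f assume "ar f \<and> dm f = X \<and> cd f = L \<boxtimes> C"
  then have f: "ar f" "dm f = X" "cd f = L \<boxtimes> C" by simp_all
  let ?r = "inv_arrow K (C \<boxtimes> unt K) C (run K C)"
  let ?b5 = "inv_arrow K ((C \<boxtimes> D) \<boxtimes> C) (C \<boxtimes> (D \<boxtimes> C)) (asc K C D C)"
  obtain ev co where ev: "ev \<in> Hom K (C \<boxtimes> D) (unt K)" and co: "co \<in> Hom K (unt K) (D \<boxtimes> C)"
    and zz: "lun K C \<cdot> (ev \<boxdot> ident K C) \<cdot> ?b5 \<cdot> (ident K C \<boxdot> co) \<cdot> ?r = ident K C"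
    using assms(1) unfolding left_dual_def by (elim bexE conjE) (rule that)
  have ev: "ar ev" "dm ev = C \<boxtimes> D" "cd ev = unt K" and co: "ar co" "dm co = unt K" "cd co = D \<boxtimes> C"
    using ev co C D by simp_all
  note r = isopD[OF run_isop[OF C]] and b5 = isopD[OF asc_isop[OF C D C]]
  define M where "M = L \<boxtimes> C"
  have M: "M \<in> Ob K" unfolding M_def using L C by simp
  note a8 = asc_isop[OF L C unt_Ob]
  let ?b8 = "inv_arrow K (L \<boxtimes> C \<boxtimes> unt K) (L \<boxtimes> (C \<boxtimes> unt K)) (asc K L C (unt K))"
  \<comment> \<open>In this notation the second zigzag identity says that \<open>rt\<close> is a
    retraction of the morphism from \<open>C\<close> to
    \<open>C \<boxtimes> (D \<boxtimes> C)\<close> induced by \<open>co\<close>.\<close>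
  define rt where "rt = lun K C \<cdot> (ev \<boxdot> ident K C) \<cdot> ?b5"
  have rt: "ar rt" "dm rt = C \<boxtimes> (D \<boxtimes> C)" "cd rt = C" unfolding rt_def using ev b5 C D by simp_all
  \<comment> \<open>Coherence would make \<open>\<theta>\<close> the inverse of
    \<open>run K M\<close>. The possible defect \<open>u\<close> is absorbed by working with
    \<open>g = u \<cdot> f\<close> in place of \<open>f\<close>.\<close>
  define \<theta> where "\<theta> = ?b8 \<cdot> (ident K L \<boxdot> ?r)"
  have \<theta>: "ar \<theta>" "dm \<theta> = M" "cd \<theta> = M \<boxtimes> unt K"
    unfolding \<theta>_def M_def using isopD[OF a8] r L C by simp_all
  define u where "u = run K M \<cdot> \<theta>"
  define g where "g = u \<cdot> f"
  have g: "ar g" "dm g = X" "cd g = M" unfolding g_def u_def using \<theta> M f M_def by simp_all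
  define a where "a = asc K L C (D \<boxtimes> C)"
  have a: "ar a" "dm a = M \<boxtimes> (D \<boxtimes> C)" "cd a = L \<boxtimes> (C \<boxtimes> (D \<boxtimes> C))" unfolding a_def M_def using L C D by simp_all
  have co_asc: "ident K L \<boxdot> (ident K C \<boxdot> co) = a \<cdot> ((ident K M \<boxdot> co) \<cdot> ?b8)"
  proof (rule isop_epi[OF a8])
    have "(ident K L \<boxdot> (ident K C \<boxdot> co)) \<cdot> asc K L C (unt K) = asc K L C (D \<boxtimes> C) \<cdot> ((ident K L \<boxdot> ident K C) \<boxdot> co)"
      by (rule asc_natural[symmetric]) (use L C D co in simp_all)
    also have "\<dots> = a \<cdot> (ident K M \<boxdot> co)" unfolding a_def M_def using L C by (simp add: tensm_ident)
    also have "\<dots> = (a \<cdot> ((ident K M \<boxdot> co) \<cdot> ?b8)) \<cdot> asc K L C (unt K)"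
      using a co M isopD[OF a8] unfolding M_def by simp
    finally show "(ident K L \<boxdot> (ident K C \<boxdot> co)) \<cdot> asc K L C (unt K) = (a \<cdot> ((ident K M \<boxdot> co) \<cdot> ?b8)) \<cdot> asc K L C (unt K)" .
  qed (use L C D co a M isopD[OF a8] in \<open>simp_all add: M_def\<close>)
  have "run K M \<cdot> (\<theta> \<cdot> f) = run K M \<cdot> ((g \<boxdot> ident K (unt K)) \<cdot> inv_arrow K (X \<boxtimes> unt K) X (run K X))"
  proof -
    note rX = isopD[OF run_isop[OF X]]
    have "run K M \<cdot> ((g \<boxdot> ident K (unt K)) \<cdot> inv_arrow K (X \<boxtimes> unt K) X (run K X))
        = (run K M \<cdot> (g \<boxdot> ident K (unt K))) \<cdot> inv_arrow K (X \<boxtimes> unt K) X (run K X)"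
      using g rX M by simp
    also have "run K M \<cdot> (g \<boxdot> ident K (unt K)) = g \<cdot> run K X"
      by (rule run_natural) (use X M g in simp_all)
    also have "(g \<cdot> run K X) \<cdot> inv_arrow K (X \<boxtimes> unt K) X (run K X) = g" using g rX by simp
    also have "g = run K M \<cdot> (\<theta> \<cdot> f)" unfolding g_def u_def using \<theta> f M M_def by simp
    finally show ?thesis by (rule sym)
  qed
  then have \<theta>f: "\<theta> \<cdot> f = (g \<boxdot> ident K (unt K)) \<cdot> inv_arrow K (X \<boxtimes> unt K) X (run K X)"
    by (rule isop_mono[OF run_isop[OF M], rotated -1]) (use \<theta> f g X isopD[OF run_isop[OF X]] M_def in simp_all)
  \<comment> \<open>\<open>f\<close> is recovered from \<open>g\<close> through
    \<open>X \<boxtimes> (D \<boxtimes> C)\<close>, so it is enough that \<open>W\<close>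
    vanishes.\<close>
  define W where "W = (ident K L \<boxdot> rt) \<cdot> (a \<cdot> (g \<boxdot> ident K (D \<boxtimes> C)))"
  have fW: "f = W \<cdot> ((ident K X \<boxdot> co) \<cdot> inv_arrow K (X \<boxtimes> unt K) X (run K X))"
  proof -
    note rX = isopD[OF run_isop[OF X]]
    have "rt \<cdot> ((ident K C \<boxdot> co) \<cdot> ?r) = ident K C"
      using zz unfolding rt_def using ev co r b5 C D by simp
    then have "f = (ident K L \<boxdot> (rt \<cdot> ((ident K C \<boxdot> co) \<cdot> ?r))) \<cdot> f" using f L C by (simp add: tensm_ident)
    also have "ident K L \<boxdot> (rt \<cdot> ((ident K C \<boxdot> co) \<cdot> ?r))
        = (ident K L \<boxdot> rt) \<cdot> ((ident K L \<boxdot> (ident K C \<boxdot> co)) \<cdot> (ident K L \<boxdot> ?r))"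
      using interchange[of "ident K L" "ident K L" "(ident K C \<boxdot> co) \<cdot> ?r" rt]
        interchange[of "ident K L" "ident K L" ?r "ident K C \<boxdot> co"] L C co r rt by simp
    also have "(ident K L \<boxdot> (ident K C \<boxdot> co)) \<cdot> (ident K L \<boxdot> ?r) = a \<cdot> ((ident K M \<boxdot> co) \<cdot> \<theta>)"
      unfolding co_asc \<theta>_def using a co M isopD[OF a8] r L C by (simp add: M_def)
    also have "((ident K L \<boxdot> rt) \<cdot> (a \<cdot> ((ident K M \<boxdot> co) \<cdot> \<theta>))) \<cdot> f
        = (ident K L \<boxdot> rt) \<cdot> (a \<cdot> ((ident K M \<boxdot> co) \<cdot> (\<theta> \<cdot> f)))"
      using rt a co M \<theta> f L by (simp add: M_def)
    also have "(ident K M \<boxdot> co) \<cdot> (\<theta> \<cdot> f)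
        = ((ident K M \<boxdot> co) \<cdot> (g \<boxdot> ident K (unt K))) \<cdot> inv_arrow K (X \<boxtimes> unt K) X (run K X)"
      unfolding \<theta>f using co M g rX by simp
    also have "(ident K M \<boxdot> co) \<cdot> (g \<boxdot> ident K (unt K)) = (g \<boxdot> ident K (D \<boxtimes> C)) \<cdot> (ident K X \<boxdot> co)"
      using interchange[of g "ident K M" "ident K (unt K)" co] interchange[of "ident K X" g co "ident K (D \<boxtimes> C)"]
        g co M X D C by simp
    finally show ?thesis unfolding W_def using rt a g co rX X D C L M by simp
  qed
  have "W = zr (X \<boxtimes> (D \<boxtimes> C)) (L \<boxtimes> C)"
  proof (rule isop_epi[OF asc_isop[OF X D C]])
    \<comment> \<open>Up to the unit isomorphism \<open>e\<close> is the adjoint transpose of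
      \<open>g\<close>, so the hypothesis \<open>o\<close> kills it. The pentagon and
      triangle-shaped rearrangement below exhibits \<open>W\<close> as \<open>e\<close> tensored
      with \<open>C\<close>, up to structure isomorphisms.\<close>
    define e where "e = (ident K L \<boxdot> ev) \<cdot> (asc K L C D \<cdot> (g \<boxdot> ident K D))"
    have e: "ar e" "dm e = X \<boxtimes> D" "cd e = L \<boxtimes> unt K"
      unfolding e_def using ev g L C D by (simp_all add: M_def)
    have "run K L \<cdot> e = zr (X \<boxtimes> D) L" by (rule orthD[OF o]) (use e L in simp_all)
    then have "run K L \<cdot> e = run K L \<cdot> zr (X \<boxtimes> D) (L \<boxtimes> unt K)" using L X D by simp
    then have e0: "e = zr (X \<boxtimes> D) (L \<boxtimes> unt K)"
      by (rule isop_mono[OF run_isop[OF L], rotated -1]) (use e L X D in simp_all)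
    let ?g3 = "(g \<boxdot> ident K D) \<boxdot> ident K C"
    have n1: "(g \<boxdot> ident K (D \<boxtimes> C)) \<cdot> asc K X D C = asc K M D C \<cdot> ?g3"
      using asc_natural[of X D C M D C g "ident K D" "ident K C"] X D C M g by (simp add: tensm_ident)
    have rta: "rt \<cdot> asc K C D C = lun K C \<cdot> (ev \<boxdot> ident K C)"
      unfolding rt_def using ev b5 C D by simp
    have n2: "asc K L (unt K) C \<cdot> ((ident K L \<boxdot> ev) \<boxdot> ident K C) = (ident K L \<boxdot> (ev \<boxdot> ident K C)) \<cdot> asc K L (C \<boxtimes> D) C"
      by (rule asc_natural) (use L C D ev in simp_all)
    have pent: "(ident K L \<boxdot> asc K C D C) \<cdot> (asc K L (C \<boxtimes> D) C \<cdot> (asc K L C D \<boxdot> ident K C)) = a \<cdot> asc K M D C"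
      unfolding a_def M_def by (rule pentagon[OF L C D C])
    have "W \<cdot> asc K X D C = (ident K L \<boxdot> rt) \<cdot> (a \<cdot> ((g \<boxdot> ident K (D \<boxtimes> C)) \<cdot> asc K X D C))"
      unfolding W_def using rt a g X D C L M by simp
    also have "\<dots> = (ident K L \<boxdot> rt) \<cdot> ((a \<cdot> asc K M D C) \<cdot> ?g3)"
      unfolding n1 using a g M D C by simp
    also have "\<dots> = ((ident K L \<boxdot> rt) \<cdot> (ident K L \<boxdot> asc K C D C)) \<cdot> (asc K L (C \<boxtimes> D) C \<cdot> ((asc K L C D \<boxdot> ident K C) \<cdot> ?g3))"
      unfolding pent[symmetric] using rt g L C D M by (simp add: M_def)
    also have "(ident K L \<boxdot> rt) \<cdot> (ident K L \<boxdot> asc K C D C) = (ident K L \<boxdot> lun K C) \<cdot> (ident K L \<boxdot> (ev \<boxdot> ident K C))"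
      using interchange[of "ident K L" "ident K L" "asc K C D C" rt]
        interchange[of "ident K L" "ident K L" "ev \<boxdot> ident K C" "lun K C"] rta rt ev L C D by simp
    also have "((ident K L \<boxdot> lun K C) \<cdot> (ident K L \<boxdot> (ev \<boxdot> ident K C))) \<cdot> (asc K L (C \<boxtimes> D) C \<cdot> ((asc K L C D \<boxdot> ident K C) \<cdot> ?g3))
        = (ident K L \<boxdot> lun K C) \<cdot> (((ident K L \<boxdot> (ev \<boxdot> ident K C)) \<cdot> asc K L (C \<boxtimes> D) C) \<cdot> ((asc K L C D \<boxdot> ident K C) \<cdot> ?g3))"
      using ev g L C D M by (simp add: M_def)
    also have "\<dots> = (ident K L \<boxdot> lun K C) \<cdot> (asc K L (unt K) C \<cdot> (((ident K L \<boxdot> ev) \<boxdot> ident K C) \<cdot> ((asc K L C D \<boxdot> ident K C) \<cdot> ?g3)))"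
      unfolding n2[symmetric] using ev g L C D M by (simp add: M_def)
    also have "((ident K L \<boxdot> ev) \<boxdot> ident K C) \<cdot> ((asc K L C D \<boxdot> ident K C) \<cdot> ?g3) = e \<boxdot> ident K C"
      unfolding e_def
      using interchange[of "g \<boxdot> ident K D" "asc K L C D" "ident K C" "ident K C"]
        interchange[of "asc K L C D \<cdot> (g \<boxdot> ident K D)" "ident K L \<boxdot> ev" "ident K C" "ident K C"] ev g L C D M
      by (simp add: M_def)
    also have "(ident K L \<boxdot> lun K C) \<cdot> (asc K L (unt K) C \<cdot> (e \<boxdot> ident K C)) = zr (X \<boxtimes> D \<boxtimes> C) (L \<boxtimes> C)"
      unfolding e0 using L X C D by (simp add: zr_tens)
    finally show "W \<cdot> asc K X D C = zr (X \<boxtimes> (D \<boxtimes> C)) (L \<boxtimes> C) \<cdot> asc K X D C"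
      using X D C L by simp
  qed (use rt a g X D C L M in \<open>simp_all add: W_def\<close>)
  then show "f = zr X (L \<boxtimes> C)" unfolding fW using co isopD[OF run_isop[OF X]] X D C L by simp
qed

end

section \<open>Tensor ideals and localization of the unit\<close>

context rigidly_compactly_generated
begin

lemma Loc_tens:
  assumes "S \<subseteq> Ob K" "C \<in> Ob K" "\<And>A. A \<in> S \<Longrightarrow> A \<boxtimes> C \<in> S" "X \<in> Loc \<kappa> K S"
  shows "X \<boxtimes> C \<in> Loc \<kappa> K S"
proof -
  have "localizing \<kappa> K {X \<in> Ob K. X \<boxtimes> C \<in> Loc \<kappa> K S}"
    by (rule localizing_preimage[OF tens_exact_left[OF assms(2)] localizing_Loc[OF assms(1)]])
      (rule tens_coproduct_left[OF assms(2)])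
  moreover have "S \<subseteq> {X \<in> Ob K. X \<boxtimes> C \<in> Loc \<kappa> K S}" using assms(1,3) Loc_contains by blast
  ultimately show ?thesis using Loc_least assms(4) by blast
qed

lemma tens_dist:
  assumes "dist K A B C f g h" "D \<in> Ob K"
  obtains f' g' h' where "dist K (A \<boxtimes> D) (B \<boxtimes> D) (C \<boxtimes> D) f' g' h'"
  by (rule exact_functorE[OF tens_exact_left[OF assms(2)]]) (use assms(1) that in blast)

lemma L_unit_tens_zero:
  assumes T: "rickard_triangle \<kappa> K I (unt K) G L" and I: "I \<subseteq> cpt \<kappa> K"
    "\<And>A B f g. \<lbrakk>A \<in> I; isop A B f g\<rbrakk> \<Longrightarrow> B \<in> I"
    "\<And>A B. \<lbrakk>A \<in> I; B \<in> cpt \<kappa> K\<rbrakk> \<Longrightarrow> A \<boxtimes> B \<in> I" and C: "C \<in> I"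
  shows "zero_object K (L \<boxtimes> C)"
proof -
  have IO: "I \<subseteq> Ob K" using I(1) cpt_Ob by blast
  have Cc: "C \<in> cpt \<kappa> K" and CO: "C \<in> Ob K" using C I(1) IO by blast+
  obtain f g h where d: "dist K G (unt K) L f g h" and GL: "G \<in> Loc \<kappa> K I"
    and o': "\<forall>B\<in>Loc \<kappa> K I. Hom K B L = {zr B L}"
    using T unfolding rickard_triangle_def by (elim conjE exE) (rule that)
  have L: "L \<in> Ob K" using distD[OF d] by blast
  have LI: "localizing \<kappa> K (Loc \<kappa> K I)" by (rule localizing_Loc[OF IO])
  note T = triangulated_subD[OF localizing_sub[OF LI]]
  have o: "orth B L" if "B \<in> Loc \<kappa> K I" for B using o' that orth_iff[of B L] L T(1) by blast
  obtain f' g' h' where d': "dist K (G \<boxtimes> C) (unt K \<boxtimes> C) (L \<boxtimes> C) f' g' h'" using tens_dist[OF d CO] .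
  have "G \<boxtimes> C \<in> Loc \<kappa> K I" by (rule Loc_tens[OF IO CO I(3)[OF _ Cc] GL])
  moreover have "unt K \<boxtimes> C \<in> Loc \<kappa> K I"
    using I(2)[OF C isop_sym[OF lun_isop[OF CO]]] Loc_contains by blast
  ultimately have LC: "L \<boxtimes> C \<in> Loc \<kappa> K I" by (rule T(4)[OF d'])
  \<comment> \<open>It is the right dual of \<open>C\<close> that makes
    \<open>_ \<boxtimes> D\<close> left adjoint to \<open>_ \<boxtimes> C\<close>, as
    \<open>orth_dual\<close> requires.\<close>
  obtain D where D: "D \<in> cpt \<kappa> K" "left_dual K D C" using right_dual_exists[OF Cc] unfolding right_dual_def by blast
  have DO: "D \<in> Ob K" using D(1) cpt_Ob by blast
  have "(L \<boxtimes> C) \<boxtimes> D \<in> Loc \<kappa> K I" by (rule Loc_tens[OF IO DO I(3)[OF _ D(1)] LC])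
  then have oD: "orth ((L \<boxtimes> C) \<boxtimes> D) L" by (rule o)
  have "orth (L \<boxtimes> C) (L \<boxtimes> C)" by (rule orth_dual[OF D(2) L _ CO DO oD]) (use L CO in simp)
  then have "ident K (L \<boxtimes> C) = zr (L \<boxtimes> C) (L \<boxtimes> C)" by (rule orthD) (use L CO in simp_all)
  then show ?thesis by (rule zero_objectI[rotated]) (use L CO in simp)
qed

section \<open>The Balmer spectrum\<close>

lemma SpcD:
  assumes "P \<in> Spc \<kappa> K"
  shows "thick K P" "triangulated_sub K P" "P \<subseteq> cpt \<kappa> K"
    "\<And>A B. \<lbrakk>A \<in> P; B \<in> cpt \<kappa> K\<rbrakk> \<Longrightarrow> A \<boxtimes> B \<in> P" "\<And>A B. \<lbrakk>A \<in> P; B \<in> cpt \<kappa> K\<rbrakk> \<Longrightarrow> B \<boxtimes> A \<in> P"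
    "P \<noteq> cpt \<kappa> K"
proof -
  have t: "thick_ideal \<kappa> K P" "P \<noteq> cpt \<kappa> K" using assms unfolding Spc_def by blast+
  then show "thick K P" "P \<subseteq> cpt \<kappa> K" "P \<noteq> cpt \<kappa> K"
    and "\<And>A B. \<lbrakk>A \<in> P; B \<in> cpt \<kappa> K\<rbrakk> \<Longrightarrow> A \<boxtimes> B \<in> P" "\<And>A B. \<lbrakk>A \<in> P; B \<in> cpt \<kappa> K\<rbrakk> \<Longrightarrow> B \<boxtimes> A \<in> P"
    unfolding thick_ideal_def by blast+
  then show "triangulated_sub K P" unfolding thick_def by blast
qed

text \<open>An ideal containing the unit contains every compact object. The unit will start a
  descending chain of supports around a given prime.\<close>

lemma unt_notin: "P \<in> Spc \<kappa> K \<Longrightarrow> unt K \<notin> P"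
proof
  assume P: "P \<in> Spc \<kappa> K" and "unt K \<in> P"
  have "C \<in> P" if C: "C \<in> cpt \<kappa> K" for C
    by (rule triangulated_subD(2)[OF SpcD(2)[OF P] SpcD(4)[OF P \<open>unt K \<in> P\<close> C] lun_isop[OF cpt_Ob[OF C]]])
  then show False using SpcD(3,6)[OF P] by blast
qed

lemma Spc_biproduct:
  assumes P: "P \<in> Spc \<kappa> K" and b: "biproduct K A B X i j p q"
  shows "X \<in> P \<longleftrightarrow> A \<in> P \<and> B \<in> P"
proof
  show "A \<in> P \<and> B \<in> P" if "X \<in> P"
    using SpcD(1)[OF P] b that unfolding thick_def by blast
  show "X \<in> P" if "A \<in> P \<and> B \<in> P"
    using triangulated_sub_biproduct[OF SpcD(2)[OF P] b] that by blast
qed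

lemma Spc_open_eq: "Spc \<kappa> K - {P \<in> Spc \<kappa> K. P \<inter> S = {}} = {P \<in> Spc \<kappa> K. \<exists>A\<in>S. A \<in> P}"
  by blast

text \<open>The open sets of \<open>Spc_topology\<close> are given through the constructor
  \<open>topology\<close>, so they can be identified only after this check.\<close>

lemma istopology_Spc: "istopology (\<lambda>U. \<exists>S\<subseteq>cpt \<kappa> K. U = {P \<in> Spc \<kappa> K. \<exists>A\<in>S. A \<in> P})"
  unfolding istopology_def
proof (intro conjI allI impI)
  fix U V
  assume "\<exists>S\<subseteq>cpt \<kappa> K. U = {P \<in> Spc \<kappa> K. \<exists>A\<in>S. A \<in> P}"
    and "\<exists>S\<subseteq>cpt \<kappa> K. V = {P \<in> Spc \<kappa> K. \<exists>A\<in>S. A \<in> P}"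
  then obtain S T where S: "S \<subseteq> cpt \<kappa> K" "U = {P \<in> Spc \<kappa> K. \<exists>A\<in>S. A \<in> P}"
    and T: "T \<subseteq> cpt \<kappa> K" "V = {P \<in> Spc \<kappa> K. \<exists>A\<in>T. A \<in> P}"
    by (elim exE conjE) (rule that)
  \<comment> \<open>All biproducts are taken, so none has to be chosen; a prime contains one exactly
    when it contains both summands.\<close>
  define W where "W = {X. \<exists>A\<in>S. \<exists>B\<in>T. \<exists>i j p q. biproduct K A B X i j p q}"
  have "W \<subseteq> cpt \<kappa> K"
  proof
    fix X assume "X \<in> W"
    then obtain A B i j p q where "A \<in> S" "B \<in> T" and X: "biproduct K A B X i j p q"
      unfolding W_def by (elim CollectE bexE exE) (rule that)
    then have "A \<in> cpt \<kappa> K" "B \<in> cpt \<kappa> K" using S(1) T(1) by (simp_all add: subsetD)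
    then show "X \<in> cpt \<kappa> K" by (rule cpt_biproduct[OF _ _ X])
  qed
  moreover have "U \<inter> V = {P \<in> Spc \<kappa> K. \<exists>A\<in>W. A \<in> P}"
  proof (rule Set.set_eqI)
    fix P
    show "P \<in> U \<inter> V \<longleftrightarrow> P \<in> {P \<in> Spc \<kappa> K. \<exists>A\<in>W. A \<in> P}"
    proof
      assume "P \<in> U \<inter> V"
      then obtain A B where P: "P \<in> Spc \<kappa> K" and AB: "A \<in> S" "A \<in> P" "B \<in> T" "B \<in> P"
        unfolding S(2) T(2) by (elim IntE CollectE conjE bexE) (rule that)
      have "A \<in> Ob K" "B \<in> Ob K"
        using cpt_Ob[OF subsetD[OF SpcD(3)[OF P] AB(2)]] cpt_Ob[OF subsetD[OF SpcD(3)[OF P] AB(4)]] by simp_all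
      from biproduct_exists[OF this] obtain X i j p q where X: "biproduct K A B X i j p q" by (elim exE)
      have "X \<in> P" unfolding Spc_biproduct[OF P X] using AB by simp
      moreover have "X \<in> W" unfolding W_def using X AB by (intro CollectI bexI exI)
      ultimately show "P \<in> {P \<in> Spc \<kappa> K. \<exists>A\<in>W. A \<in> P}" using P by (intro CollectI conjI bexI)
    next
      assume "P \<in> {P \<in> Spc \<kappa> K. \<exists>A\<in>W. A \<in> P}"
      then obtain X where P: "P \<in> Spc \<kappa> K" and XW: "X \<in> W" and XP: "X \<in> P" by (elim CollectE conjE bexE)
      obtain A B i j p q where AB: "A \<in> S" "B \<in> T" and X: "biproduct K A B X i j p q"
        using XW unfolding W_def by (elim CollectE bexE exE) (rule that)
      have "A \<in> P" "B \<in> P" using XP unfolding Spc_biproduct[OF P X] by simp_all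
      then show "P \<in> U \<inter> V" unfolding S(2) T(2) using P AB by (intro IntI CollectI conjI bexI)
    qed
  qed
  ultimately show "\<exists>W\<subseteq>cpt \<kappa> K. U \<inter> V = {P \<in> Spc \<kappa> K. \<exists>A\<in>W. A \<in> P}"
    by (intro exI[of _ W] conjI)
next
  fix \<U> :: "'o set set set"
  assume U: "\<forall>U\<in>\<U>. \<exists>S\<subseteq>cpt \<kappa> K. U = {P \<in> Spc \<kappa> K. \<exists>A\<in>S. A \<in> P}"
  \<comment> \<open>An open set may come from many sets of objects; their union over all of them
    avoids a choice.\<close>
  define S where "S = \<Union>{S. S \<subseteq> cpt \<kappa> K \<and> {P \<in> Spc \<kappa> K. \<exists>A\<in>S. A \<in> P} \<in> \<U>}"
  have "\<Union>\<U> = {P \<in> Spc \<kappa> K. \<exists>A\<in>S. A \<in> P}"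
  proof
    show "\<Union>\<U> \<subseteq> {P \<in> Spc \<kappa> K. \<exists>A\<in>S. A \<in> P}"
    proof
      fix P assume "P \<in> \<Union>\<U>"
      then obtain V where V: "V \<in> \<U>" "P \<in> V" by (elim UnionE)
      obtain T where T: "T \<subseteq> cpt \<kappa> K" "V = {P \<in> Spc \<kappa> K. \<exists>A\<in>T. A \<in> P}"
        using bspec[OF U V(1)] by (elim exE conjE)
      have "T \<subseteq> S" unfolding S_def by (rule Union_upper) (use T V(1) in simp)
      then show "P \<in> {P \<in> Spc \<kappa> K. \<exists>A\<in>S. A \<in> P}" using V(2) unfolding T(2) by auto
    qed
    show "{P \<in> Spc \<kappa> K. \<exists>A\<in>S. A \<in> P} \<subseteq> \<Union>\<U>"
    proof
      fix P assume "P \<in> {P \<in> Spc \<kappa> K. \<exists>A\<in>S. A \<in> P}"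
      then obtain A where P: "P \<in> Spc \<kappa> K" and A: "A \<in> S" "A \<in> P" by (elim CollectE conjE bexE)
      obtain T where T: "A \<in> T" "{P \<in> Spc \<kappa> K. \<exists>A\<in>T. A \<in> P} \<in> \<U>"
        using A(1) unfolding S_def by (elim UnionE CollectE conjE)
      show "P \<in> \<Union>\<U>" by (rule UnionI[OF T(2)]) (use P A(2) T(1) in auto)
    qed
  qed
  moreover have "S \<subseteq> cpt \<kappa> K" unfolding S_def by (rule Union_least) simp
  ultimately show "\<exists>S\<subseteq>cpt \<kappa> K. \<Union>\<U> = {P \<in> Spc \<kappa> K. \<exists>A\<in>S. A \<in> P}"
    by (intro exI[of _ S] conjI)
qed

lemma openin_Spc:
  "openin (Spc_topology \<kappa> K) U \<longleftrightarrow> (\<exists>S\<subseteq>cpt \<kappa> K. U = {P \<in> Spc \<kappa> K. \<exists>A\<in>S. A \<in> P})"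
  unfolding Spc_topology_def Spc_open_eq by (simp only: topology_inverse'[OF istopology_Spc])

lemma openin_Spc_not_suppB:
  "C \<in> cpt \<kappa> K \<Longrightarrow> openin (Spc_topology \<kappa> K) {P \<in> Spc \<kappa> K. C \<in> P}"
  unfolding openin_Spc by (rule exI[of _ "{C}"]) simp

lemma topspace_Spc: "topspace (Spc_topology \<kappa> K) = Spc \<kappa> K"
proof
  obtain S where "topspace (Spc_topology \<kappa> K) = {P \<in> Spc \<kappa> K. \<exists>A\<in>S. A \<in> P}"
    using openin_topspace[of "Spc_topology \<kappa> K"] unfolding openin_Spc by (elim exE conjE)
  then show "topspace (Spc_topology \<kappa> K) \<subseteq> Spc \<kappa> K" by simp
  have "\<exists>A\<in>cpt \<kappa> K. A \<in> P" if P: "P \<in> Spc \<kappa> K" for P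
  proof -
    obtain Z where Z: "zero_object K Z" using zero_exists by (elim exE)
    have "Z \<in> P" by (rule triangulated_sub_zero[OF SpcD(2)[OF P] Z])
    then show ?thesis using SpcD(3)[OF P] by (intro bexI[of _ Z]) (simp_all add: subsetD)
  qed
  then have "Spc \<kappa> K = {P \<in> Spc \<kappa> K. \<exists>A\<in>cpt \<kappa> K. A \<in> P}" by auto
  then have "openin (Spc_topology \<kappa> K) (Spc \<kappa> K)" unfolding openin_Spc by (intro exI[of _ "cpt \<kappa> K"] conjI) simp_all
  then show "Spc \<kappa> K \<subseteq> topspace (Spc_topology \<kappa> K)" by (rule openin_subset)
qed

lemma closedin_suppB: "C \<in> cpt \<kappa> K \<Longrightarrow> closedin (Spc_topology \<kappa> K) (suppB \<kappa> K C)"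
proof -
  assume "C \<in> cpt \<kappa> K"
  then have "openin (Spc_topology \<kappa> K) {P \<in> Spc \<kappa> K. C \<in> P}" by (rule openin_Spc_not_suppB)
  moreover have "Spc \<kappa> K - suppB \<kappa> K C = {P \<in> Spc \<kappa> K. C \<in> P}" unfolding suppB_def by auto
  moreover have "suppB \<kappa> K C \<subseteq> Spc \<kappa> K" unfolding suppB_def by simp
  ultimately show ?thesis unfolding closedin_def topspace_Spc by simp
qed

text \<open>Open sets ask for membership of some object, so specialization leads to smaller primes,
  opposite to the convention for prime ideals of a ring.\<close>

lemma in_closure_Spc:
  assumes "P \<in> Spc \<kappa> K" "Q \<in> Spc \<kappa> K"
  shows "Q \<in> Spc_topology \<kappa> K closure_of {P} \<longleftrightarrow> Q \<subseteq> P"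
proof
  assume "Q \<in> Spc_topology \<kappa> K closure_of {P}"
  then have Q: "\<And>U. \<lbrakk>Q \<in> U; openin (Spc_topology \<kappa> K) U\<rbrakk> \<Longrightarrow> P \<in> U" by (simp add: in_closure_of)
  show "Q \<subseteq> P"
  proof
    fix A assume A: "A \<in> Q"
    have "A \<in> cpt \<kappa> K" by (rule subsetD[OF SpcD(3)[OF assms(2)] A])
    then have "openin (Spc_topology \<kappa> K) {P \<in> Spc \<kappa> K. A \<in> P}" by (rule openin_Spc_not_suppB)
    then have "P \<in> {P \<in> Spc \<kappa> K. A \<in> P}" by (rule Q[rotated]) (use A assms(2) in simp)
    then show "A \<in> P" by simp
  qed
next
  assume QP: "Q \<subseteq> P"
  have "P \<in> U" if Q: "Q \<in> U" and U: "openin (Spc_topology \<kappa> K) U" for U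
  proof -
    obtain S where "U = {P \<in> Spc \<kappa> K. \<exists>A\<in>S. A \<in> P}" using U unfolding openin_Spc by (elim exE conjE)
    then show ?thesis using Q QP assms(1) by auto
  qed
  then show "Q \<in> Spc_topology \<kappa> K closure_of {P}" unfolding in_closure_of topspace_Spc using assms(2) by simp
qed

lemma closure_Spc: "P \<in> Spc \<kappa> K \<Longrightarrow> Spc_topology \<kappa> K closure_of {P} = {Q \<in> Spc \<kappa> K. Q \<subseteq> P}"
  using in_closure_Spc[of P] closure_of_subset_topspace[of "Spc_topology \<kappa> K" "{P}"] unfolding topspace_Spc by blast

lemma Vset_eq: "P \<in> Spc \<kappa> K \<Longrightarrow> Vset \<kappa> K P = {Q \<in> Spc \<kappa> K. Q \<subseteq> P}"
  unfolding Vset_def by (rule closure_Spc)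

lemma Zset_eq: "P \<in> Spc \<kappa> K \<Longrightarrow> Zset \<kappa> K P = {Q \<in> Spc \<kappa> K. \<not> P \<subseteq> Q}"
  unfolding Zset_def using in_closure_Spc by blast

lemma suppB_isop:
  assumes "isop A B f g"
  shows "suppB \<kappa> K A = suppB \<kappa> K B"
proof -
  have "A \<in> P \<longleftrightarrow> B \<in> P" if "P \<in> Spc \<kappa> K" for P
    using triangulated_subD(2)[OF SpcD(2)[OF that]] assms isop_sym[OF assms] by blast
  then show ?thesis unfolding suppB_def by blast
qed

lemma suppB_sh: "A \<in> Ob K \<Longrightarrow> suppB \<kappa> K (sh K A) = suppB \<kappa> K A"
proof -
  assume A: "A \<in> Ob K"
  have "sh K A \<in> P \<longleftrightarrow> A \<in> P" if "P \<in> Spc \<kappa> K" for P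
    by (rule triangulated_subD(3)[OF SpcD(2)[OF that] A])
  then show ?thesis unfolding suppB_def by blast
qed

lemma suppB_tens:
  "\<lbrakk>A \<in> cpt \<kappa> K; B \<in> cpt \<kappa> K\<rbrakk> \<Longrightarrow> suppB \<kappa> K (A \<boxtimes> B) \<subseteq> suppB \<kappa> K A \<inter> suppB \<kappa> K B"
  unfolding suppB_def using SpcD(4,5) by blast

section \<open>Compact objects supported in a given set of primes\<close>

lemma Theta_cpt: "Theta \<kappa> K S \<subseteq> cpt \<kappa> K"
  unfolding Theta_def by blast

lemma Theta_isop: "\<lbrakk>A \<in> Theta \<kappa> K S; isop A B f g\<rbrakk> \<Longrightarrow> B \<in> Theta \<kappa> K S"
  unfolding Theta_def using suppB_isop[of A B f g] cpt_iso[of A \<kappa> B f g] by blast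

lemma Theta_tens:
  "\<lbrakk>A \<in> Theta \<kappa> K S; B \<in> cpt \<kappa> K\<rbrakk> \<Longrightarrow> A \<boxtimes> B \<in> Theta \<kappa> K S"
  "\<lbrakk>A \<in> Theta \<kappa> K S; B \<in> cpt \<kappa> K\<rbrakk> \<Longrightarrow> B \<boxtimes> A \<in> Theta \<kappa> K S"
  unfolding Theta_def using suppB_tens tens_cpt by blast+

lemma Theta_sh_closed: "sh_closed (Theta \<kappa> K S)"
  unfolding sh_closed_def
proof (intro conjI ballI)
  show "Theta \<kappa> K S \<subseteq> Ob K" using Theta_cpt cpt_Ob by blast
  fix C assume C: "C \<in> Theta \<kappa> K S"
  then have Cc: "C \<in> cpt \<kappa> K" "suppB \<kappa> K C \<subseteq> S" unfolding Theta_def by blast+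
  show "sh K C \<in> Theta \<kappa> K S"
    unfolding Theta_def using cpt_sh[OF Cc(1)] suppB_sh[OF cpt_Ob[OF Cc(1)]] Cc(2) by simp
  obtain C' u v where C': "C' \<in> cpt \<kappa> K" "isop (sh K C') C u v" using desuspend_cpt[OF Cc(1)] .
  have "suppB \<kappa> K C' = suppB \<kappa> K C" using suppB_sh[OF cpt_Ob[OF C'(1)]] suppB_isop[OF C'(2)] by simp
  then have "C' \<in> Theta \<kappa> K S" unfolding Theta_def using C'(1) Cc(2) by simp
  then show "\<exists>C'\<in>Theta \<kappa> K S. \<exists>f g. isop (sh K C') C f g" using C'(2) by blast
qed

text \<open>Existence makes the choice in \<open>Rickard\<close> meaningful; later arguments use
  only the triangle and its orthogonality.\<close>

lemma Rickard_Theta: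
  assumes "A \<in> Ob K"
  shows "rickard_triangle \<kappa> K (Theta \<kappa> K S) A (Gamma_ideal \<kappa> K (Theta \<kappa> K S) A) (L_ideal \<kappa> K (Theta \<kappa> K S) A)"
proof -
  have "\<exists>G L. rickard_triangle \<kappa> K (Theta \<kappa> K S) A G L"
    by (rule rickard_ex[OF Theta_cpt _ Theta_sh_closed assms]) (rule Theta_isop)
  then obtain G L where "rickard_triangle \<kappa> K (Theta \<kappa> K S) A G L" by (elim exE)
  then have "case (G, L) of (G, L) \<Rightarrow> rickard_triangle \<kappa> K (Theta \<kappa> K S) A G L" by simp
  then have "case Rickard \<kappa> K (Theta \<kappa> K S) A of (G, L) \<Rightarrow> rickard_triangle \<kappa> K (Theta \<kappa> K S) A G L"
    unfolding Rickard_def by (rule someI)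
  then show ?thesis unfolding Gamma_ideal_def L_ideal_def by (simp add: case_prod_beta)
qed

section \<open>Extensions of the Balmer support\<close>

context
  fixes \<sigma> :: "'o \<Rightarrow> 'o set set"
  assumes ext: "support_extension \<kappa> K \<sigma>"
begin

lemma ext_Spc: "A \<in> Ob K \<Longrightarrow> \<sigma> A \<subseteq> Spc \<kappa> K"
  and ext_cpt: "A \<in> cpt \<kappa> K \<Longrightarrow> \<sigma> A = suppB \<kappa> K A"
  and ext_sh: "A \<in> Ob K \<Longrightarrow> \<sigma> (sh K A) = \<sigma> A"
  and ext_dist: "dist K A B C f g h \<Longrightarrow> \<sigma> A \<subseteq> \<sigma> B \<union> \<sigma> C"
  and ext_tens: "\<lbrakk>A \<in> Ob K; B \<in> Ob K\<rbrakk> \<Longrightarrow> \<sigma> (A \<boxtimes> B) \<subseteq> \<sigma> A \<inter> \<sigma> B"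
proof -
  note e = ext[unfolded support_extension_def]
  have "\<forall>A\<in>Ob K. \<sigma> A \<subseteq> Spc \<kappa> K" using e by (elim conjE)
  then show "A \<in> Ob K \<Longrightarrow> \<sigma> A \<subseteq> Spc \<kappa> K" by (rule bspec)
  have "\<forall>A\<in>cpt \<kappa> K. \<sigma> A = suppB \<kappa> K A" using e by (elim conjE)
  then show "A \<in> cpt \<kappa> K \<Longrightarrow> \<sigma> A = suppB \<kappa> K A" by (rule bspec)
  have "\<forall>A\<in>Ob K. \<sigma> (sh K A) = \<sigma> A" using e by (elim conjE)
  then show "A \<in> Ob K \<Longrightarrow> \<sigma> (sh K A) = \<sigma> A" by (rule bspec)
  have "\<forall>A B C f g h. dist K A B C f g h \<longrightarrow> \<sigma> A \<subseteq> \<sigma> B \<union> \<sigma> C" using e by (elim conjE)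
  then show "dist K A B C f g h \<Longrightarrow> \<sigma> A \<subseteq> \<sigma> B \<union> \<sigma> C" by blast
  have "\<forall>A\<in>Ob K. \<forall>B\<in>Ob K. \<sigma> (A \<boxtimes> B) \<subseteq> \<sigma> A \<inter> \<sigma> B" using e by (elim conjE)
  then show "\<lbrakk>A \<in> Ob K; B \<in> Ob K\<rbrakk> \<Longrightarrow> \<sigma> (A \<boxtimes> B) \<subseteq> \<sigma> A \<inter> \<sigma> B" by simp
qed

lemma ext_coproduct: "\<lbrakk>small \<kappa> (I :: 'i set); coproduct K I A X \<iota>\<rbrakk> \<Longrightarrow> \<sigma> X = (\<Union>i\<in>I. \<sigma> (A i))"
proof -
  assume I: "small \<kappa> (I :: 'i set)" "coproduct K I A X \<iota>"
  have "\<forall>(I::'i set) A X \<iota>. small \<kappa> I \<and> coproduct K I A X \<iota> \<longrightarrow> \<sigma> X = (\<Union>i\<in>I. \<sigma> (A i))"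
    using ext unfolding support_extension_def by (elim conjE)
  then show ?thesis by (elim allE[of _ I] allE[of _ A] allE[of _ X] allE[of _ \<iota>]) (use I in simp)
qed

lemma ext_isop:
  assumes "isop A B f g"
  shows "\<sigma> A = \<sigma> B"
  using ext_coproduct[OF small_finite[OF size_bound] singleton_coproduct[OF assms, of undefined]] by simp

lemma ext_zero: "zero_object K Z \<Longrightarrow> \<sigma> Z = {}"
  using ext_coproduct[OF small_finite[OF size_bound] empty_coproduct[of Z]] by simp

lemma ext_dist2:
  assumes "dist K A B C f g h"
  shows "\<sigma> B \<subseteq> \<sigma> A \<union> \<sigma> C" "\<sigma> C \<subseteq> \<sigma> A \<union> \<sigma> B"
  using ext_dist[OF rotate[OF assms]] ext_dist[OF rotate[OF rotate[OF assms]]] ext_sh distD(1,2)[OF assms]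
  by blast+

lemma ext_biproduct:
  assumes "biproduct K A B X i j p q"
  shows "\<sigma> X = \<sigma> A \<union> \<sigma> B"
proof -
  obtain a b :: 'i where ab: "a \<noteq> b" using two_indices[OF size_bound] .
  have "\<sigma> X = (\<Union>n\<in>{a, b}. \<sigma> (if n = a then A else B))"
    by (rule ext_coproduct[OF small_finite[OF size_bound] biproduct_coproduct[OF assms ab]]) simp
  then show ?thesis using ab by auto
qed

lemma ext_localizing: "localizing \<kappa> K {X \<in> Ob K. \<sigma> X \<subseteq> W}"
proof (rule localizingI)
  show "Z \<in> {X \<in> Ob K. \<sigma> X \<subseteq> W}" if "zero_object K Z" for Z using ext_zero[OF that] that by simp
  show "B \<in> {X \<in> Ob K. \<sigma> X \<subseteq> W}" if "A \<in> {X \<in> Ob K. \<sigma> X \<subseteq> W}" "isop A B f g" for A B f g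
    using ext_isop[OF that(2)] that(1) isopD(10)[OF that(2)] by simp
  show "sh K A \<in> {X \<in> Ob K. \<sigma> X \<subseteq> W}" if "A \<in> {X \<in> Ob K. \<sigma> X \<subseteq> W}" for A using that ext_sh by simp
  show "A \<in> {X \<in> Ob K. \<sigma> X \<subseteq> W}" if "A \<in> Ob K" "sh K A \<in> {X \<in> Ob K. \<sigma> X \<subseteq> W}" for A using that ext_sh by simp
  show "C \<in> {X \<in> Ob K. \<sigma> X \<subseteq> W}"
    if "dist K A B C f g h" "A \<in> {X \<in> Ob K. \<sigma> X \<subseteq> W}" "B \<in> {X \<in> Ob K. \<sigma> X \<subseteq> W}" for A B C f g h
    using ext_dist2(2)[OF that(1)] that(2,3) distD(3)[OF that(1)] by blast
  show "A \<in> {X \<in> Ob K. \<sigma> X \<subseteq> W} \<and> B \<in> {X \<in> Ob K. \<sigma> X \<subseteq> W}"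
    if "biproduct K A B X i j p q" "X \<in> {X \<in> Ob K. \<sigma> X \<subseteq> W}" for A B X i j p q
    using ext_biproduct[OF that(1)] that(2) biproductD(1,2)[OF that(1)] by simp
  show "X \<in> {X \<in> Ob K. \<sigma> X \<subseteq> W}"
    if "small \<kappa> I" "coproduct K I A X \<iota>" "\<And>i. i \<in> I \<Longrightarrow> A i \<in> {X \<in> Ob K. \<sigma> X \<subseteq> W}" for I :: "'i set" and A X \<iota>
    using ext_coproduct[OF that(1,2)] that(3) coproductD(1)[OF that(2)] by blast
qed blast

lemma ext_Gamma: "\<sigma> (Gamma_ideal \<kappa> K (Theta \<kappa> K S) (unt K)) \<subseteq> S"
proof -
  have "Theta \<kappa> K S \<subseteq> {X \<in> Ob K. \<sigma> X \<subseteq> S}" unfolding Theta_def using cpt_Ob ext_cpt by blast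
  then have "Loc \<kappa> K (Theta \<kappa> K S) \<subseteq> {X \<in> Ob K. \<sigma> X \<subseteq> S}" by (rule Loc_least[OF ext_localizing])
  then show ?thesis using Rickard_Theta[OF unt_Ob, of S] unfolding rickard_triangle_def by blast
qed

section \<open>Tensorial extensions\<close>

context
  assumes tensorial: "tensorial \<kappa> K \<sigma>"
begin

lemma tensorialD:
  assumes "A \<in> Ob K" "C \<in> cpt \<kappa> K" "P \<in> \<sigma> A" "P \<in> \<sigma> C"
  obtains B where "B \<in> cpt \<kappa> K" "P \<in> \<sigma> (A \<boxtimes> B \<boxtimes> C)"
  using tensorial assms unfolding tensorial_def by blast

text \<open>Otherwise supports around \<open>Q\<close> could be cut down forever. If
  \<open>R\<close> lies in the support of \<open>C\<close> but not in the closure of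
  \<open>Q\<close>, some \<open>A\<close> lies in \<open>R\<close> and not in \<open>Q\<close>.
  Tensoriality, which on compact objects speaks of the Balmer support, gives \<open>B\<close> such
  that \<open>C \<boxtimes> B \<boxtimes> A\<close> still has \<open>Q\<close> in its support,
  whereas \<open>R\<close> is lost. The resulting strict chain of closed sets contradicts the
  Noetherian hypothesis.\<close>

lemma suppB_basis:
  assumes N: "Spc_Noetherian \<kappa> K" and Q: "Q \<in> Spc \<kappa> K"
  shows "\<exists>C\<in>cpt \<kappa> K. Q \<in> suppB \<kappa> K C \<and> suppB \<kappa> K C \<subseteq> {R \<in> Spc \<kappa> K. R \<subseteq> Q}"
proof (rule ccontr)
  assume "\<not> ?thesis"
  then have no: "\<not> suppB \<kappa> K C \<subseteq> {R \<in> Spc \<kappa> K. R \<subseteq> Q}" if "C \<in> cpt \<kappa> K" "Q \<in> suppB \<kappa> K C" for C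
    using that by blast
  let ?P = "\<lambda>C. C \<in> cpt \<kappa> K \<and> Q \<in> suppB \<kappa> K C"
  have "\<exists>c. \<forall>n. ?P (c n) \<and> suppB \<kappa> K (c (Suc n)) \<subset> suppB \<kappa> K (c n)"
  proof (rule dependent_nat_choice)
    show "\<exists>C. ?P C" using unt_cpt unt_notin[OF Q] Q unfolding suppB_def by blast
  next
    fix C and n :: nat assume C: "?P C"
    then obtain R where R: "R \<in> suppB \<kappa> K C" "R \<notin> {R \<in> Spc \<kappa> K. R \<subseteq> Q}" using no[of C] by (auto simp: subset_eq)
    have RS: "R \<in> Spc \<kappa> K" using R(1) unfolding suppB_def by simp
    obtain A where A: "A \<in> R" "A \<notin> Q" using R(2) RS by auto
    have Ac: "A \<in> cpt \<kappa> K" using A(1) SpcD(3)[OF RS] by blast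
    have Cc: "C \<in> cpt \<kappa> K" using C by blast
    have QC: "Q \<in> \<sigma> C" "Q \<in> \<sigma> A" using C A(2) Q ext_cpt[OF Cc] ext_cpt[OF Ac] unfolding suppB_def by simp_all
    obtain B where B: "B \<in> cpt \<kappa> K" "Q \<in> \<sigma> (C \<boxtimes> B \<boxtimes> A)" using tensorialD[OF cpt_Ob[OF Cc] Ac QC] .
    have D: "C \<boxtimes> B \<in> cpt \<kappa> K" "C \<boxtimes> B \<boxtimes> A \<in> cpt \<kappa> K" using tens_cpt Cc B(1) Ac by blast+
    have sub: "suppB \<kappa> K (C \<boxtimes> B \<boxtimes> A) \<subseteq> suppB \<kappa> K C \<inter> suppB \<kappa> K A"
      using suppB_tens[OF D(1) Ac] suppB_tens[OF Cc B(1)] by blast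
    have "R \<notin> suppB \<kappa> K A" using A(1) unfolding suppB_def by blast
    then have "suppB \<kappa> K (C \<boxtimes> B \<boxtimes> A) \<subset> suppB \<kappa> K C" using sub R(1) by blast
    moreover have "?P (C \<boxtimes> B \<boxtimes> A)" using D(2) B(2) ext_cpt[OF D(2)] by simp
    ultimately show "\<exists>C'. ?P C' \<and> suppB \<kappa> K C' \<subset> suppB \<kappa> K C" by blast
  qed
  then obtain c where "\<forall>n. ?P (c n) \<and> suppB \<kappa> K (c (Suc n)) \<subset> suppB \<kappa> K (c n)" by (elim exE)
  then have c: "\<And>n. c n \<in> cpt \<kappa> K" "\<And>n. suppB \<kappa> K (c (Suc n)) \<subset> suppB \<kappa> K (c n)" by simp_all
  have "decseq (\<lambda>n. suppB \<kappa> K (c n))" by (rule decseq_SucI) (rule psubset_imp_subset[OF c(2)])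
  then have 1: "(\<forall>n. closedin (Spc_topology \<kappa> K) (suppB \<kappa> K (c n))) \<and> decseq (\<lambda>n. suppB \<kappa> K (c n))"
    using closedin_suppB[OF c(1)] by simp
  have 2: "\<forall>F. (\<forall>n. closedin (Spc_topology \<kappa> K) (F n)) \<and> decseq F \<longrightarrow> (\<exists>N. \<forall>n\<ge>N. F n = F N)"
    using N unfolding Spc_Noetherian_def noetherian_space_def .
  have "\<exists>N. \<forall>n\<ge>N. suppB \<kappa> K (c n) = suppB \<kappa> K (c N)"
    by (rule mp[OF spec[OF 2, of "\<lambda>n. suppB \<kappa> K (c n)"] 1])
  then obtain N where n: "\<forall>n\<ge>N. suppB \<kappa> K (c n) = suppB \<kappa> K (c N)" by (elim exE)
  have "suppB \<kappa> K (c (Suc N)) = suppB \<kappa> K (c N)" by (rule n[rule_format]) simp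
  then show False using c(2)[of N] by simp
qed

lemma ext_L:
  assumes N: "Spc_Noetherian \<kappa> K" and S: "\<And>Q R. \<lbrakk>Q \<in> S; R \<in> Spc \<kappa> K; R \<subseteq> Q\<rbrakk> \<Longrightarrow> R \<in> S" "S \<subseteq> Spc \<kappa> K"
  shows "\<sigma> (L_ideal \<kappa> K (Theta \<kappa> K S) (unt K)) \<inter> S = {}"
proof -
  define I where "I = Theta \<kappa> K S"
  define G where "G = Gamma_ideal \<kappa> K I (unt K)"
  define L where "L = L_ideal \<kappa> K I (unt K)"
  have T: "rickard_triangle \<kappa> K I (unt K) G L" unfolding G_def L_def I_def by (rule Rickard_Theta[OF unt_Ob])
  then obtain f g h where "dist K G (unt K) L f g h" unfolding rickard_triangle_def by (elim conjE exE) (rule that)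
  then have LO: "L \<in> Ob K" by (rule distD(3))
  have "Q \<notin> \<sigma> L" if Q: "Q \<in> S" for Q
  proof
    assume QL: "Q \<in> \<sigma> L"
    have QS: "Q \<in> Spc \<kappa> K" using Q S(2) by blast
    obtain C where C: "C \<in> cpt \<kappa> K" "Q \<in> suppB \<kappa> K C" "suppB \<kappa> K C \<subseteq> {R \<in> Spc \<kappa> K. R \<subseteq> Q}"
      using suppB_basis[OF N QS] by blast
    have CI: "C \<in> I" unfolding I_def Theta_def using C(1,3) S(1)[OF Q] by blast
    have QC: "Q \<in> \<sigma> C" using C(2) ext_cpt[OF C(1)] by simp
    obtain B where B: "B \<in> cpt \<kappa> K" "Q \<in> \<sigma> (L \<boxtimes> B \<boxtimes> C)" using tensorialD[OF LO C(1) QL QC] .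
    \<comment> \<open>The factor \<open>B\<close> inserted by tensoriality is absorbed into the
      ideal, so the vanishing result applies to \<open>B \<boxtimes> C\<close> in place of
      \<open>C\<close>.\<close>
    have "B \<boxtimes> C \<in> I" unfolding I_def by (rule Theta_tens(2)[OF CI[unfolded I_def] B(1)])
    then have "zero_object K (L \<boxtimes> (B \<boxtimes> C))"
      by (rule L_unit_tens_zero[OF T _ _ _, rotated -1]) (unfold I_def, rule Theta_cpt, erule (1) Theta_isop, erule (1) Theta_tens(1))
    then have "\<sigma> (L \<boxtimes> B \<boxtimes> C) = {}"
      using ext_isop[OF asc_isop[OF LO cpt_Ob[OF B(1)] cpt_Ob[OF C(1)]]] ext_zero by simp
    then show False using B(2) by blast
  qed
  then show ?thesis unfolding L_def I_def by blast
qed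

text \<open>The tensor axiom gives the upper bound. For the lower bound \<open>P\<close> is traced
  through the two triangles, tensored with \<open>A\<close> and with
  \<open>LZ \<boxtimes> A\<close>: it belongs to the support of the middle term and in each case is
  excluded from that of one outer term, so it lies in the other.\<close>

lemma ext_Gamma_point:
  assumes N: "Spc_Noetherian \<kappa> K" and P: "P \<in> Spc \<kappa> K" and A: "A \<in> Ob K"
  shows "Gamma_point \<kappa> K P A \<in> Ob K" "\<sigma> (Gamma_point \<kappa> K P A) = {P} \<inter> \<sigma> A"
proof -
  let ?V = "Vset \<kappa> K P" and ?Z = "Zset \<kappa> K P"
  define GV where "GV = Gamma_ideal \<kappa> K (Theta \<kappa> K ?V) (unt K)"
  define LV where "LV = L_ideal \<kappa> K (Theta \<kappa> K ?V) (unt K)"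
  define GZ where "GZ = Gamma_ideal \<kappa> K (Theta \<kappa> K ?Z) (unt K)"
  define LZ where "LZ = L_ideal \<kappa> K (Theta \<kappa> K ?Z) (unt K)"
  have "rickard_triangle \<kappa> K (Theta \<kappa> K ?V) (unt K) GV LV" unfolding GV_def LV_def by (rule Rickard_Theta[OF unt_Ob])
  then obtain f g h where TV: "dist K GV (unt K) LV f g h"
    unfolding rickard_triangle_def by (elim conjE exE) (rule that)
  have "rickard_triangle \<kappa> K (Theta \<kappa> K ?Z) (unt K) GZ LZ" unfolding GZ_def LZ_def by (rule Rickard_Theta[OF unt_Ob])
  then obtain f' g' h' where TZ: "dist K GZ (unt K) LZ f' g' h'"
    unfolding rickard_triangle_def by (elim conjE exE) (rule that)
  note DV = distD[OF TV] and DZ = distD[OF TZ]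
  have sGV: "\<sigma> GV \<subseteq> ?V" unfolding GV_def by (rule ext_Gamma)
  have sGZ: "\<sigma> GZ \<subseteq> ?Z" unfolding GZ_def by (rule ext_Gamma)
  have sLV: "\<sigma> LV \<inter> ?V = {}" unfolding LV_def by (rule ext_L[OF N]) (auto simp: Vset_eq[OF P])
  have sLZ: "\<sigma> LZ \<inter> ?Z = {}" unfolding LZ_def by (rule ext_L[OF N]) (auto simp: Zset_eq[OF P])
  have PV: "P \<in> ?V" and PZ: "P \<notin> ?Z" using P by (simp_all add: Vset_eq Zset_eq)
  have G: "Gamma_point \<kappa> K P A = GV \<boxtimes> LZ \<boxtimes> A" unfolding Gamma_point_def GV_def LZ_def ..
  show "Gamma_point \<kappa> K P A \<in> Ob K" unfolding G using DV(1) DZ(3) A by simp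
  have "\<sigma> (GV \<boxtimes> LZ \<boxtimes> A) \<subseteq> \<sigma> GV \<inter> \<sigma> LZ \<inter> \<sigma> A"
    using ext_tens[of "GV \<boxtimes> LZ" A] ext_tens[OF DV(1) DZ(3)] DV(1) DZ(3) A by auto
  \<comment> \<open>\<open>?V\<close> holds the primes contained in \<open>P\<close>, and outside
    \<open>?Z\<close> are those containing \<open>P\<close>.\<close>
  moreover have "?V - ?Z \<subseteq> {P}" using P by (auto simp: Vset_eq Zset_eq)
  ultimately have 1: "\<sigma> (Gamma_point \<kappa> K P A) \<subseteq> {P} \<inter> \<sigma> A" unfolding G using sGV sLZ by blast
  have "P \<in> \<sigma> (Gamma_point \<kappa> K P A)" if PA: "P \<in> \<sigma> A"
  proof -
    have B: "LZ \<boxtimes> A \<in> Ob K" using DZ(3) A by simp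
    obtain f1 g1 h1 where T1: "dist K (GZ \<boxtimes> A) (unt K \<boxtimes> A) (LZ \<boxtimes> A) f1 g1 h1" using tens_dist[OF TZ A] .
    have "\<sigma> (unt K \<boxtimes> A) = \<sigma> A" by (rule ext_isop[OF lun_isop[OF A]])
    moreover have "P \<notin> \<sigma> (GZ \<boxtimes> A)" using ext_tens[OF DZ(1) A] sGZ PZ by blast
    ultimately have PB: "P \<in> \<sigma> (LZ \<boxtimes> A)" using ext_dist2(1)[OF T1] PA by blast
    obtain f2 g2 h2 where T2: "dist K (GV \<boxtimes> (LZ \<boxtimes> A)) (unt K \<boxtimes> (LZ \<boxtimes> A)) (LV \<boxtimes> (LZ \<boxtimes> A)) f2 g2 h2"
      using tens_dist[OF TV B] .
    have "\<sigma> (unt K \<boxtimes> (LZ \<boxtimes> A)) = \<sigma> (LZ \<boxtimes> A)" by (rule ext_isop[OF lun_isop[OF B]])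
    moreover have "P \<notin> \<sigma> (LV \<boxtimes> (LZ \<boxtimes> A))" using ext_tens[OF DV(3) B] sLV PV by blast
    ultimately have "P \<in> \<sigma> (GV \<boxtimes> (LZ \<boxtimes> A))" using ext_dist2(1)[OF T2] PB by blast
    then show ?thesis unfolding G using ext_isop[OF asc_isop[OF DV(1) DZ(3) A]] by simp
  qed
  then show "\<sigma> (Gamma_point \<kappa> K P A) = {P} \<inter> \<sigma> A" using 1 by blast
qed

end

end

end

theorem proposition5p12:
  fixes \<kappa> :: "'i rel" and K :: "('o, 'm) mtcat" and \<sigma> :: "'o \<Rightarrow> 'o set set"
  assumes "rigidly_compactly_generated \<kappa> K"
    and "Spc_Noetherian \<kappa> K"
    and "support_extension \<kappa> K \<sigma>"
    and "faithful K \<sigma>"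
    and "tensorial \<kappa> K \<sigma>"
  shows "\<forall>A\<in>Ob K. \<sigma> A = SuppB \<kappa> K A"
proof
  interpret rigidly_compactly_generated \<kappa> K by (rule assms(1))
  fix A assume A: "A \<in> Ob K"
  have "P \<in> \<sigma> A \<longleftrightarrow> \<not> zero_object K (Gamma_point \<kappa> K P A)" if P: "P \<in> Spc \<kappa> K" for P
  proof -
    note G = ext_Gamma_point[OF assms(3,5,2) P A]
    \<comment> \<open>Faithfulness gives one direction; the other holds because a zero object is an
      empty coproduct.\<close>
    have "zero_object K (Gamma_point \<kappa> K P A) \<longleftrightarrow> \<sigma> (Gamma_point \<kappa> K P A) = {}"
      using ext_zero[OF assms(3)] assms(4) G(1) unfolding faithful_def by blast
    then show ?thesis unfolding G(2) by blast
  qed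
  then show "\<sigma> A = SuppB \<kappa> K A" unfolding SuppB_def using ext_Spc[OF assms(3) A] by blast
qed

end
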